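(* Let $M$ be a closed Riemannian manifold of dimension four, let $\omega$ be a symplectic form on $M$, and let $f: M\to M$ be a $C^2$ partially hyperbolic symplectomorphism of $(M,\omega)$ with partially hyperbolic splitting $TM=\mathbb{E}^s\oplus\mathbb{E}^c\oplus\mathbb{E}^u$, where $\mathbb{E}^s$ and $\mathbb{E}^u$ are line bundles (one-dimensional). If $\mathbb{E}^s$ and $\mathbb{E}^u$ are $C^1$, then $f$ is dynamically coherent. Moreover, the center foliation (the foliation tangent to $\mathbb{E}^c$) is $C^1$.
   Context: A symplectic form $\omega$ on $M$ is a closed nondegenerate $2$-form. A $C^1$ diffeomorphism $f:M\to M$ of a closed Riemannian manifold is partially hyperbolic if there is a continuous splitting $T_pM=\mathbb{E}^s(p)\oplus\mathbb{E}^c(p)\oplus\mathbb{E}^u(p)$, invariant in the sense that $Df_p\mathbb{E}^{\sigma}(p)=\mathbb{E}^\sigma(f(p))$ for $\sigma=s,c,u$ and all $p\in M$, and there exist $\lambda\in(0,1)$ and $C>0$ such that for all $n\geq1$ $$\|Df^n|_{\mathbb{E}^s}\|,\ \|Df^{-n}|_{\mathbb{E}^u}\|,\ \frac{\|Df^nX^s\|}{\|Df^{n}X^c\|},\ \frac{\|Df^nX^c\|}{\|Df^{n}X^u\|}\leq C\lambda^n$$ for all unit vectors $X^\sigma\in\mathbb{E}^\sigma$, $\sigma=s,c,u$ (based at the same point). A partially hyperbolic symplectomorphism of $(M,\omega)$ is a partially hyperbolic diffeomorphism $f$ with $f^*\omega=\omega$. A partially hyperbolic diffeomorphism $f$ is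 dynamically coherent if there exists an $f$-invariant foliation tangent to $\mathbb{E}^c$. *)

theory Defs
  imports "HOL-Analysis.Analysis" "HOL-Library.Disjoint_Sets"
begin

section \<open>Maps of class \<open>C\<^sup>k\<close> on open subsets of a Euclidean space\<close>

text \<open>Only used for open \<open>S\<close>. As the ambient space is finite-dimensional, continuity of all
  the directional derivatives is the same as continuity of the derivative.\<close>

fun Ck_on :: "nat \<Rightarrow> ('e::euclidean_space \<Rightarrow> 'b::real_normed_vector) \<Rightarrow> 'e set \<Rightarrow> bool" where
  "Ck_on 0 f S \<longleftrightarrow> continuous_on S f"
| "Ck_on (Suc k) f S \<longleftrightarrow> (\<forall>x\<in>S. f differentiable (at x)) \<and>
     (\<forall>v. Ck_on k (\<lambda>x. frechet_derivative f (at x) v) S)"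

definition smooth_on :: "('e::euclidean_space \<Rightarrow> 'b::real_normed_vector) \<Rightarrow> 'e set \<Rightarrow> bool" where
  "smooth_on f S \<longleftrightarrow> (\<forall>k. Ck_on k f S)"


section \<open>Smooth manifolds\<close>

text \<open>The manifold is the whole type \<open>'m\<close>, with its type class topology; a chart is
  a domain together with a coordinate map, whose values off the domain are irrelevant.\<close>

type_synonym ('m, 'e) chart = "'m set \<times> ('m \<Rightarrow> 'e)"

abbreviation chart_dom :: "('m, 'e) chart \<Rightarrow> 'm set" where
  "chart_dom c \<equiv> fst c"

abbreviation chart_map :: "('m, 'e) chart \<Rightarrow> 'm \<Rightarrow> 'e" where
  "chart_map c \<equiv> snd c"

definition chart_inv :: "('m, 'e) chart \<Rightarrow> 'e \<Rightarrow> 'm" where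
  "chart_inv c = inv_into (chart_dom c) (chart_map c)"

definition is_chart :: "('m::topological_space, 'e::euclidean_space) chart \<Rightarrow> bool" where
  "is_chart c \<longleftrightarrow> open (chart_dom c) \<and> open (chart_map c ` chart_dom c) \<and>
     homeomorphism (chart_dom c) (chart_map c ` chart_dom c) (chart_map c) (chart_inv c)"

definition transition :: "('m, 'e) chart \<Rightarrow> ('m, 'e) chart \<Rightarrow> 'e \<Rightarrow> 'e" where
  "transition c d = chart_map d \<circ> chart_inv c"

definition smooth_atlas :: "('m::topological_space, 'e::euclidean_space) chart set \<Rightarrow> bool" where
  "smooth_atlas A \<longleftrightarrow> (\<forall>c\<in>A. is_chart c) \<and> (\<Union>c\<in>A. chart_dom c) = UNIV \<and>
     (\<forall>c\<in>A. \<forall>d\<in>A. smooth_on (transition c d) (chart_map c ` (chart_dom c \<inter> chart_dom d)))"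

text \<open>Second countability is not listed, as it follows from compactness.\<close>

definition closed_manifold :: "('m::t2_space, 'e::euclidean_space) chart set \<Rightarrow> bool" where
  "closed_manifold A \<longleftrightarrow> compact (UNIV :: 'm set) \<and> smooth_atlas A"

text \<open>Charts that belong to the \<open>C\<^sup>k\<close> structure induced by the atlas \<open>A\<close>.\<close>

definition Ck_chart ::
  "('m::topological_space, 'e::euclidean_space) chart set \<Rightarrow> nat \<Rightarrow> ('m, 'e) chart \<Rightarrow> bool" where
  "Ck_chart A k c \<longleftrightarrow> is_chart c \<and>
     (\<forall>d\<in>A. Ck_on k (transition c d) (chart_map c ` (chart_dom c \<inter> chart_dom d)) \<and>
            Ck_on k (transition d c) (chart_map d ` (chart_dom c \<inter> chart_dom d)))"

definition Ck_map ::
  "('m::topological_space, 'e::euclidean_space) chart set \<Rightarrow> nat \<Rightarrow> ('m \<Rightarrow> 'm) \<Rightarrow> bool" where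
  "Ck_map A k f \<longleftrightarrow> continuous_on UNIV f \<and>
     (\<forall>c\<in>A. \<forall>d\<in>A. Ck_on k (chart_map d \<circ> f \<circ> chart_inv c)
        (chart_map c ` (chart_dom c \<inter> f -` chart_dom d)))"

definition Ck_diffeo ::
  "('m::topological_space, 'e::euclidean_space) chart set \<Rightarrow> nat \<Rightarrow> ('m \<Rightarrow> 'm) \<Rightarrow> bool" where
  "Ck_diffeo A k f \<longleftrightarrow> bij f \<and> Ck_map A k f \<and> Ck_map A k (inv f)"


section \<open>Tangent spaces\<close>

text \<open>For each point \<open>p\<close> a chart of the atlas around \<open>p\<close> is selected once and for all, and
  the tangent space at \<open>p\<close> is identified with the model space \<open>'e\<close> by means of that chart.
  The selected chart need not depend continuously on \<open>p\<close>, so that the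
  regularity of fields of tangent vectors, subspaces and forms is always expressed after passage
  to the coordinates of one chart.\<close>

definition chart_at :: "('m, 'e) chart set \<Rightarrow> 'm \<Rightarrow> ('m, 'e) chart" where
  "chart_at A p = (SOME c. c \<in> A \<and> p \<in> chart_dom c)"

text \<open>The differential at \<open>p\<close> of the coordinate map of \<open>c\<close>, and its inverse, which sends
  a vector of the model space to the tangent vector at \<open>p\<close> with these coordinates in \<open>c\<close>.\<close>

definition coord ::
  "('m, 'e::euclidean_space) chart set \<Rightarrow> ('m, 'e) chart \<Rightarrow> 'm \<Rightarrow> 'e \<Rightarrow> 'e" where
  "coord A c p =
     frechet_derivative (transition (chart_at A p) c) (at (chart_map (chart_at A p) p))"

definition coord_inv ::
  "('m, 'e::euclidean_space) chart set \<Rightarrow> ('m, 'e) chart \<Rightarrow> 'm \<Rightarrow> 'e \<Rightarrow> 'e" where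
  "coord_inv A c p = frechet_derivative (transition c (chart_at A p)) (at (chart_map c p))"

definition tangent_map ::
  "('m, 'e::euclidean_space) chart set \<Rightarrow> ('m \<Rightarrow> 'm) \<Rightarrow> 'm \<Rightarrow> 'e \<Rightarrow> 'e" where
  "tangent_map A f p =
     frechet_derivative (chart_map (chart_at A (f p)) \<circ> f \<circ> chart_inv (chart_at A p))
       (at (chart_map (chart_at A p) p))"

definition Ck_vector_field_on ::
  "('m, 'e::euclidean_space) chart set \<Rightarrow> nat \<Rightarrow> 'm set \<Rightarrow> ('m \<Rightarrow> 'e) \<Rightarrow> bool" where
  "Ck_vector_field_on A k U X \<longleftrightarrow>
     (\<forall>c\<in>A. Ck_on k (\<lambda>x. coord A c (chart_inv c x) (X (chart_inv c x)))
        (chart_map c ` (chart_dom c \<inter> U)))"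

text \<open>A \<open>C\<^sup>k\<close> subbundle of the tangent bundle: locally there is a \<open>C\<^sup>k\<close> frame. The \<open>r\<close> vectors
  \<open>X i q\<close> form a basis of \<open>E q\<close>, since they span a space of dimension \<open>r\<close>.\<close>

definition Ck_subbundle ::
  "('m::topological_space, 'e::euclidean_space) chart set \<Rightarrow> nat \<Rightarrow> ('m \<Rightarrow> 'e set) \<Rightarrow> bool" where
  "Ck_subbundle A k E \<longleftrightarrow>
     (\<forall>p. \<exists>U r. \<exists>X :: nat \<Rightarrow> 'm \<Rightarrow> 'e. open U \<and> p \<in> U \<and>
        (\<forall>i<r. Ck_vector_field_on A k U (X i)) \<and>
        (\<forall>q\<in>U. span ((\<lambda>i. X i q) ` {..<r}) = E q \<and> dim (E q) = r))"


section \<open>Riemannian metrics and symplectic forms\<close>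

definition local_form ::
  "('m, 'e::euclidean_space) chart set \<Rightarrow> ('m \<Rightarrow> 'e \<Rightarrow> 'e \<Rightarrow> real) \<Rightarrow> ('m, 'e) chart \<Rightarrow>
    'e \<Rightarrow> 'e \<Rightarrow> 'e \<Rightarrow> real" where
  "local_form A w c u v x =
     w (chart_inv c x) (coord_inv A c (chart_inv c x) u) (coord_inv A c (chart_inv c x) v)"

definition smooth_bilinear_field ::
  "('m, 'e::euclidean_space) chart set \<Rightarrow> ('m \<Rightarrow> 'e \<Rightarrow> 'e \<Rightarrow> real) \<Rightarrow> bool" where
  "smooth_bilinear_field A w \<longleftrightarrow> (\<forall>p. bilinear (w p)) \<and>
     (\<forall>c\<in>A. \<forall>u v. smooth_on (local_form A w c u v) (chart_map c ` chart_dom c))"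

definition riemannian_metric ::
  "('m, 'e::euclidean_space) chart set \<Rightarrow> ('m \<Rightarrow> 'e \<Rightarrow> 'e \<Rightarrow> real) \<Rightarrow> bool" where
  "riemannian_metric A g \<longleftrightarrow> smooth_bilinear_field A g \<and>
     (\<forall>p u v. g p u v = g p v u) \<and> (\<forall>p v. v \<noteq> 0 \<longrightarrow> g p v v > 0)"

definition riem_norm :: "('m \<Rightarrow> 'e \<Rightarrow> 'e \<Rightarrow> real) \<Rightarrow> 'm \<Rightarrow> 'e \<Rightarrow> real" where
  "riem_norm g p v = sqrt (g p v v)"

definition two_form ::
  "('m, 'e::euclidean_space) chart set \<Rightarrow> ('m \<Rightarrow> 'e \<Rightarrow> 'e \<Rightarrow> real) \<Rightarrow> bool" where
  "two_form A w \<longleftrightarrow> smooth_bilinear_field A w \<and> (\<forall>p v. w p v v = 0)"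

text \<open>The left-hand side is \<open>d\<omega>(u, v, z)\<close> in the chart \<open>c\<close>: for constant vector fields the bracket
  terms in the formula for the exterior derivative vanish.\<close>

definition closed_two_form ::
  "('m, 'e::euclidean_space) chart set \<Rightarrow> ('m \<Rightarrow> 'e \<Rightarrow> 'e \<Rightarrow> real) \<Rightarrow> bool" where
  "closed_two_form A w \<longleftrightarrow> two_form A w \<and>
     (\<forall>c\<in>A. \<forall>x \<in> chart_map c ` chart_dom c. \<forall>u v z.
        frechet_derivative (local_form A w c v z) (at x) u
      + frechet_derivative (local_form A w c z u) (at x) v
      + frechet_derivative (local_form A w c u v) (at x) z = 0)"

definition symplectic_form ::
  "('m, 'e::euclidean_space) chart set \<Rightarrow> ('m \<Rightarrow> 'e \<Rightarrow> 'e \<Rightarrow> real) \<Rightarrow> bool" where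
  "symplectic_form A w \<longleftrightarrow> closed_two_form A w \<and> (\<forall>p u. (\<forall>v. w p u v = 0) \<longrightarrow> u = 0)"

definition pullback_form ::
  "('m, 'e::euclidean_space) chart set \<Rightarrow> ('m \<Rightarrow> 'm) \<Rightarrow> ('m \<Rightarrow> 'e \<Rightarrow> 'e \<Rightarrow> real) \<Rightarrow>
    'm \<Rightarrow> 'e \<Rightarrow> 'e \<Rightarrow> real" where
  "pullback_form A f w p u v = w (f p) (tangent_map A f p u) (tangent_map A f p v)"


section \<open>Partially hyperbolic diffeomorphisms\<close>

definition continuous_splitting ::
  "('m::topological_space, 'e::euclidean_space) chart set \<Rightarrow>
    ('m \<Rightarrow> 'e set) \<Rightarrow> ('m \<Rightarrow> 'e set) \<Rightarrow> ('m \<Rightarrow> 'e set) \<Rightarrow> bool" where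
  "continuous_splitting A Es Ec Eu \<longleftrightarrow>
     Ck_subbundle A 0 Es \<and> Ck_subbundle A 0 Ec \<and> Ck_subbundle A 0 Eu \<and>
     (\<forall>p v. \<exists>!x. case x of (a, b, c) \<Rightarrow> a \<in> Es p \<and> b \<in> Ec p \<and> c \<in> Eu p \<and> v = a + b + c)"

definition invariant_subbundle ::
  "('m, 'e::euclidean_space) chart set \<Rightarrow> ('m \<Rightarrow> 'm) \<Rightarrow> ('m \<Rightarrow> 'e set) \<Rightarrow> bool" where
  "invariant_subbundle A f E \<longleftrightarrow> (\<forall>p. tangent_map A f p ` E p = E (f p))"

definition partially_hyperbolic ::
  "('m::topological_space, 'e::euclidean_space) chart set \<Rightarrow> ('m \<Rightarrow> 'e \<Rightarrow> 'e \<Rightarrow> real) \<Rightarrow>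
    ('m \<Rightarrow> 'm) \<Rightarrow> ('m \<Rightarrow> 'e set) \<Rightarrow> ('m \<Rightarrow> 'e set) \<Rightarrow> ('m \<Rightarrow> 'e set) \<Rightarrow> bool" where
  "partially_hyperbolic A g f Es Ec Eu \<longleftrightarrow>
     Ck_diffeo A 1 f \<and> continuous_splitting A Es Ec Eu \<and>
     invariant_subbundle A f Es \<and> invariant_subbundle A f Ec \<and> invariant_subbundle A f Eu \<and>
     (\<exists>lam C. 0 < lam \<and> lam < 1 \<and> 0 < C \<and>
       (\<forall>n\<ge>1. \<forall>p.
         let nrm = riem_norm g;
             S = (\<lambda>E. {X \<in> E p. nrm p X = 1});
             Dn = (\<lambda>X. nrm ((f ^^ n) p) (tangent_map A (f ^^ n) p X));
             Dm = (\<lambda>X. nrm ((inv f ^^ n) p) (tangent_map A (inv f ^^ n) p X))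
         in (\<forall>X \<in> S Es. Dn X \<le> C * lam ^ n) \<and>
            (\<forall>X \<in> S Eu. Dm X \<le> C * lam ^ n) \<and>
            (\<forall>X \<in> S Es. \<forall>Y \<in> S Ec. Dn X / Dn Y \<le> C * lam ^ n) \<and>
            (\<forall>X \<in> S Ec. \<forall>Y \<in> S Eu. Dn X / Dn Y \<le> C * lam ^ n)))"

definition partially_hyperbolic_symplectomorphism ::
  "('m::topological_space, 'e::euclidean_space) chart set \<Rightarrow> ('m \<Rightarrow> 'e \<Rightarrow> 'e \<Rightarrow> real) \<Rightarrow>
    ('m \<Rightarrow> 'e \<Rightarrow> 'e \<Rightarrow> real) \<Rightarrow> ('m \<Rightarrow> 'm) \<Rightarrow>
    ('m \<Rightarrow> 'e set) \<Rightarrow> ('m \<Rightarrow> 'e set) \<Rightarrow> ('m \<Rightarrow> 'e set) \<Rightarrow> bool" where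
  "partially_hyperbolic_symplectomorphism A g w f Es Ec Eu \<longleftrightarrow>
     partially_hyperbolic A g f Es Ec Eu \<and> pullback_form A f w = w"


section \<open>Foliations and dynamical coherence\<close>

text \<open>The slice through \<open>p\<close> of a chart \<open>c\<close>, where the coordinates along \<open>I\<close> are free and the
  other ones are fixed.\<close>

definition slice ::
  "('m, 'e::euclidean_space) chart \<Rightarrow> 'e set \<Rightarrow> 'm \<Rightarrow> 'm set" where
  "slice c I p = {q \<in> chart_dom c. \<forall>b \<in> Basis - I. chart_map c q \<bullet> b = chart_map c p \<bullet> b}"

text \<open>A foliation of dimension \<open>d\<close> and class \<open>C\<^sup>k\<close> (merely topological if \<open>k = 0\<close>), given by the
  set \<open>F\<close> of its leaves. Path components, and not components, are used on purpose: in the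
  subspace topology, a union of several dense leaves may be connected. A path that stays in one
  leaf stays in one plaque as long as it stays in the foliated chart, so that the leaves are
  exactly the classes of points that are joined by chains of plaques.\<close>

definition foliation ::
  "('m::topological_space, 'e::euclidean_space) chart set \<Rightarrow> nat \<Rightarrow> nat \<Rightarrow> 'm set set \<Rightarrow> bool" where
  "foliation A k d F \<longleftrightarrow> partition_on UNIV F \<and> (\<forall>L\<in>F. path_connected L) \<and>
     (\<forall>p. \<exists>c I a b. Ck_chart A k c \<and> p \<in> chart_dom c \<and>
        chart_map c ` chart_dom c = box a b \<and> I \<subseteq> Basis \<and> card I = d \<and>
        (\<forall>L\<in>F. \<forall>q \<in> L \<inter> chart_dom c.
           path_component_set (L \<inter> chart_dom c) q = slice c I q))"

text \<open>\<open>L\<close> is an immersed \<open>C\<^sup>1\<close> submanifold whose tangent space at every \<open>p \<in> L\<close> is \<open>E p\<close>. Near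
  \<open>p\<close>, the sheet of \<open>L\<close> through \<open>p\<close> (other sheets may accumulate on it) is
  a slice of a \<open>C\<^sup>1\<close> chart.\<close>

definition tangent_to ::
  "('m::topological_space, 'e::euclidean_space) chart set \<Rightarrow> 'm set \<Rightarrow> ('m \<Rightarrow> 'e set) \<Rightarrow> bool" where
  "tangent_to A L E \<longleftrightarrow>
     (\<forall>p\<in>L. \<exists>c I. Ck_chart A 1 c \<and> p \<in> chart_dom c \<and> I \<subseteq> Basis \<and>
        path_component_set (L \<inter> chart_dom c) p = slice c I p \<and>
        {v. \<forall>b \<in> Basis - I. coord A c p v \<bullet> b = 0} = E p)"

definition center_foliation ::
  "('m::topological_space, 'e::euclidean_space) chart set \<Rightarrow> ('m \<Rightarrow> 'm) \<Rightarrow> ('m \<Rightarrow> 'e set) \<Rightarrow>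
    'm set set \<Rightarrow> bool" where
  "center_foliation A f Ec F \<longleftrightarrow>
     (\<exists>d. foliation A 0 d F) \<and> (\<forall>L\<in>F. tangent_to A L Ec) \<and> (\<forall>L\<in>F. f ` L \<in> F)"

definition dynamically_coherent ::
  "('m::topological_space, 'e::euclidean_space) chart set \<Rightarrow> ('m \<Rightarrow> 'm) \<Rightarrow> ('m \<Rightarrow> 'e set) \<Rightarrow>
    bool" where
  "dynamically_coherent A f Ec \<longleftrightarrow> (\<exists>F. center_foliation A f Ec F)"

end

theory Submission
  imports Defs
begin

text \<open>The center bundle is the symplectic orthogonal of the sum of the stable and the unstable line
  bundles. It is therefore \<open>C\<^sup>1\<close> and locally the common kernel of two one-forms \<open>w(X, \<sqdot>)\<close>, with \<open>X\<close> a
  \<open>C\<^sup>1\<close> section of one of the line bundles. On the center planes the exterior derivative of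
  \<open>w(X, \<sqdot>)\<close> is a multiple \<open>b(X) w\<close> of the area form \<open>w\<close>. The function \<open>b\<close> is linear in \<open>X\<close>, invariant
  under \<open>f\<close> and bounded on unit vectors; as \<open>X\<close> is contracted by \<open>f\<close> or by its inverse, \<open>b = 0\<close>.
  So the center bundle is involutive, and Frobenius' theorem provides \<open>C\<^sup>1\<close> charts with slices
  tangent to it.

  The leaves are the chains of plaques. A leaf meets a chart in countably many slices, and therefore
  a path in their union stays in one of them. For an arbitrary center foliation, the
  coordinates transversal to the slices are locally constant on its leaves, and invariance of domain
  shows that each leaf is open in the slices which it meets.\<close>

section \<open>Flows of vector fields of class \<open>C\<^sup>1\<close>\<close>

text \<open>In dimension four the center planes are two-dimensional, so every alternating form on
  such a plane is a multiple of \<open>w\<close>; this makes \<open>b\<close> a number. It is linear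
  over functions: d(u w(X, .)) = du wedge w(X, .) + u d(w(X, .)), and the first term vanishes on the
  center planes, where w(X, .) is zero. So only the value of X at a point counts, and local sections
  may be exchanged freely along an orbit. Invariance needs that d commutes with the pullback of a
  C^1 form, which holds as \<open>f\<close> is C^2. Orthogonality rests on domination: nondegeneracy
  ties the growth along the stable line to that along the unstable one. As the bundle is only C^1,
  Frobenius' theorem is derived from flows of C^1 fields. Two constant forms complete the two forms
  w(X, .) to a coframe whose exterior derivative vanishes on the center planes; the dual fields that
  span the bundle then commute, and their flow straightens it. A leaf may be dense, so nothing about
  leaves can be read off from their subspace topology; paths and transversal coordinates take its
  place.\<close>

lemma picard_solution:
  fixes F :: "real \<Rightarrow> 'e::euclidean_space \<Rightarrow> 'e"
  assumes T: "0 \<le> T" and L: "0 \<le> L" "L * T \<le> 1/2" and S: "closed S" "S \<noteq> {}"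
    and cont: "\<And>z. continuous_on {0..T} z \<Longrightarrow> z ` {0..T} \<subseteq> S \<Longrightarrow> continuous_on {0..T} (\<lambda>s. F s (z s))"
    and lip: "\<And>t x y. t \<in> {0..T} \<Longrightarrow> x \<in> S \<Longrightarrow> y \<in> S \<Longrightarrow> norm (F t x - F t y) \<le> L * norm (x - y)"
    and stay: "\<And>z t. continuous_on {0..T} z \<Longrightarrow> z ` {0..T} \<subseteq> S \<Longrightarrow> t \<in> {0..T} \<Longrightarrow>
       w + integral {0..t} (\<lambda>s. F s (z s)) \<in> S"
  shows "\<exists>z. continuous_on {0..T} z \<and> z ` {0..T} \<subseteq> S \<and>
    (\<forall>t\<in>{0..T}. z t = w + integral {0..t} (\<lambda>s. F s (z s)))"
proof -
  \<comment> \<open>Clamping the time to [0, T] turns a function on that interval into a bounded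
    continuous function on the whole line, so that the contraction principle can run in the complete
    space \<open>bcontfun\<close>.\<close>
  define cl where "cl t = max 0 (min T t)" for t :: real
  have cl: "cl t \<in> {0..T}" for t using T by (auto simp: cl_def)
  have cl_id: "cl t = t" if "t \<in> {0..T}" for t using that by (auto simp: cl_def)
  have cl_cont: "continuous_on UNIV cl" unfolding cl_def by (intro continuous_intros)
  define I where "I z t = w + integral {0..cl t} (\<lambda>s. F s (z s))" for z t
  have I_cont0: "continuous_on {0..T} (\<lambda>t. w + integral {0..t} (\<lambda>s. F s (z s)))"
    if "continuous_on {0..T} z" "z ` {0..T} \<subseteq> S" for z
    by (intro continuous_intros indefinite_integral_continuous_1 integrable_continuous_real cont that)
  have I_cont: "continuous_on UNIV (I z)" if "continuous_on {0..T} z" "z ` {0..T} \<subseteq> S" for z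
    unfolding I_def by (rule continuous_on_compose2[OF I_cont0[OF that] cl_cont]) (use cl in auto)
  have I_bcont: "I z \<in> bcontfun" if z: "continuous_on {0..T} z" "z ` {0..T} \<subseteq> S" for z
  proof -
    have "range (I z) \<subseteq> (\<lambda>t. w + integral {0..t} (\<lambda>s. F s (z s))) ` {0..T}"
      unfolding I_def using cl by auto
    moreover have "compact ((\<lambda>t. w + integral {0..t} (\<lambda>s. F s (z s))) ` {0..T})"
      by (intro compact_continuous_image I_cont0 z) auto
    ultimately have "bounded (range (I z))" using compact_imp_bounded bounded_subset by blast
    then show ?thesis using I_cont[OF z] by (simp add: bcontfun_def)
  qed
  define Q where "Q = (PiC UNIV (\<lambda>_. S) :: (real \<Rightarrow>\<^sub>C 'e) set)"
  have Q: "z \<in> Q \<longleftrightarrow> range (apply_bcontfun z) \<subseteq> S" for z by (auto simp: Q_def mem_PiC_iff)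
  define f where "f z = Bcontfun (I (apply_bcontfun z))" for z
  have f: "apply_bcontfun (f z) = I (apply_bcontfun z)" if "z \<in> Q" for z
    unfolding f_def using that Q by (intro Bcontfun_inverse I_bcont) auto
  have "\<exists>!z\<in>Q. f z = z"
  proof (rule Banach_fix[where c="1/2"])
    show "complete Q" unfolding Q_def using S by (intro complete_eq_closed[THEN iffD2] closed_PiC) auto
    obtain s where "s \<in> S" using S by auto
    then have "const_bcontfun s \<in> Q" by (auto simp: Q)
    then show "Q \<noteq> {}" by auto
    show "f ` Q \<subseteq> Q"
    proof clarify
      fix z assume z: "z \<in> Q"
      then have "apply_bcontfun z ` {0..T} \<subseteq> S" using Q by auto
      then have "range (I z) \<subseteq> S" unfolding I_def using stay[of "apply_bcontfun z"] cl by blast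
      then show "f z \<in> Q" unfolding Q f[OF z] .
    qed
    fix x y assume xy: "x \<in> Q" "y \<in> Q"
    show "dist (f x) (f y) \<le> 1/2 * dist x y"
    proof (rule dist_bound)
      fix t
      have cx: "continuous_on {0..cl t} (\<lambda>s. F s (apply_bcontfun z s))" if "z \<in> Q" for z
        by (rule continuous_on_subset[OF cont[of "apply_bcontfun z"]]) (use cl[of t] that Q in auto)
      have "dist (f x t) (f y t) = norm (integral {0..cl t} (\<lambda>s. F s (x s) - F s (y s)))"
        by (subst integral_diff) (auto simp: f xy I_def dist_norm intro!: integrable_continuous_real cx)
      also have "\<dots> \<le> (L * dist x y) * (cl t - 0)"
      proof (rule integral_bound)
        show "0 \<le> cl t" using cl[of t] by auto
        show "continuous_on {0..cl t} (\<lambda>s. F s (x s) - F s (y s))" by (intro continuous_intros cx xy)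
        fix s assume s: "s \<in> {0..cl t}"
        have "norm (F s (x s) - F s (y s)) \<le> L * norm (x s - y s)"
          using xy s cl[of t] Q by (intro lip) auto
        also have "\<dots> \<le> L * dist x y" using L dist_bounded[of x s y]
          by (intro mult_left_mono) (auto simp: dist_norm)
        finally show "norm (F s (x s) - F s (y s)) \<le> L * dist x y" .
      qed
      also have "\<dots> \<le> (L * dist x y) * T" using cl[of t] L by (intro mult_left_mono) auto
      also have "\<dots> \<le> 1/2 * dist x y" using mult_right_mono[OF L(2), of "dist x y"]
        by (simp add: mult_ac)
      finally show "dist (f x t) (f y t) \<le> 1/2 * dist x y" .
    qed
  qed auto
  then obtain z where z: "z \<in> Q" "f z = z" by blast
  have "apply_bcontfun z t = w + integral {0..t} (\<lambda>s. F s (apply_bcontfun z s))" if "t \<in> {0..T}" for t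
    using f[OF z(1)] z(2) cl_id[OF that] by (metis I_def)
  moreover have "apply_bcontfun z ` {0..T} \<subseteq> S" using z(1) Q by auto
  ultimately show ?thesis by (intro exI[of _ "apply_bcontfun z"]) blast
qed

text \<open>At a time where the norm attains its maximum m, the hypothesis reads m \<le> c + m / 2.
  On short intervals this does the work of Gronwall's inequality.\<close>

lemma norm_le_of_contraction:
  fixes u :: "real \<Rightarrow> 'e::real_normed_vector"
  assumes "continuous_on {0..T} u"
    and step: "\<And>t m. t \<in> {0..T} \<Longrightarrow> (\<And>s. s \<in> {0..T} \<Longrightarrow> norm (u s) \<le> m) \<Longrightarrow> norm (u t) \<le> c + m / 2"
    and t: "t \<in> {0..T}"
  shows "norm (u t) \<le> 2 * c"
proof -
  have "continuous_on {0..T} (\<lambda>t. norm (u t))" using assms(1) by (intro continuous_intros)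
  then obtain s where s: "s \<in> {0..T}" "\<And>t. t \<in> {0..T} \<Longrightarrow> norm (u t) \<le> norm (u s)"
    using continuous_attains_sup[of "{0..T}" "\<lambda>t. norm (u t)"] t by auto
  show ?thesis using step[OF s(1) s(2)] s(2)[OF t] by simp
qed

lemma norm_integral_le:
  fixes g :: "real \<Rightarrow> 'e::euclidean_space"
  assumes "continuous_on {0..T} g" "\<And>s. s \<in> {0..T} \<Longrightarrow> norm (g s) \<le> B" "t \<in> {0..T}"
  shows "norm (integral {0..t} g) \<le> B * T"
proof -
  have "norm (integral {0..t} g) \<le> B * (t - 0)"
    using assms by (intro integral_bound) (auto intro: continuous_on_subset)
  also have "\<dots> \<le> B * T" using assms(3) order_trans[OF norm_ge_zero assms(2)[of t]]
    by (intro mult_left_mono) (use assms in auto)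
  finally show ?thesis .
qed

text \<open>The derivative at time \<open>T\<close> is the solution operator of the variational
  equation u' = V'(\<phi>) u. The last conclusion is the tool for computing it later: any explicit
  solution \<open>y\<close> of that equation yields the value of \<open>A w\<close> at
  \<open>y 0\<close>. The conclusion about a zero of \<open>V\<close> identifies the orbit of a rest
  point, where this equation has constant coefficients.\<close>

lemma C1_flow:
  fixes V :: "'e::euclidean_space \<Rightarrow> 'e" and V' :: "'e \<Rightarrow> 'e \<Rightarrow>\<^sub>L 'e"
  assumes U: "open U" "w0 \<in> U"
    and der: "\<And>x. x \<in> U \<Longrightarrow> (V has_derivative blinfun_apply (V' x)) (at x)"
    and cont': "continuous_on U V'"
  obtains T \<delta> \<phi> A where "0 < T" "0 < \<delta>"
    "\<And>w. w \<in> ball w0 \<delta> \<Longrightarrow> \<phi> w 0 = w"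
    "\<And>w t. w \<in> ball w0 \<delta> \<Longrightarrow> t \<in> {0..T} \<Longrightarrow> \<phi> w t \<in> U"
    "\<And>w t. w \<in> ball w0 \<delta> \<Longrightarrow> t \<in> {0..T} \<Longrightarrow>
       (\<phi> w has_vector_derivative V (\<phi> w t)) (at t within {0..T})"
    "\<And>t. V w0 = 0 \<Longrightarrow> t \<in> {0..T} \<Longrightarrow> \<phi> w0 t = w0"
    "\<And>w. w \<in> ball w0 \<delta> \<Longrightarrow> ((\<lambda>w. \<phi> w T) has_derivative blinfun_apply (A w)) (at w)"
    "continuous_on (ball w0 \<delta>) (A :: 'e \<Rightarrow> 'e \<Rightarrow>\<^sub>L 'e)"
    "\<And>w y. w \<in> ball w0 \<delta> \<Longrightarrow>
       (\<And>t. t \<in> {0..T} \<Longrightarrow> (y has_vector_derivative V' (\<phi> w t) (y t)) (at t within {0..T})) \<Longrightarrow>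
       A w (y 0) = y T"
proof -
  obtain R where R: "R > 0" "cball w0 R \<subseteq> U" using U open_contains_cball by blast
  let ?K = "cball w0 R"
  have contV: "continuous_on U V"
    using der by (meson continuous_at_imp_continuous_on has_derivative_continuous)
  have cK: "continuous_on ?K V" "continuous_on ?K V'" using R contV cont' continuous_on_subset by blast+
  have "bounded (V ` ?K)" "bounded (V' ` ?K)"
    by (intro compact_imp_bounded compact_continuous_image cK compact_cball)+
  then obtain M L where M: "M > 0" "\<And>x. x \<in> ?K \<Longrightarrow> norm (V x) \<le> M"
    and L: "L > 0" "\<And>x. x \<in> ?K \<Longrightarrow> norm (V' x) \<le> L"
    unfolding bounded_pos by auto
  \<comment> \<open>\<open>M * T \<le> R / 2\<close> keeps orbits that start within R / 2 of
    \<open>w0\<close> in the ball of radius R; \<open>L * T \<le> 1/2\<close> makes the Picard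
    operator a contraction, both for the flow and for its linearisation.\<close>
  define T where "T = min (R / (2 * M)) (1 / (2 * L))"
  have T: "T > 0" "M * T \<le> R / 2" "L * T \<le> 1/2"
    using R M L by (auto simp: T_def min_def field_simps)
  define \<delta> where "\<delta> = R / 2"
  have \<delta>: "\<delta> > 0" using R by (simp add: \<delta>_def)
  have lipV: "norm (V x - V y) \<le> L * norm (x - y)" if "x \<in> ?K" "y \<in> ?K" for x y
  proof (rule differentiable_bound[OF _ _ _ that])
    show "convex ?K" by simp
    show "(V has_derivative V' x) (at x within ?K)" if "x \<in> ?K" for x
      using der R that by (meson has_derivative_at_withinI subset_iff)
    show "onorm (blinfun_apply (V' x)) \<le> L" if "x \<in> ?K" for x using L(2)[OF that] by (simp add: norm_blinfun.rep_eq)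
  qed
  have "\<exists>z. continuous_on {0..T} z \<and> z ` {0..T} \<subseteq> ?K \<and>
    (\<forall>t\<in>{0..T}. z t = w + integral {0..t} (\<lambda>s. V (z s)))" if w: "w \<in> ball w0 \<delta>" for w
  proof (rule picard_solution[where L=L])
    show "continuous_on {0..T} (\<lambda>s. V (z s))" if "continuous_on {0..T} z" "z ` {0..T} \<subseteq> ?K" for z
      by (rule continuous_on_compose2[OF cK(1) that])
    then have "norm (integral {0..t} (\<lambda>s. V (z s))) \<le> M * T"
      if "continuous_on {0..T} z" "z ` {0..T} \<subseteq> ?K" "t \<in> {0..T}" for z t
      using that by (intro norm_integral_le) (auto intro!: M)
    then have *: "norm (integral {0..t} (\<lambda>s. V (z s))) \<le> R/2"
      if "continuous_on {0..T} z" "z ` {0..T} \<subseteq> ?K" "t \<in> {0..T}" for z t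
      using that T by force
    show "w + integral {0..t} (\<lambda>s. V (z s)) \<in> ?K"
      if "continuous_on {0..T} z" "z ` {0..T} \<subseteq> ?K" "t \<in> {0..T}" for z t
    proof -
      have "norm (w - w0) \<le> R / 2" using w by (simp add: \<delta>_def dist_norm norm_minus_commute)
      then have "norm ((w - w0) + integral {0..t} (\<lambda>s. V (z s))) \<le> R/2 + R/2"
        using *[OF that] by (intro norm_triangle_le add_mono)
      then show ?thesis by (simp add: dist_norm norm_minus_commute algebra_simps)
    qed
  qed (use T L R lipV in auto)
  then obtain \<phi> where \<phi>c: "\<And>w. w \<in> ball w0 \<delta> \<Longrightarrow> continuous_on {0..T} (\<phi> w)"
    and \<phi>K: "\<And>w. w \<in> ball w0 \<delta> \<Longrightarrow> \<phi> w ` {0..T} \<subseteq> ?K"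
    and \<phi>I: "\<And>w t. w \<in> ball w0 \<delta> \<Longrightarrow> t \<in> {0..T} \<Longrightarrow> \<phi> w t = w + integral {0..t} (\<lambda>s. V (\<phi> w s))"
    by metis
  have \<phi>K': "\<phi> w t \<in> ?K" if "w \<in> ball w0 \<delta>" "t \<in> {0..T}" for w t
    using \<phi>K[OF that(1)] that(2) by blast
  have cVphi: "continuous_on {0..T} (\<lambda>s. V (\<phi> w s))" if "w \<in> ball w0 \<delta>" for w
    by (rule continuous_on_compose2[OF cK(1) \<phi>c[OF that] \<phi>K[OF that]])
  have cV'phi: "continuous_on {0..T} (\<lambda>s. V' (\<phi> w s))" if "w \<in> ball w0 \<delta>" for w
    by (rule continuous_on_compose2[OF cK(2) \<phi>c[OF that] \<phi>K[OF that]])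
  have iV: "(\<lambda>s. V (\<phi> w s)) integrable_on {0..t}" if "w \<in> ball w0 \<delta>" "t \<in> {0..T}" for w t
    by (intro integrable_continuous_real continuous_on_subset[OF cVphi[OF that(1)]]) (use that in auto)
  have \<phi>lip: "norm (\<phi> w t - \<phi> w' t) \<le> 2 * norm (w - w')"
    if w: "w \<in> ball w0 \<delta>" "w' \<in> ball w0 \<delta>" and t: "t \<in> {0..T}" for w w' t
  proof (rule norm_le_of_contraction[OF _ _ t])
    show "continuous_on {0..T} (\<lambda>t. \<phi> w t - \<phi> w' t)" by (intro continuous_intros \<phi>c w)
    fix t m assume t: "t \<in> {0..T}" and m: "\<And>s. s \<in> {0..T} \<Longrightarrow> norm (\<phi> w s - \<phi> w' s) \<le> m"
    have m0: "0 \<le> m" using order_trans[OF norm_ge_zero m[OF t]] .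
    have "norm (integral {0..t} (\<lambda>s. V (\<phi> w s) - V (\<phi> w' s))) \<le> (L * m) * T"
    proof (rule norm_integral_le[OF _ _ t])
      show "continuous_on {0..T} (\<lambda>s. V (\<phi> w s) - V (\<phi> w' s))" by (intro continuous_intros cVphi w)
      fix s assume s: "s \<in> {0..T}"
      have "norm (V (\<phi> w s) - V (\<phi> w' s)) \<le> L * norm (\<phi> w s - \<phi> w' s)"
        by (intro lipV \<phi>K' w s)
      also have "\<dots> \<le> L * m" using m[OF s] L by simp
      finally show "norm (V (\<phi> w s) - V (\<phi> w' s)) \<le> L * m" .
    qed
    also have "\<dots> \<le> m / 2" using mult_right_mono[OF T(3) m0] by (simp add: mult_ac)
    finally have *: "norm (integral {0..t} (\<lambda>s. V (\<phi> w s) - V (\<phi> w' s))) \<le> m / 2" .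
    have "\<phi> w t - \<phi> w' t = (w - w') + integral {0..t} (\<lambda>s. V (\<phi> w s) - V (\<phi> w' s))"
      using \<phi>I[OF w(1) t] \<phi>I[OF w(2) t] integral_diff[OF iV[OF w(1) t] iV[OF w(2) t]] by simp
    then show "norm (\<phi> w t - \<phi> w' t) \<le> norm (w - w') + m / 2"
      using * norm_triangle_ineq[of "w - w'"] by (smt (verit))
  qed
  \<comment> \<open>The variational equation along the orbit of \<open>w\<close> is solved on the
    same interval for every initial vector \<open>k\<close>; its solution \<open>a w k\<close> at
    time \<open>T\<close> will be the derivative of the flow applied to \<open>k\<close>.\<close>
  have "\<exists>a. continuous_on {0..T} a \<and>
    (\<forall>t\<in>{0..T}. a t = k + integral {0..t} (\<lambda>s. V' (\<phi> w s) (a s)))" if w: "w \<in> ball w0 \<delta>" for w k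
  proof -
    have "\<exists>z. continuous_on {0..T} z \<and> z ` {0..T} \<subseteq> UNIV \<and>
      (\<forall>t\<in>{0..T}. z t = k + integral {0..t} (\<lambda>s. V' (\<phi> w s) (z s)))"
    proof (rule picard_solution[where L=L])
      show "continuous_on {0..T} (\<lambda>s. V' (\<phi> w s) (z s))" if "continuous_on {0..T} z" for z
        by (intro continuous_intros cV'phi w that)
      fix t and x y :: 'e assume "t \<in> {0..T}"
      then have "norm (V' (\<phi> w t)) \<le> L" by (intro L \<phi>K' w)
      then have "norm (V' (\<phi> w t)) * norm (x - y) \<le> L * norm (x - y)" by (intro mult_right_mono) auto
      then show "norm (V' (\<phi> w t) x - V' (\<phi> w t) y) \<le> L * norm (x - y)"
        using norm_blinfun[of "V' (\<phi> w t)" "x - y"] by (simp add: blinfun.diff_right)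
    qed (use T L in auto)
    then show ?thesis by auto
  qed
  then obtain a where ac: "\<And>w k. w \<in> ball w0 \<delta> \<Longrightarrow> continuous_on {0..T} (a w k)"
    and aI: "\<And>w k t. w \<in> ball w0 \<delta> \<Longrightarrow> t \<in> {0..T} \<Longrightarrow>
      a w k t = k + integral {0..t} (\<lambda>s. V' (\<phi> w s) (a w k s))"
    by metis
  have iV': "(\<lambda>s. V' (\<phi> w s) (y s)) integrable_on {0..t}"
    if "w \<in> ball w0 \<delta>" "t \<in> {0..T}" "continuous_on {0..T} y" for w t and y :: "real \<Rightarrow> 'e"
    by (intro integrable_continuous_real continuous_intros continuous_on_subset[OF cV'phi[OF that(1)]]
        continuous_on_subset[OF that(3)]) (use that in auto)
  \<comment> \<open>All the estimates on linearised equations reduce to this bound on the solutions of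
    \<open>u' = V'(\<phi>) u + r\<close>.\<close>
  have gron: "norm (u t) \<le> 2 * (norm k + b * T)"
    if w: "w \<in> ball w0 \<delta>" and u: "continuous_on {0..T} u" and r: "continuous_on {0..T} r"
      and b: "\<And>s. s \<in> {0..T} \<Longrightarrow> norm (r s) \<le> b"
      and eq: "\<And>t. t \<in> {0..T} \<Longrightarrow> u t = k + integral {0..t} (\<lambda>s. V' (\<phi> w s) (u s)) + integral {0..t} r"
      and t: "t \<in> {0..T}" for w t k b and u r :: "real \<Rightarrow> 'e"
  proof (rule norm_le_of_contraction[OF u _ t])
    fix t m assume t: "t \<in> {0..T}" and m: "\<And>s. s \<in> {0..T} \<Longrightarrow> norm (u s) \<le> m"
    have m0: "0 \<le> m" using order_trans[OF norm_ge_zero m[OF t]] .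
    have "norm (integral {0..t} (\<lambda>s. V' (\<phi> w s) (u s))) \<le> (L * m) * T"
    proof (rule norm_integral_le[OF _ _ t])
      show "continuous_on {0..T} (\<lambda>s. V' (\<phi> w s) (u s))" by (intro continuous_intros cV'phi w u)
      fix s assume s: "s \<in> {0..T}"
      have "norm (V' (\<phi> w s) (u s)) \<le> norm (V' (\<phi> w s)) * norm (u s)" by (rule norm_blinfun)
      also have "\<dots> \<le> L * m" using L \<phi>K'[OF w s] s by (intro mult_mono m) auto
      finally show "norm (V' (\<phi> w s) (u s)) \<le> L * m" .
    qed
    also have "\<dots> \<le> m / 2" using mult_right_mono[OF T(3) m0] by (simp add: mult_ac)
    finally have 1: "norm (integral {0..t} (\<lambda>s. V' (\<phi> w s) (u s))) \<le> m / 2" .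
    have 2: "norm (integral {0..t} r) \<le> b * T" by (rule norm_integral_le[OF r b t])
    show "norm (u t) \<le> (norm k + b * T) + m / 2"
      unfolding eq[OF t] using 1 2 norm_triangle_ineq[of k "integral {0..t} (\<lambda>s. V' (\<phi> w s) (u s))"]
        norm_triangle_ineq[of "k + integral {0..t} (\<lambda>s. V' (\<phi> w s) (u s))" "integral {0..t} r"] by linarith
  qed
  have auniq: "y t = a w k t"
    if w: "w \<in> ball w0 \<delta>" and y: "continuous_on {0..T} y"
      and eq: "\<And>t. t \<in> {0..T} \<Longrightarrow> y t = k + integral {0..t} (\<lambda>s. V' (\<phi> w s) (y s))" and t: "t \<in> {0..T}"
    for w y k t
  proof -
    have "norm (y t - a w k t) \<le> 2 * (norm (0::'e) + 0 * T)"
    proof (rule gron[OF w _ continuous_on_const _ _ t])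
      show "continuous_on {0..T} (\<lambda>t. y t - a w k t)" by (intro continuous_intros y ac w)
      show "y t - a w k t = 0 + integral {0..t} (\<lambda>s. V' (\<phi> w s) (y s - a w k s)) + integral {0..t} (\<lambda>_. 0)"
        if t: "t \<in> {0..T}" for t
        using eq[OF t] aI[OF w t, of k] integral_diff[OF iV'[OF w t y] iV'[OF w t ac[OF w, of k]]]
        by (simp add: blinfun.diff_right)
    qed auto
    then show ?thesis by simp
  qed
  have a_bound: "norm (a w k t) \<le> 2 * norm k" if w: "w \<in> ball w0 \<delta>" "t \<in> {0..T}" for w k t
    using gron[OF w(1) ac[OF w(1)] continuous_on_const[of _ 0] _ _ w(2), of 0 k k] aI[OF w(1)] by simp
  have a_lin: "linear (\<lambda>k. a w k T)" if w: "w \<in> ball w0 \<delta>" for w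
  proof
    have TT: "T \<in> {0..T}" using T by auto
    show "a w (k + l) T = a w k T + a w l T" for k l
    proof (rule auniq[symmetric, OF w _ _ TT, of "\<lambda>t. a w k t + a w l t"])
      show "continuous_on {0..T} (\<lambda>t. a w k t + a w l t)" by (intro continuous_intros ac w)
      show "a w k t + a w l t = k + l + integral {0..t} (\<lambda>s. V' (\<phi> w s) (a w k s + a w l s))"
        if t: "t \<in> {0..T}" for t
        using aI[OF w t, of k] aI[OF w t, of l]
          integral_add[OF iV'[OF w t ac[OF w, of k]] iV'[OF w t ac[OF w, of l]]]
        by (simp add: blinfun.add_right)
    qed
    show "a w (c *\<^sub>R k) T = c *\<^sub>R a w k T" for c k
    proof (rule auniq[symmetric, OF w _ _ TT, of "\<lambda>t. c *\<^sub>R a w k t"])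
      show "continuous_on {0..T} (\<lambda>t. c *\<^sub>R a w k t)" by (intro continuous_intros ac w)
      show "c *\<^sub>R a w k t = c *\<^sub>R k + integral {0..t} (\<lambda>s. V' (\<phi> w s) (c *\<^sub>R a w k s))"
        if t: "t \<in> {0..T}" for t
        by (subst aI[OF w t]) (simp add: blinfun.scaleR_right scaleR_add_right)
    qed
  qed
  define A where "A w = Blinfun (\<lambda>k. a w k T)" for w
  have A: "blinfun_apply (A w) = (\<lambda>k. a w k T)" if "w \<in> ball w0 \<delta>" for w
    unfolding A_def using a_lin[OF that]
    by (intro bounded_linear_Blinfun_apply linear_conv_bounded_linear[THEN iffD1])
  have uc: "uniformly_continuous_on ?K V'" using compact_uniformly_continuous[OF cK(2)] by simp
  have unif: "\<exists>d>0. \<forall>w\<in>ball w0 \<delta>. \<forall>w'\<in>ball w0 \<delta>. norm (w - w') < d \<longrightarrow>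
      (\<forall>t\<in>{0..T}. norm (V' (\<phi> w t) - V' (\<phi> w' t)) \<le> e)" if "e > 0" for e
  proof -
    obtain d where d: "d > 0" "\<And>x y. x \<in> ?K \<Longrightarrow> y \<in> ?K \<Longrightarrow> dist y x < d \<Longrightarrow> dist (V' y) (V' x) < e"
      using uc \<open>e > 0\<close> unfolding uniformly_continuous_on_def by metis
    show ?thesis
    proof (intro exI[of _ "d/2"] conjI ballI impI)
      show "d / 2 > 0" using d by simp
      fix w w' t assume *: "w \<in> ball w0 \<delta>" "w' \<in> ball w0 \<delta>" "norm (w - w') < d / 2" "t \<in> {0..T}"
      have "dist (\<phi> w t) (\<phi> w' t) < d" using \<phi>lip[OF *(1,2,4)] *(3) by (simp add: dist_norm)
      moreover have "\<phi> w t \<in> ?K" "\<phi> w' t \<in> ?K" using \<phi>K * by blast+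
      ultimately have "dist (V' (\<phi> w t)) (V' (\<phi> w' t)) < e" using d by blast
      then show "norm (V' (\<phi> w t) - V' (\<phi> w' t)) \<le> e" by (simp add: dist_norm)
    qed
  qed
  \<comment> \<open>The error of the linear approximation of \<open>V\<close> is uniformly small
    over the ball, by uniform continuity of \<open>V'\<close> on a compact set.\<close>
  have lin_err: "\<exists>d>0. \<forall>x\<in>?K. \<forall>y\<in>?K. norm (y - x) < d \<longrightarrow>
      norm (V y - V x - V' x (y - x)) \<le> e * norm (y - x)" if "e > 0" for e
  proof -
    obtain d where d: "d > 0" "\<And>x y. x \<in> ?K \<Longrightarrow> y \<in> ?K \<Longrightarrow> dist y x < d \<Longrightarrow> dist (V' y) (V' x) < e"
      using uc \<open>e > 0\<close> unfolding uniformly_continuous_on_def by metis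
    show ?thesis
    proof (intro exI[of _ d] conjI ballI impI d)
      fix x y assume *: "x \<in> ?K" "y \<in> ?K" "norm (y - x) < d"
      have sub: "closed_segment x y \<subseteq> ?K" using * by (intro closed_segment_subset) auto
      have "norm (V y - V x - V' x (y - x)) \<le> norm (y - x) * e"
      proof (rule differentiable_bound_linearization[where S="closed_segment x y" and f' = "\<lambda>x. blinfun_apply (V' x)"])
        show "x + t *\<^sub>R (y - x) \<in> closed_segment x y" if "t \<in> {0..1}" for t
          using that by (auto simp: closed_segment_def algebra_simps intro!: exI[of _ t])
        show "(V has_derivative V' z) (at z within closed_segment x y)" if "z \<in> closed_segment x y" for z
          using der R sub that by (meson has_derivative_at_withinI subset_iff)
        show "onorm (blinfun_apply (V' z) - blinfun_apply (V' x)) \<le> e" if z: "z \<in> closed_segment x y" for z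
        proof -
          have "dist z x < d" using * segment_bound1[OF z] by (simp add: dist_norm)
          then have "norm (V' z - V' x) < e" using d(2)[of x z] sub z * by (auto simp: dist_norm)
          then show ?thesis by (simp add: norm_blinfun.rep_eq minus_blinfun.rep_eq fun_diff_def)
        qed
      qed auto
      then show "norm (V y - V x - V' x (y - x)) \<le> e * norm (y - x)" by (simp add: mult_ac)
    qed
  qed
  have derA: "((\<lambda>w. \<phi> w T) has_derivative A w) (at w)" if w: "w \<in> ball w0 \<delta>" for w
    unfolding has_derivative_within_alt
  proof (intro conjI allI impI)
    show "bounded_linear (A w)" by (rule blinfun.bounded_linear_right)
    fix e :: real assume e: "e > 0"
    \<comment> \<open>One factor 2 comes from \<open>gron\<close>, the other from the Lipschitz
      constant 2 of the flow; together with \<open>T\<close> they turn \<open>e'\<close> into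
      \<open>e\<close>.\<close>
    define e' where "e' = e / (4 * T)"
    have e': "e' > 0" "2 * (e' * (2 * n) * T) = e * n" for n using e T by (auto simp: e'_def)
    obtain d where d: "d > 0" "\<And>x y. x \<in> ?K \<Longrightarrow> y \<in> ?K \<Longrightarrow> norm (y - x) < d \<Longrightarrow>
      norm (V y - V x - V' x (y - x)) \<le> e' * norm (y - x)" using lin_err[OF e'(1)] by blast
    obtain d2 where d2: "d2 > 0" "ball w d2 \<subseteq> ball w0 \<delta>" using w open_ball open_contains_ball by blast
    show "\<exists>d>0. \<forall>v\<in>UNIV. norm (v - w) < d \<longrightarrow> norm (\<phi> v T - \<phi> w T - A w (v - w)) \<le> e * norm (v - w)"
    proof (intro exI[of _ "min (d/2) d2"] conjI ballI impI)
      show "min (d/2) d2 > 0" using d d2 by simp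
      fix v assume v: "norm (v - w) < min (d/2) d2"
      then have "v \<in> ball w d2" by (simp add: dist_norm norm_minus_commute)
      then have vb: "v \<in> ball w0 \<delta>" using d2 by blast
      \<comment> \<open>The difference of two orbits solves the variational equation along the orbit
        of \<open>w\<close> up to this remainder, so \<open>gron\<close> with initial value 0
        controls its distance from \<open>a w (v - w)\<close>.\<close>
      define r where "r s = V (\<phi> v s) - V (\<phi> w s) - V' (\<phi> w s) (\<phi> v s - \<phi> w s)" for s
      have rc: "continuous_on {0..T} r"
        unfolding r_def by (intro continuous_intros cVphi cV'phi \<phi>c w vb)
      have "norm (\<phi> v T - \<phi> w T - a w (v - w) T) \<le> 2 * (norm (0::'e) + (e' * (2 * norm (v - w))) * T)"
      proof (rule gron[OF w _ rc])
        show "continuous_on {0..T} (\<lambda>t. \<phi> v t - \<phi> w t - a w (v - w) t)"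
          by (intro continuous_intros \<phi>c ac w vb)
        show "T \<in> {0..T}" using T by auto
        show "norm (r s) \<le> e' * (2 * norm (v - w))" if s: "s \<in> {0..T}" for s
        proof -
          have *: "norm (\<phi> v s - \<phi> w s) \<le> 2 * norm (v - w)" by (rule \<phi>lip[OF vb w s])
          then have "norm (r s) \<le> e' * norm (\<phi> v s - \<phi> w s)" unfolding r_def
            using v by (intro d \<phi>K' w vb s) auto
          also have "\<dots> \<le> e' * (2 * norm (v - w))" using * e' by (intro mult_left_mono) auto
          finally show ?thesis .
        qed
        fix t assume t: "t \<in> {0..T}"
        have "\<phi> v t - \<phi> w t = (v - w) + (integral {0..t} (\<lambda>s. V (\<phi> v s)) - integral {0..t} (\<lambda>s. V (\<phi> w s)))"
          using \<phi>I[OF vb t] \<phi>I[OF w t] by simp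
        also have "\<dots> = (v - w) + integral {0..t} (\<lambda>s. V (\<phi> v s) - V (\<phi> w s))"
          using integral_diff[OF iV[OF vb t] iV[OF w t]] by simp
        also have "integral {0..t} (\<lambda>s. V (\<phi> v s) - V (\<phi> w s)) =
           integral {0..t} (\<lambda>s. V' (\<phi> w s) (\<phi> v s - \<phi> w s) + r s)" by (simp add: r_def)
        also have "\<dots> = integral {0..t} (\<lambda>s. V' (\<phi> w s) (\<phi> v s - \<phi> w s)) + integral {0..t} r"
          by (intro integral_add iV'[OF w t] continuous_intros \<phi>c w vb integrable_continuous_real
              continuous_on_subset[OF rc]) (use t in auto)
        finally have 1: "\<phi> v t - \<phi> w t = (v - w) + (integral {0..t} (\<lambda>s. V' (\<phi> w s) (\<phi> v s - \<phi> w s)) + integral {0..t} r)" .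
        have 2: "integral {0..t} (\<lambda>s. V' (\<phi> w s) (\<phi> v s - \<phi> w s - a w (v - w) s)) =
          integral {0..t} (\<lambda>s. V' (\<phi> w s) (\<phi> v s - \<phi> w s)) - integral {0..t} (\<lambda>s. V' (\<phi> w s) (a w (v - w) s))"
          unfolding blinfun.diff_right[of _ "\<phi> v _ - \<phi> w _"]
          by (intro integral_diff iV'[OF w t] continuous_intros \<phi>c w vb ac)
        show "\<phi> v t - \<phi> w t - a w (v - w) t = 0 +
          integral {0..t} (\<lambda>s. V' (\<phi> w s) (\<phi> v s - \<phi> w s - a w (v - w) s)) + integral {0..t} r"
          unfolding 1 2 by (subst aI[OF w t, of "v - w"]) simp
      qed
      then show "norm (\<phi> v T - \<phi> w T - A w (v - w)) \<le> e * norm (v - w)"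
        using e'(2)[of "norm (v - w)"] A[OF w] by (simp only: norm_zero add_0)
    qed
  qed
  have contA: "continuous_on (ball w0 \<delta>) A"
  proof (rule continuous_on_blinfun_componentwise)
    fix k :: 'e assume "k \<in> Basis"
    show "continuous_on (ball w0 \<delta>) (\<lambda>w. A w k)"
      unfolding continuous_on_iff
    proof (intro ballI allI impI)
      fix w and e :: real assume w: "w \<in> ball w0 \<delta>" and e: "e > 0"
      \<comment> \<open>The summand 1 keeps the denominator positive when \<open>k\<close> is 0 and
        makes the resulting estimate strict.\<close>
      define e' where "e' = e / (8 * (norm k + 1) * T)"
      have nk: "norm k < norm k + 1" "0 < norm k + 1" using norm_ge_zero[of k] by linarith+
      have e': "e' > 0" unfolding e'_def using e T nk by (intro divide_pos_pos mult_pos_pos) auto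
      have "4 * (e / (8 * m * T)) * norm k * T = e / 2 * (norm k / m)" if "m > 0" for m
        using T(1) that by (simp add: field_simps)
      from this[OF nk(2)] have "4 * e' * norm k * T = e / 2 * (norm k / (norm k + 1))"
        unfolding e'_def .
      also have "\<dots> \<le> e / 2 * 1" using nk e by (intro mult_left_mono) auto
      also have "\<dots> < e" using e by simp
      finally have e'2: "4 * e' * norm k * T < e" .
      obtain d where d: "d > 0" "\<And>w w' t. w\<in>ball w0 \<delta> \<Longrightarrow> w'\<in>ball w0 \<delta> \<Longrightarrow> norm (w - w') < d \<Longrightarrow>
         t\<in>{0..T} \<Longrightarrow> norm (V' (\<phi> w t) - V' (\<phi> w' t)) \<le> e'" using unif[OF e'] by blast
      show "\<exists>d>0. \<forall>v\<in>ball w0 \<delta>. dist v w < d \<longrightarrow> dist (A v k) (A w k) < e"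
      proof (intro exI[of _ d] conjI ballI impI d)
        fix v assume v: "v \<in> ball w0 \<delta>" "dist v w < d"
        \<comment> \<open>\<open>a v k\<close> solves the equation along the orbit of
          \<open>w\<close> with this forcing term, which is small because \<open>V'\<close> varies
          little between the two orbits.\<close>
        define r where "r s = (V' (\<phi> v s) - V' (\<phi> w s)) (a v k s)" for s
        have rc: "continuous_on {0..T} r"
          unfolding r_def by (intro continuous_intros cV'phi ac w v)
        have "norm (a v k T - a w k T) \<le> 2 * (norm (0::'e) + (e' * (2 * norm k)) * T)"
        proof (rule gron[OF w _ rc])
          show "continuous_on {0..T} (\<lambda>t. a v k t - a w k t)" by (intro continuous_intros ac w v)
          show "T \<in> {0..T}" using T by auto
          show "norm (r s) \<le> e' * (2 * norm k)" if s: "s \<in> {0..T}" for s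
          proof -
            have "norm (r s) \<le> norm (V' (\<phi> v s) - V' (\<phi> w s)) * norm (a v k s)"
              unfolding r_def by (rule norm_blinfun)
            also have "\<dots> \<le> e' * (2 * norm k)" using d(2)[OF v(1) w _ s] v(2) e' a_bound[OF v(1) s]
              by (intro mult_mono) (auto simp: dist_norm)
            finally show ?thesis .
          qed
          fix t assume t: "t \<in> {0..T}"
          have "integral {0..t} (\<lambda>s. V' (\<phi> w s) (a v k s - a w k s)) + integral {0..t} r =
            integral {0..t} (\<lambda>s. V' (\<phi> w s) (a v k s - a w k s) + r s)"
            by (intro integral_add[symmetric] iV'[OF w t] continuous_intros ac w v integrable_continuous_real
              continuous_on_subset[OF rc]) (use t in auto)
          also have "\<dots> = integral {0..t} (\<lambda>s. V' (\<phi> v s) (a v k s) - V' (\<phi> w s) (a w k s))"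
            by (simp add: r_def blinfun.diff_left blinfun.diff_right algebra_simps)
          also have "\<dots> = integral {0..t} (\<lambda>s. V' (\<phi> v s) (a v k s)) - integral {0..t} (\<lambda>s. V' (\<phi> w s) (a w k s))"
            by (intro integral_diff iV' w v t ac)
          finally show "a v k t - a w k t = 0 + integral {0..t} (\<lambda>s. V' (\<phi> w s) (a v k s - a w k s)) + integral {0..t} r"
            using aI[OF w t, of k] aI[OF v(1) t, of k] by (simp add: algebra_simps)
        qed
        also have "\<dots> < e" using e'2 by simp
        finally show "dist (A v k) (A w k) < e" using A w v by (simp add: dist_norm)
      qed
    qed
  qed
  show ?thesis
  proof (rule that[of T \<delta> \<phi> A])
    show "\<phi> w 0 = w" if "w \<in> ball w0 \<delta>" for w using \<phi>I[OF that, of 0] T by simp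
    show "\<phi> w t \<in> U" if "w \<in> ball w0 \<delta>" "t \<in> {0..T}" for w t using \<phi>K[OF that(1)] that(2) R by blast
    show "(\<phi> w has_vector_derivative V (\<phi> w t)) (at t within {0..T})"
      if w: "w \<in> ball w0 \<delta>" and t: "t \<in> {0..T}" for w t
    proof -
      have "((\<lambda>t. w + integral {0..t} (\<lambda>s. V (\<phi> w s))) has_vector_derivative V (\<phi> w t)) (at t within {0..T})"
        using integral_has_vector_derivative[OF cVphi[OF w] t]
        by (auto intro!: derivative_eq_intros)
      then show ?thesis by (rule has_vector_derivative_transform[OF t, rotated]) (simp add: \<phi>I[OF w])
    qed
    show "\<phi> w0 t = w0" if V0: "V w0 = 0" and t: "t \<in> {0..T}" for t
    proof -
      have w: "w0 \<in> ball w0 \<delta>" using \<delta> by simp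
      \<comment> \<open>The constant in the contraction estimate is 0 since \<open>V\<close>
        vanishes at \<open>w0\<close>, so the orbit does not move.\<close>
      have "norm (\<phi> w0 t - w0) \<le> 2 * 0"
      proof (rule norm_le_of_contraction[OF _ _ t])
        show "continuous_on {0..T} (\<lambda>t. \<phi> w0 t - w0)" by (intro continuous_intros \<phi>c w)
        fix t m assume t: "t \<in> {0..T}" and m: "\<And>s. s \<in> {0..T} \<Longrightarrow> norm (\<phi> w0 s - w0) \<le> m"
        have m0: "0 \<le> m" using order_trans[OF norm_ge_zero m[OF t]] .
        have "norm (integral {0..t} (\<lambda>s. V (\<phi> w0 s))) \<le> (L * m) * T"
        proof (rule norm_integral_le[OF cVphi[OF w] _ t])
          fix s assume s: "s \<in> {0..T}"
          have "norm (V (\<phi> w0 s) - V w0) \<le> L * norm (\<phi> w0 s - w0)"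
            using R by (intro lipV \<phi>K' w s) auto
          also have "\<dots> \<le> L * m" using m[OF s] L by simp
          finally show "norm (V (\<phi> w0 s)) \<le> L * m" using V0 by simp
        qed
        also have "\<dots> \<le> m / 2" using mult_right_mono[OF T(3) m0] by (simp add: mult_ac)
        finally show "norm (\<phi> w0 t - w0) \<le> 0 + m / 2" using \<phi>I[OF w t] by simp
      qed
      then show ?thesis by simp
    qed
    show "A w (y 0) = y T" if w: "w \<in> ball w0 \<delta>" and
      y: "\<And>t. t \<in> {0..T} \<Longrightarrow> (y has_vector_derivative V' (\<phi> w t) (y t)) (at t within {0..T})" for w y
    proof -
      have yc: "continuous_on {0..T} y"
        using y has_vector_derivative_continuous continuous_on_eq_continuous_within by blast
      have eq: "y t = y 0 + integral {0..t} (\<lambda>s. V' (\<phi> w s) (y s))" if t: "t \<in> {0..T}" for t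
      proof -
        have "((\<lambda>s. V' (\<phi> w s) (y s)) has_integral y t - y 0) {0..t}"
          using t by (intro fundamental_theorem_of_calculus has_vector_derivative_within_subset[OF y]) auto
        then show ?thesis by (simp add: integral_unique)
      qed
      have "y T = a w (y 0) T" by (rule auniq[OF w yc eq]) (use T in auto)
      then show ?thesis by (simp add: A[OF w])
    qed
  qed (use T \<delta> derA contA in auto)
qed

section \<open>Calculus of maps of class \<open>C\<^sup>1\<close>\<close>

lemma Ck_on_subset: "Ck_on k f S \<Longrightarrow> T \<subseteq> S \<Longrightarrow> Ck_on k f T"
  by (induction k arbitrary: f) (auto intro: continuous_on_subset)

text \<open>Openness of \<open>S\<close> matters: the derivative at a point of \<open>S\<close> sees
  the values on a whole neighbourhood.\<close>

lemma Ck_on_cong: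
  assumes "open S" "\<And>x. x \<in> S \<Longrightarrow> f x = g x"
  shows "Ck_on k f S \<longleftrightarrow> Ck_on k g S"
  using assms
proof (induction k arbitrary: f g)
  case 0
  then show ?case by (auto cong: continuous_on_cong)
next
  case (Suc k)
  have der: "(f has_derivative D) (at x) \<longleftrightarrow> (g has_derivative D) (at x)" if "x \<in> S" for x D
  proof
    show "(g has_derivative D) (at x)" if "(f has_derivative D) (at x)"
      by (rule has_derivative_transform_within_open[OF that Suc.prems(1) \<open>x \<in> S\<close> Suc.prems(2)])
    show "(f has_derivative D) (at x)" if "(g has_derivative D) (at x)"
      by (rule has_derivative_transform_within_open[OF that Suc.prems(1) \<open>x \<in> S\<close> Suc.prems(2)[symmetric]])
  qed
  then have "f differentiable (at x) \<longleftrightarrow> g differentiable (at x)" if "x \<in> S" for x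
    using that by (simp add: differentiable_def)
  moreover have "frechet_derivative f (at x) = frechet_derivative g (at x)" if "x \<in> S" for x
    using der[OF that] by (simp add: frechet_derivative_def)
  then have "Ck_on k (\<lambda>x. frechet_derivative f (at x) v) S \<longleftrightarrow> Ck_on k (\<lambda>x. frechet_derivative g (at x) v) S" for v
    using Suc.prems by (intro Suc.IH) auto
  ultimately show ?case by simp
qed

lemma Ck_on_Suc_imp: "Ck_on (Suc k) f S \<Longrightarrow> Ck_on k f S"
proof (induction k arbitrary: f)
  case 0
  then show ?case
    by (auto intro: continuous_at_imp_continuous_on differentiable_imp_continuous_within)
next
  case (Suc k)
  from Suc.prems show ?case unfolding Ck_on.simps(2)[of "Suc k"] Ck_on.simps(2)[of k f]
    by (auto intro: Suc.IH simp del: Ck_on.simps)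
qed

lemma Ck_on_le: "Ck_on l f S \<Longrightarrow> k \<le> l \<Longrightarrow> Ck_on k f S"
  by (induction l) (auto simp: le_Suc_eq simp del: Ck_on.simps intro: Ck_on_Suc_imp)

lemma C1_onI:
  assumes "\<And>x. x \<in> S \<Longrightarrow> (f has_derivative f' x) (at x)" "\<And>v. continuous_on S (\<lambda>x. f' x v)"
  shows "Ck_on 1 f S"
proof -
  have "frechet_derivative f (at x) = f' x" if "x \<in> S" for x
    using assms(1)[OF that] frechet_derivative_at by metis
  then show ?thesis using assms by (auto simp: differentiable_def cong: continuous_on_cong)
qed

lemma C1_on_has_derivative:
  "Ck_on 1 f S \<Longrightarrow> x \<in> S \<Longrightarrow> (f has_derivative frechet_derivative f (at x)) (at x)"
  by (simp add: frechet_derivative_works)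

lemma C1_on_continuous_derivative:
  "Ck_on 1 f S \<Longrightarrow> continuous_on S (\<lambda>x. frechet_derivative f (at x) v)"
  by simp

lemma C1_on_continuous: "Ck_on 1 f S \<Longrightarrow> continuous_on S f"
  using Ck_on_Suc_imp[of 0 f S] by simp

text \<open>In finite dimension, continuity of each directional derivative gives continuity of the
  derivative in operator norm, the form in which composition and the flow use it.\<close>

lemma C1_on_blinfun:
  assumes "Ck_on 1 f S"
  obtains f' where "\<And>x. x \<in> S \<Longrightarrow> (f has_derivative blinfun_apply (f' x)) (at x)" "continuous_on S f'"
proof
  let ?f' = "\<lambda>x. Blinfun (frechet_derivative f (at x))"
  have *: "blinfun_apply (?f' x) = frechet_derivative f (at x)" if "x \<in> S" for x
    using C1_on_has_derivative[OF assms that]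
    by (intro bounded_linear_Blinfun_apply has_derivative_bounded_linear)
  show "(f has_derivative blinfun_apply (?f' x)) (at x)" if "x \<in> S" for x
    using C1_on_has_derivative[OF assms that] *[OF that] by simp
  show "continuous_on S ?f'"
    using C1_on_continuous_derivative[OF assms] *
    by (intro continuous_on_blinfun_componentwise) (auto cong: continuous_on_cong)
qed

lemma C1_on_blinfunI:
  assumes "\<And>x. x \<in> S \<Longrightarrow> (f has_derivative blinfun_apply (f' x)) (at x)" "continuous_on S f'"
  shows "Ck_on 1 f S"
  using assms by (intro C1_onI[of _ _ "\<lambda>x. blinfun_apply (f' x)"] continuous_intros)

lemma C1_on_compose:
  assumes "Ck_on 1 f S" "Ck_on 1 g T" "f ` S \<subseteq> T"
  shows "Ck_on 1 (\<lambda>x. g (f x)) S"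
proof -
  obtain f' where f': "\<And>x. x \<in> S \<Longrightarrow> (f has_derivative blinfun_apply (f' x)) (at x)" "continuous_on S f'"
    by (rule C1_on_blinfun[OF assms(1)]) blast
  obtain g' where g': "\<And>x. x \<in> T \<Longrightarrow> (g has_derivative blinfun_apply (g' x)) (at x)" "continuous_on T g'"
    by (rule C1_on_blinfun[OF assms(2)]) blast
  show ?thesis
  proof (rule C1_on_blinfunI[where f' = "\<lambda>x. g' (f x) o\<^sub>L f' x"])
    show "((\<lambda>x. g (f x)) has_derivative (g' (f x) o\<^sub>L f' x)) (at x)" if "x \<in> S" for x
      using has_derivative_compose[OF f'(1)[OF that] g'(1)] that assms(3) by (auto simp: o_def blinfun_compose.rep_eq)
    show "continuous_on S (\<lambda>x. g' (f x) o\<^sub>L f' x)"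
      by (intro continuous_intros f' continuous_on_compose2[OF g'(2) C1_on_continuous[OF assms(1)]] assms)
  qed
qed

lemma C1_on_bilinear:
  assumes "bounded_bilinear B" "Ck_on 1 f S" "Ck_on 1 g S"
  shows "Ck_on 1 (\<lambda>x. B (f x) (g x)) S"
proof -
  interpret bounded_bilinear B by fact
  show ?thesis
  proof (rule C1_onI)
    show "((\<lambda>x. B (f x) (g x)) has_derivative (\<lambda>v. B (f x) (frechet_derivative g (at x) v) +
        B (frechet_derivative f (at x) v) (g x))) (at x)" if "x \<in> S" for x
      by (rule FDERIV[OF C1_on_has_derivative[OF assms(2) that] C1_on_has_derivative[OF assms(3) that]])
  qed (intro continuous_intros continuous_on C1_on_continuous C1_on_continuous_derivative assms)
qed

lemma C1_on_linear:
  assumes "bounded_linear L" "Ck_on 1 f S"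
  shows "Ck_on 1 (\<lambda>x. L (f x)) S"
  by (rule C1_onI[OF bounded_linear.has_derivative[OF assms(1) C1_on_has_derivative[OF assms(2)]]], assumption)
    (intro bounded_linear.continuous_on[OF assms(1)] C1_on_continuous_derivative assms)

lemma C1_on_const [simp]: "Ck_on 1 (\<lambda>x. c) S"
  by (rule C1_onI[where f' = "\<lambda>_ _. 0"]) auto

lemma C1_on_ident: "bounded_linear L \<Longrightarrow> Ck_on 1 L S"
  by (rule C1_onI[where f' = "\<lambda>_. L"]) (auto intro: bounded_linear_imp_has_derivative)

lemma C1_on_add:
  assumes "Ck_on 1 f S" "Ck_on 1 g S"
  shows "Ck_on 1 (\<lambda>x. f x + g x) S"
  by (rule C1_onI[OF has_derivative_add[OF C1_on_has_derivative[OF assms(1)] C1_on_has_derivative[OF assms(2)]]])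
    (auto intro!: continuous_intros C1_on_continuous_derivative assms simp del: One_nat_def)

lemma C1_on_sum:
  "(\<And>i. i \<in> I \<Longrightarrow> Ck_on 1 (f i) S) \<Longrightarrow> Ck_on 1 (\<lambda>x. \<Sum>i\<in>I. f i x) S"
  by (induction I rule: infinite_finite_induct) (auto intro!: C1_on_add simp del: Ck_on.simps One_nat_def)

lemmas C1_on_scaleR = C1_on_bilinear[OF bounded_bilinear_scaleR]
lemmas C1_on_mult = C1_on_bilinear[OF bounded_bilinear_mult]

lemma C1_on_prod:
  fixes f :: "'i \<Rightarrow> 'e::euclidean_space \<Rightarrow> real"
  shows "(\<And>i. i \<in> I \<Longrightarrow> Ck_on 1 (f i) S) \<Longrightarrow> Ck_on 1 (\<lambda>x. \<Prod>i\<in>I. f i x) S"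
  by (induction I rule: infinite_finite_induct) (auto intro!: C1_on_mult simp del: Ck_on.simps One_nat_def)

lemma C1_on_divide:
  fixes f g :: "'e::euclidean_space \<Rightarrow> real"
  assumes "Ck_on 1 f S" "Ck_on 1 g S" "\<And>x. x \<in> S \<Longrightarrow> g x \<noteq> 0"
  shows "Ck_on 1 (\<lambda>x. f x / g x) S"
proof (rule C1_onI)
  show "((\<lambda>x. f x / g x) has_derivative (\<lambda>h. - f x * (inverse (g x) * frechet_derivative g (at x) h * inverse (g x)) +
      frechet_derivative f (at x) h / g x)) (at x)" if "x \<in> S" for x
    by (rule has_derivative_divide[OF C1_on_has_derivative[OF assms(1) that] C1_on_has_derivative[OF assms(2) that] assms(3)[OF that]])
qed (intro continuous_intros C1_on_continuous_derivative C1_on_continuous assms ballI)+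

lemma C1_on_componentwise:
  fixes f :: "'e::euclidean_space \<Rightarrow> real ^ 'n"
  assumes "\<And>k. Ck_on 1 (\<lambda>x. f x $ k) S"
  shows "Ck_on 1 f S"
proof -
  have *: "(\<lambda>x. \<Sum>k\<in>UNIV. f x $ k *\<^sub>R axis k 1) = f"
    by (simp add: fun_eq_iff vec_eq_iff axis_def if_distrib cong: if_cong)
  have "Ck_on 1 (\<lambda>x. \<Sum>k\<in>UNIV. f x $ k *\<^sub>R (axis k 1 :: real ^ 'n)) S"
    by (intro C1_on_sum C1_on_scaleR assms C1_on_const)
  then show ?thesis unfolding * .
qed

lemma linear_sum_Basis:
  fixes M :: "'e::euclidean_space \<Rightarrow> 'f::real_vector"
  assumes "linear M"
  shows "M w = (\<Sum>b\<in>Basis. (w \<bullet> b) *\<^sub>R M b)"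
  by (subst euclidean_representation[symmetric, of w]) (simp add: linear_sum[OF assms] linear_cmul[OF assms])

text \<open>A product rule that asks for differentiability of \<open>M z v\<close> for each fixed
  \<open>v\<close> only: expanding \<open>y z\<close> in the basis leaves finitely many such
  vectors.\<close>

lemma has_derivative_linear_family:
  fixes M :: "'d::euclidean_space \<Rightarrow> 'e::euclidean_space \<Rightarrow> 'f::real_normed_vector"
  assumes U: "open U" "z0 \<in> U" and lin: "\<And>z. z \<in> U \<Longrightarrow> linear (M z)"
    and M': "\<And>v. ((\<lambda>z. M z v) has_derivative M' v) (at z0)" and y: "(y has_derivative y') (at z0)"
  shows "((\<lambda>z. M z (y z)) has_derivative (\<lambda>k. M' (y z0) k + M z0 (y' k))) (at z0)"
proof -
  have M'eq: "M' w = (\<lambda>k. \<Sum>b\<in>Basis. (w \<bullet> b) *\<^sub>R M' b k)" for w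
  proof (rule has_derivative_unique[OF M'])
    have "((\<lambda>z. \<Sum>b\<in>Basis. (w \<bullet> b) *\<^sub>R M z b) has_derivative (\<lambda>k. \<Sum>b\<in>Basis. (w \<bullet> b) *\<^sub>R M' b k)) (at z0)"
      by (intro has_derivative_sum has_derivative_scaleR_right M')
    then show "((\<lambda>z. M z w) has_derivative (\<lambda>k. \<Sum>b\<in>Basis. (w \<bullet> b) *\<^sub>R M' b k)) (at z0)"
      by (rule has_derivative_transform_within_open[OF _ U]) (simp add: linear_sum_Basis[OF lin, symmetric])
  qed
  have "((\<lambda>z. \<Sum>b\<in>Basis. (y z \<bullet> b) *\<^sub>R M z b) has_derivative
    (\<lambda>k. \<Sum>b\<in>Basis. (y z0 \<bullet> b) *\<^sub>R M' b k + (y' k \<bullet> b) *\<^sub>R M z0 b)) (at z0)"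
    by (intro has_derivative_sum has_derivative_scaleR M' has_derivative_inner_left y)
  also have "(\<lambda>k. \<Sum>b\<in>Basis. (y z0 \<bullet> b) *\<^sub>R M' b k + (y' k \<bullet> b) *\<^sub>R M z0 b) =
    (\<lambda>k. M' (y z0) k + M z0 (y' k))"
    by (simp add: sum.distrib M'eq[of "y z0"] linear_sum_Basis[OF lin[OF U(2)], of "y' _"])
  finally show ?thesis
    by (rule has_derivative_transform_within_open[OF _ U]) (simp add: linear_sum_Basis[OF lin, symmetric])
qed

lemma C1_on_linear_family:
  fixes M :: "'d::euclidean_space \<Rightarrow> 'e::euclidean_space \<Rightarrow> 'f::real_normed_vector"
  assumes U: "open U" and lin: "\<And>z. z \<in> U \<Longrightarrow> linear (M z)"
    and M: "\<And>v. Ck_on 1 (\<lambda>z. M z v) U" and y: "Ck_on 1 y U"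
  shows "Ck_on 1 (\<lambda>z. M z (y z)) U"
proof -
  have "Ck_on 1 (\<lambda>z. \<Sum>b\<in>Basis. (y z \<bullet> b) *\<^sub>R M z b) U"
    by (intro C1_on_sum C1_on_scaleR M C1_on_linear[OF bounded_linear_inner_left] y)
  then show ?thesis
    by (subst Ck_on_cong[OF U]) (auto simp: linear_sum_Basis[OF lin, symmetric])
qed

section \<open>Inverses of families of linear maps\<close>

lemma cramer_inverse:
  fixes L :: "real ^ 'n \<Rightarrow> real ^ 'n"
  assumes "linear L" "det (matrix L) \<noteq> 0"
  shows "L x = b \<longleftrightarrow>
    x = (\<chi> k. det (\<chi> i j. if j = k then b $ i else L (axis j 1) $ i) / det (matrix L))"
proof -
  have "L x = matrix L *v x" using assms(1) by (simp add: matrix_works)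
  moreover have "matrix L $ i $ j = L (axis j 1) $ i" for i j by (simp add: matrix_def)
  ultimately show ?thesis using cramer[OF assms(2), of x b] by (simp only:)
qed

lemma det_matrix_nonzero:
  fixes L :: "real ^ 'n \<Rightarrow> real ^ 'n"
  assumes "linear L" "inj L" shows "det (matrix L) \<noteq> 0"
  using linear_injective_isomorphism[OF assms] assms(1)
  by (simp add: invertible_det_nz[symmetric] matrix_invertible matrix_of_matrix_vector_mul o_def fun_eq_iff) blast

text \<open>By Cramer's rule the entries of the inverse are rational functions of the entries of
  \<open>M z\<close>, with nonzero denominator on \<open>U1\<close>. The C^1 conclusion is
  conditional, so that one lemma serves both the merely continuous derivative in the inverse
  function theorem and the C^1 coframe in Frobenius' theorem.\<close>

lemma inverse_linear_family:
  fixes M :: "'d::euclidean_space \<Rightarrow> real ^ 'n \<Rightarrow> real ^ 'n"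
  assumes U: "open U" "x0 \<in> U" and lin: "\<And>z. z \<in> U \<Longrightarrow> linear (M z)"
    and M: "\<And>v. continuous_on U (\<lambda>z. M z v)" and inj: "inj (M x0)"
  obtains U1 N where "open U1" "x0 \<in> U1" "U1 \<subseteq> U" "\<And>z. z \<in> U1 \<Longrightarrow> linear (N z)"
    "\<And>z v. z \<in> U1 \<Longrightarrow> M z (N z v) = v" "\<And>z v. z \<in> U1 \<Longrightarrow> N z (M z v) = v"
    "\<And>v. continuous_on U1 (\<lambda>z. N z v)"
    "\<And>v. \<forall>v. Ck_on 1 (\<lambda>z. M z v) U \<Longrightarrow> Ck_on 1 (\<lambda>z. N z v) U1"
proof -
  define N where "N z b = (\<chi> k. det (\<chi> i j. if j = k then b $ i else M z (axis j 1) $ i) / det (matrix (M z)))" for z b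
  have detc: "continuous_on U (\<lambda>z. det (matrix (M z)))"
    unfolding det_def matrix_def by (auto intro!: continuous_intros M)
  define U1 where "U1 = {z \<in> U. det (matrix (M z)) \<noteq> 0}"
  have "U1 = (\<lambda>z. det (matrix (M z))) -` (- {0}) \<inter> U" by (auto simp: U1_def)
  then have "open U1" using continuous_open_preimage[OF detc U(1), of "-{0}"] by (simp add: Int_commute open_Compl)
  have N: "M z x = b \<longleftrightarrow> x = N z b" if "z \<in> U1" for z x b
    using that lin cramer_inverse[of "M z" x b] by (auto simp: U1_def N_def)
  have sub: "U1 \<subseteq> U" by (auto simp: U1_def)
  show ?thesis
  proof (rule that[of U1 N])
    show "x0 \<in> U1" using U det_matrix_nonzero[OF lin[OF U(2)] inj] by (simp add: U1_def)
    show MN: "M z (N z v) = v" and NM: "N z (M z v) = v" if "z \<in> U1" for z v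
      using N[OF that] by (metis, metis)
    show "linear (N z)" if z: "z \<in> U1" for z
    proof -
      have l: "linear (M z)" using lin sub z by auto
      show ?thesis
        by (rule linearI; rule sym; rule N[OF z, THEN iffD1]) (simp_all add: linear_add[OF l] linear_cmul[OF l] MN[OF z])
    qed
    show "continuous_on U1 (\<lambda>z. N z v)" for v
    proof -
      have entry: "continuous_on U1 (\<lambda>z. if j = k then v $ i else M z (axis j 1) $ i)" for i j k
        by (cases "j = k") (auto intro!: continuous_intros continuous_on_subset[OF M sub])
      have "continuous_on U1 (\<lambda>z. det (\<chi> i j. if j = k then v $ i else M z (axis j 1) $ i))" for k
        unfolding det_def vec_lambda_beta by (intro continuous_intros entry)
      then show ?thesis unfolding N_def
        by (intro continuous_on_vec_lambda continuous_on_divide continuous_on_subset[OF detc sub])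
          (auto simp: U1_def)
    qed
    show "Ck_on 1 (\<lambda>z. N z v) U1" if C1: "\<forall>v. Ck_on 1 (\<lambda>z. M z v) U" for v
    proof (rule C1_on_componentwise)
      fix k
      have e: "Ck_on 1 (\<lambda>z. M z (axis j 1) $ i) U1" for i j
        by (rule C1_on_linear[OF bounded_linear_vec_nth Ck_on_subset[OF C1[rule_format] sub]])
      have e': "Ck_on 1 (\<lambda>z. if j = k then v $ i else M z (axis j 1) $ i) U1" for i j
        using e by (cases "j = k") (simp_all del: Ck_on.simps One_nat_def)
      have "Ck_on 1 (\<lambda>z. det (matrix (M z))) U1"
        unfolding det_def matrix_def
        by (auto intro!: C1_on_sum C1_on_prod C1_on_mult e simp del: Ck_on.simps One_nat_def)
      moreover have "Ck_on 1 (\<lambda>z. det (\<chi> i j. if j = k then v $ i else M z (axis j 1) $ i)) U1"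
        unfolding det_def
        by (auto intro!: C1_on_sum C1_on_prod C1_on_mult e' simp del: Ck_on.simps One_nat_def)
      ultimately show "Ck_on 1 (\<lambda>z. N z v $ k) U1"
        unfolding N_def vec_lambda_beta by (intro C1_on_divide) (simp_all add: U1_def)
    qed
  qed (use \<open>open U1\<close> sub in auto)
qed

section \<open>Second derivatives and the exterior derivative of a pullback\<close>

lemma second_difference_bound:
  fixes f :: "'e::euclidean_space \<Rightarrow> real"
  assumes S: "open S" "x0 \<in> S" and f': "\<And>x. x \<in> S \<Longrightarrow> (f has_derivative f' x) (at x)"
    and a: "((\<lambda>x. f' x u) has_derivative a) (at x0)" and e: "0 < e"
  shows "\<exists>d>0. \<forall>h. 0 < h \<and> h < d \<longrightarrow>
    \<bar>f (x0 + h *\<^sub>R u + h *\<^sub>R v) - f (x0 + h *\<^sub>R u) - f (x0 + h *\<^sub>R v) + f x0 - h^2 * a v\<bar> \<le> e * h^2"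
proof -
  define n where "n = norm u + norm v + 1"
  have n: "n > 0" "norm u + norm v \<le> n" by (auto simp: n_def add_nonneg_pos)
  define e' where "e' = e / (2 * n)"
  have e': "e' > 0" "2 * e' * n = e" using e n by (auto simp: e'_def)
  obtain d1 where d1: "d1 > 0" "\<And>y. norm (y - x0) < d1 \<Longrightarrow> \<bar>f' y u - f' x0 u - a (y - x0)\<bar> \<le> e' * norm (y - x0)"
    using a e' unfolding has_derivative_at_alt by (metis real_norm_def)
  obtain d2 where d2: "d2 > 0" "ball x0 d2 \<subseteq> S" using S open_contains_ball by blast
  have la: "linear a" using a has_derivative_linear by blast
  show ?thesis
  proof (intro exI[of _ "min d1 d2 / n"] conjI allI impI)
    show "0 < min d1 d2 / n" using d1 d2 n by simp
    fix h assume "0 < h \<and> h < min d1 d2 / n"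
    then have h: "0 < h" "h * n < d1" "h * n < d2" using n by (auto simp: field_simps)
    have nb: "norm (x0 + s *\<^sub>R u + t *\<^sub>R v - x0) \<le> h * n" if "0 \<le> s" "s \<le> h" "0 \<le> t" "t \<le> h" for s t
    proof -
      have "norm (x0 + s *\<^sub>R u + t *\<^sub>R v - x0) \<le> norm (s *\<^sub>R u) + norm (t *\<^sub>R v)"
        using norm_triangle_ineq[of "s *\<^sub>R u" "t *\<^sub>R v"] by (simp add: algebra_simps)
      also have "\<dots> \<le> h * norm u + h * norm v" using that by (intro add_mono) (auto intro!: mult_right_mono)
      also have "\<dots> \<le> h * n" using n h by (simp add: distrib_left[symmetric])
      finally show ?thesis .
    qed
    have inS: "x0 + s *\<^sub>R u + t *\<^sub>R v \<in> S" if "0 \<le> s" "s \<le> h" "0 \<le> t" "t \<le> h" for s t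
    proof -
      have "x0 + s *\<^sub>R u + t *\<^sub>R v \<in> ball x0 d2"
        using le_less_trans[OF nb[OF that] h(3)] by (metis dist_commute dist_norm mem_ball)
      then show ?thesis using d2 by blast
    qed
    \<comment> \<open>The increment in direction \<open>v\<close>, as a function of the parameter
      along \<open>u\<close>. The mean value theorem expresses its change through \<open>f'\<close>
      on \<open>u\<close>, and differentiability of that function at \<open>x0\<close> gives the
      second-order term.\<close>
    define \<phi> where "\<phi> s = f (x0 + s *\<^sub>R u + h *\<^sub>R v) - f (x0 + s *\<^sub>R u)" for s
    have der: "(\<phi> has_real_derivative f' (x0 + s *\<^sub>R u + h *\<^sub>R v) u - f' (x0 + s *\<^sub>R u) u) (at s)"
      if s: "0 \<le> s" "s \<le> h" for s
    proof -
      have 1: "((\<lambda>s. f (x0 + s *\<^sub>R u + t *\<^sub>R v)) has_derivative (\<lambda>r. f' (x0 + s *\<^sub>R u + t *\<^sub>R v) (r *\<^sub>R u))) (at s)"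
        if "0 \<le> t" "t \<le> h" for t
        by (rule has_derivative_compose[where g=f and f="\<lambda>s. x0 + s *\<^sub>R u + t *\<^sub>R v", OF _ f'[OF inS[OF s that]]]) (auto intro!: derivative_eq_intros)
      have l: "linear (f' (x0 + s *\<^sub>R u + t *\<^sub>R v))" if "0 \<le> t" "t \<le> h" for t
        using f'[OF inS[OF s that]] has_derivative_linear by blast
      have 2: "((\<lambda>s. f (x0 + s *\<^sub>R u)) has_derivative (\<lambda>r. f' (x0 + s *\<^sub>R u) (r *\<^sub>R u))) (at s)"
        using 1[of 0] h by simp
      show ?thesis unfolding \<phi>_def has_field_derivative_def
        by (rule has_derivative_eq_rhs[OF has_derivative_diff[OF 1[of h] 2]])
          (use h linear_cmul[OF l[of h]] linear_cmul[OF l[of 0]] in \<open>auto simp: algebra_simps\<close>)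
    qed
    obtain s where s: "0 < s" "s < h" "\<phi> h - \<phi> 0 = (h - 0) * (f' (x0 + s *\<^sub>R u + h *\<^sub>R v) u - f' (x0 + s *\<^sub>R u) u)"
      using MVT2[OF h(1), of \<phi> "\<lambda>s. f' (x0 + s *\<^sub>R u + h *\<^sub>R v) u - f' (x0 + s *\<^sub>R u) u"] der by auto
    have bd: "\<bar>f' (x0 + s *\<^sub>R u + t *\<^sub>R v) u - f' x0 u - a (s *\<^sub>R u + t *\<^sub>R v)\<bar> \<le> e' * (h * n)"
      if t: "0 \<le> t" "t \<le> h" for t
    proof -
      have *: "norm (x0 + s *\<^sub>R u + t *\<^sub>R v - x0) \<le> h * n" using nb s t by simp
      have "\<bar>f' (x0 + s *\<^sub>R u + t *\<^sub>R v) u - f' x0 u - a (x0 + s *\<^sub>R u + t *\<^sub>R v - x0)\<bar>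
        \<le> e' * norm (x0 + s *\<^sub>R u + t *\<^sub>R v - x0)" using d1(2) * h by (meson le_less_trans)
      also have "\<dots> \<le> e' * (h * n)" using * e' by (intro mult_left_mono) auto
      finally show ?thesis by (simp add: algebra_simps)
    qed
    have "a (s *\<^sub>R u + h *\<^sub>R v) - a (s *\<^sub>R u) = h * a v" by (simp add: linear_add[OF la] linear_cmul[OF la])
    then have "\<bar>f' (x0 + s *\<^sub>R u + h *\<^sub>R v) u - f' (x0 + s *\<^sub>R u) u - h * a v\<bar> \<le> 2 * (e' * (h * n))"
      using bd[of h] bd[of 0] h by simp
    then have "h * \<bar>f' (x0 + s *\<^sub>R u + h *\<^sub>R v) u - f' (x0 + s *\<^sub>R u) u - h * a v\<bar> \<le> h * (e * h)"
      using h e'(2) by (intro mult_left_mono) (auto simp: mult_ac)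
    moreover have "h * \<bar>f' (x0 + s *\<^sub>R u + h *\<^sub>R v) u - f' (x0 + s *\<^sub>R u) u - h * a v\<bar> =
      \<bar>\<phi> h - \<phi> 0 - h^2 * a v\<bar>" using h by (simp add: s(3) power2_eq_square abs_mult_pos' algebra_simps)
    ultimately have "\<bar>\<phi> h - \<phi> 0 - h^2 * a v\<bar> \<le> e * h^2" by (simp add: power2_eq_square mult_ac)
    then show "\<bar>f (x0 + h *\<^sub>R u + h *\<^sub>R v) - f (x0 + h *\<^sub>R u) - f (x0 + h *\<^sub>R v) + f x0 - h^2 * a v\<bar> \<le> e * h^2"
      by (simp add: \<phi>_def algebra_simps)
  qed
qed

text \<open>The second difference with increments h u and h v is symmetric in \<open>u\<close> and
  \<open>v\<close>, and up to o(h^2) it equals both h^2 \<open>a v\<close> and h^2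
  \<open>b u\<close>.\<close>

lemma symmetric_second_derivative:
  fixes f :: "'e::euclidean_space \<Rightarrow> real"
  assumes S: "open S" "x0 \<in> S" and f': "\<And>x. x \<in> S \<Longrightarrow> (f has_derivative f' x) (at x)"
    and a: "((\<lambda>x. f' x u) has_derivative a) (at x0)" and b: "((\<lambda>x. f' x v) has_derivative b) (at x0)"
  shows "a v = b u"
proof -
  have "\<bar>a v - b u\<bar> \<le> 2 * e" if e: "e > 0" for e
  proof -
    obtain d1 where d1: "d1 > 0" "\<And>h. 0 < h \<Longrightarrow> h < d1 \<Longrightarrow>
      \<bar>f (x0 + h *\<^sub>R u + h *\<^sub>R v) - f (x0 + h *\<^sub>R u) - f (x0 + h *\<^sub>R v) + f x0 - h^2 * a v\<bar> \<le> e * h^2"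
      using second_difference_bound[OF S f' a e, of v] by auto
    obtain d2 where d2: "d2 > 0" "\<And>h. 0 < h \<Longrightarrow> h < d2 \<Longrightarrow>
      \<bar>f (x0 + h *\<^sub>R v + h *\<^sub>R u) - f (x0 + h *\<^sub>R v) - f (x0 + h *\<^sub>R u) + f x0 - h^2 * b u\<bar> \<le> e * h^2"
      using second_difference_bound[OF S f' b e, of u] by auto
    define h where "h = min d1 d2 / 2"
    have h: "0 < h" "h < d1" "h < d2" using d1 d2 by (auto simp: h_def)
    have c: "x0 + h *\<^sub>R v + h *\<^sub>R u = x0 + h *\<^sub>R u + h *\<^sub>R v" by (simp add: algebra_simps)
    have "\<bar>h^2 * a v - h^2 * b u\<bar> \<le> 2 * e * h^2" using d1(2)[OF h(1,2)] d2(2)[OF h(1,3)] unfolding c by linarith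
    moreover have "h^2 * a v - h^2 * b u = (a v - b u) * h^2" by (simp add: algebra_simps)
    ultimately have "\<bar>a v - b u\<bar> * h^2 \<le> 2 * e * h^2" by (simp only: abs_mult abs_power2)
    then show ?thesis using h by simp
  qed
  from this[of "\<bar>a v - b u\<bar> / 4"] show ?thesis by (cases "a v = b u") auto
qed

text \<open>\<open>F\<close> pulls \<beta> back to h \<alpha>. Symmetry of the second derivative of
  \<open>F\<close> makes d commute with the pullback, and d(h \<alpha>) = dh wedge \<alpha> + h
  d\<alpha>, where the first term dies on the kernel of \<alpha>. Since \<open>a v\<close> is the
  derivative of \<alpha> on the fixed vector \<open>v\<close>, the difference
  \<open>a v u - a u v\<close> is d\<alpha>(u, v); likewise for \<open>b\<close> and
  \<beta>.\<close>

lemma exterior_derivative_scaled_pullback: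
  fixes F :: "'e::euclidean_space \<Rightarrow> 'e" and \<alpha> \<beta> :: "'e \<Rightarrow> 'e \<Rightarrow> real"
  assumes S: "open S" "x0 \<in> S" and S': "open S'" "F x0 \<in> S'"
    and F': "\<And>x. x \<in> S \<Longrightarrow> (F has_derivative F' x) (at x)"
    and F'': "\<And>v. ((\<lambda>x. F' x v) has_derivative F'' v) (at x0)"
    and lin\<alpha>: "\<And>x. x \<in> S \<Longrightarrow> linear (\<alpha> x)" and lin\<beta>: "\<And>y. y \<in> S' \<Longrightarrow> linear (\<beta> y)"
    and a: "\<And>v. ((\<lambda>x. \<alpha> x v) has_derivative a v) (at x0)"
    and b: "\<And>v. ((\<lambda>y. \<beta> y v) has_derivative b v) (at (F x0))"
    and pull: "\<And>x v. x \<in> S \<Longrightarrow> \<beta> (F x) (F' x v) = h x * \<alpha> x v"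
    and V: "\<alpha> x0 V \<noteq> 0" and uv: "\<alpha> x0 u = 0" "\<alpha> x0 v = 0"
  shows "b (F' x0 v) (F' x0 u) - b (F' x0 u) (F' x0 v) = h x0 * (a v u - a u v)"
proof -
  have Fc: "continuous (at x0) F" using F'[OF S(2)] has_derivative_continuous by blast
  then obtain S0 where S0: "open S0" "x0 \<in> S0" "S0 \<subseteq> S" "\<And>x. x \<in> S0 \<Longrightarrow> F x \<in> S'"
  proof -
    have "\<forall>\<^sub>F x in at x0. F x \<in> S'"
      by (rule topological_tendstoD[OF Fc[unfolded continuous_at] S'])
    then obtain d where "d > 0" "\<And>x. dist x x0 < d \<Longrightarrow> F x \<in> S'"
      using S'(2) unfolding eventually_at by (metis dist_self UNIV_I)
    then show ?thesis using S that[of "S \<inter> ball x0 d"] by (auto simp: dist_commute)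
  qed
  have theta: "((\<lambda>x. \<beta> (F x) (F' x w)) has_derivative (\<lambda>k. b (F' x0 w) (F' x0 k) + \<beta> (F x0) (F'' w k))) (at x0)" for w
    by (rule has_derivative_linear_family[OF S0(1,2), where M="\<lambda>x. \<beta> (F x)" and M'="\<lambda>v k. b v (F' x0 k)"])
      (use S0 lin\<beta> F'' in \<open>auto intro!: has_derivative_compose[OF F'[OF S(2)] b]\<close>)
  \<comment> \<open>Nothing is assumed about the regularity of \<open>h\<close>; near
    \<open>x0\<close> it is the quotient of the two forms on \<open>V\<close>, where \<alpha> does
    not vanish, hence differentiable.\<close>
  obtain h' where h': "(h has_derivative h') (at x0)"
  proof -
    have "isCont (\<lambda>x. \<alpha> x V) x0" using a has_derivative_continuous by blast
    then have "\<forall>\<^sub>F x in at x0. \<alpha> x V \<noteq> 0" using V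
      unfolding isCont_def using tendsto_imp_eventually_ne by blast
    then obtain d where d: "d > 0" "\<And>x. dist x x0 < d \<Longrightarrow> \<alpha> x V \<noteq> 0"
      using V unfolding eventually_at by (metis UNIV_I)
    have "((\<lambda>x. \<beta> (F x) (F' x V) / \<alpha> x V) has_derivative
      (\<lambda>k. - \<beta> (F x0) (F' x0 V) * (inverse (\<alpha> x0 V) * a V k * inverse (\<alpha> x0 V)) +
        (b (F' x0 V) (F' x0 k) + \<beta> (F x0) (F'' V k)) / \<alpha> x0 V)) (at x0)"
      by (rule has_derivative_divide[OF theta a V])
    then show ?thesis
    proof (rule that[OF has_derivative_transform_within_open[of _ _ x0 UNIV "S \<inter> ball x0 d"]])
      show "open (S \<inter> ball x0 d)" "x0 \<in> S \<inter> ball x0 d" using S d by auto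
      fix x assume "x \<in> S \<inter> ball x0 d"
      then show "\<beta> (F x) (F' x V) / \<alpha> x V = h x" using pull[of x V] d(2)[of x] by (simp add: dist_commute)
    qed
  qed
  \<comment> \<open>For \<open>w\<close> in the kernel, the term with the derivative of
    \<open>h\<close> drops out of the product rule.\<close>
  have eq: "b (F' x0 w) (F' x0 k) + \<beta> (F x0) (F'' w k) = h x0 * a w k" if w: "\<alpha> x0 w = 0" for w k
  proof -
    have "((\<lambda>x. h x * \<alpha> x w) has_derivative (\<lambda>k. h x0 * a w k + h' k * \<alpha> x0 w)) (at x0)"
      by (intro has_derivative_mult h' a)
    then have "((\<lambda>x. \<beta> (F x) (F' x w)) has_derivative (\<lambda>k. h x0 * a w k + h' k * \<alpha> x0 w)) (at x0)"
      by (rule has_derivative_transform_within_open[OF _ S]) (simp add: pull)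
    from has_derivative_unique[OF theta this] show ?thesis using w by (auto dest: fun_cong)
  qed
  have "F'' u v = F'' v u"
  proof (rule euclidean_eqI)
    fix i :: 'e
    show "F'' u v \<bullet> i = F'' v u \<bullet> i"
      by (rule symmetric_second_derivative[OF S, of "\<lambda>x. F x \<bullet> i" "\<lambda>x k. F' x k \<bullet> i"])
        (auto intro!: has_derivative_inner_left F' F'')
  qed
  then show ?thesis using eq[OF uv(1), of v] eq[OF uv(2), of u] by (simp add: algebra_simps)
qed

section \<open>Frobenius theorem for distributions of class \<open>C\<^sup>1\<close>\<close>

text \<open>\<open>M\<close> is a coframe and \<open>N\<close> the dual frame. Differentiating M(N
  w) = w turns the vanishing of dM on two frame vectors, which is \<open>integ\<close>, into the
  vanishing of the bracket of the two frame fields.\<close>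

lemma commuting_frame:
  fixes M N :: "'e::euclidean_space \<Rightarrow> 'e \<Rightarrow> 'e"
  assumes U: "open U" "z \<in> U" and lin: "\<And>z. z \<in> U \<Longrightarrow> linear (M z)"
    and M: "\<And>v. ((\<lambda>z. M z v) has_derivative M' v) (at z)"
    and N: "\<And>v. ((\<lambda>z. N z v) has_derivative N' v) (at z)"
    and MN: "\<And>z v. z \<in> U \<Longrightarrow> M z (N z v) = v" and NM: "\<And>z v. z \<in> U \<Longrightarrow> N z (M z v) = v"
    and integ: "M' (N z u) (N z v) = M' (N z v) (N z u)"
  shows "N' u (N z v) = N' v (N z u)"
proof -
  have eq: "M' (N z w) k + M z (N' w k) = 0" for w k
  proof -
    have "((\<lambda>z. M z (N z w)) has_derivative (\<lambda>k. M' (N z w) k + M z (N' w k))) (at z)"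
      by (rule has_derivative_linear_family[OF U lin M N])
    then have "((\<lambda>z. w) has_derivative (\<lambda>k. M' (N z w) k + M z (N' w k))) (at z)"
      by (rule has_derivative_transform_within_open[OF _ U]) (simp add: MN)
    from has_derivative_unique[OF this has_derivative_const] show ?thesis by (auto dest: fun_cong)
  qed
  have "M z (N' u (N z v)) = M z (N' v (N z u))"
    using eq[of u "N z v"] eq[of v "N z u"] integ by (metis add_left_cancel)
  then show ?thesis using NM[OF U(2)] by metis
qed

text \<open>\<Phi>(\<xi>) is the time-one flow of the field with parameter \<xi>, started at x0 + B
  \<xi>. \<open>B\<close> supplies the directions transversal to the fields. On the kernel of
  \<open>B\<close>, commutation makes the derivative of \<Phi> equal to the field itself, at every
  \<xi> and not only at 0.\<close>

lemma commuting_frame_flow: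
  fixes X :: "'e::euclidean_space \<Rightarrow> 'e \<Rightarrow> 'e"
  assumes U: "open U" "x0 \<in> U" and lin: "\<And>z. z \<in> U \<Longrightarrow> linear (X z)"
    and C1: "\<And>v. Ck_on 1 (\<lambda>z. X z v) U"
    and comm: "\<And>z u v. z \<in> U \<Longrightarrow>
      frechet_derivative (\<lambda>z. X z u) (at z) (X z v) = frechet_derivative (\<lambda>z. X z v) (at z) (X z u)"
    and B: "linear B"
  obtains W \<Phi> where "open W" "0 \<in> W" "Ck_on 1 \<Phi> W" "\<Phi> ` W \<subseteq> U" "\<Phi> 0 = x0"
    "\<And>\<xi> h. \<xi> \<in> W \<Longrightarrow> B h = 0 \<Longrightarrow> frechet_derivative \<Phi> (at \<xi>) h = X (\<Phi> \<xi>) h"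
    "\<And>h. frechet_derivative \<Phi> (at 0) h = X x0 h + B h"
proof -
  \<comment> \<open>The parameter becomes a state variable with velocity 0, so that dependence on
    parameters is a case of dependence on initial values.\<close>
  define V where "V w = (0 :: 'e, X (snd w) (fst w))" for w :: "'e \<times> 'e"
  let ?U = "UNIV \<times> U :: ('e \<times> 'e) set"
  have opU: "open ?U" using U by (simp add: open_Times)
  have C1f: "Ck_on 1 (\<lambda>w. X (snd w) v) ?U" for v
    by (rule C1_on_compose[OF C1_on_ident[OF bounded_linear_snd] C1]) auto
  have "Ck_on 1 (\<lambda>w. X (snd w) (fst w)) ?U"
    by (rule C1_on_linear_family[OF opU _ C1f C1_on_ident[OF bounded_linear_fst]]) (auto intro: lin)
  then have C1V: "Ck_on 1 V ?U" unfolding V_def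
    by (rule C1_on_linear[rotated]) (auto intro!: bounded_linear_Pair bounded_linear_zero bounded_linear_ident)
  obtain V' where V': "\<And>w. w \<in> ?U \<Longrightarrow> (V has_derivative blinfun_apply (V' w)) (at w)" "continuous_on ?U V'"
    by (rule C1_on_blinfun[OF C1V]) blast
  define DX where "DX z v = frechet_derivative (\<lambda>z. X z v) (at z)" for z v
  have DX: "((\<lambda>z. X z v) has_derivative DX z v) (at z)" if "z \<in> U" for z v
    unfolding DX_def by (rule C1_on_has_derivative[OF C1 that])
  have V'eq: "V' w k = (0, DX (snd w) (fst w) (snd k) + X (snd w) (fst k))" if w: "w \<in> ?U" for w k
  proof -
    have "((\<lambda>w. X (snd w) (fst w)) has_derivative (\<lambda>k. DX (snd w) (fst w) (snd k) + X (snd w) (fst k))) (at w)"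
      by (rule has_derivative_linear_family[OF opU w, where M'="\<lambda>v k. DX (snd w) v (snd k)"])
        (use w in \<open>auto intro!: lin has_derivative_compose[OF has_derivative_snd[OF has_derivative_ident] DX]
          has_derivative_fst has_derivative_ident\<close>)
    then have "(V has_derivative (\<lambda>k. (0, DX (snd w) (fst w) (snd k) + X (snd w) (fst k)))) (at w)"
      unfolding V_def by (intro has_derivative_Pair has_derivative_const)
    from has_derivative_unique[OF V'(1)[OF w] this] show ?thesis by simp
  qed
  have w0: "(0, x0) \<in> ?U" using U by simp
  obtain T \<delta> \<phi> A where T: "0 < T" "0 < \<delta>"
    and \<phi>0: "\<And>w. w \<in> ball (0, x0) \<delta> \<Longrightarrow> \<phi> w 0 = w"
    and \<phi>U: "\<And>w t. w \<in> ball (0, x0) \<delta> \<Longrightarrow> t \<in> {0..T} \<Longrightarrow> \<phi> w t \<in> ?U"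
    and \<phi>': "\<And>w t. w \<in> ball (0, x0) \<delta> \<Longrightarrow> t \<in> {0..T} \<Longrightarrow>
       (\<phi> w has_vector_derivative V (\<phi> w t)) (at t within {0..T})"
    and \<phi>eq: "\<And>t. V (0, x0) = 0 \<Longrightarrow> t \<in> {0..T} \<Longrightarrow> \<phi> (0, x0) t = (0, x0)"
    and \<phi>A: "\<And>w. w \<in> ball (0, x0) \<delta> \<Longrightarrow> ((\<lambda>w. \<phi> w T) has_derivative blinfun_apply (A w)) (at w)"
    and cA: "continuous_on (ball (0, x0) \<delta>) A"
    and Alin: "\<And>w y. w \<in> ball (0, x0) \<delta> \<Longrightarrow>
       (\<And>t. t \<in> {0..T} \<Longrightarrow> (y has_vector_derivative V' (\<phi> w t) (y t)) (at t within {0..T})) \<Longrightarrow>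
       blinfun_apply (A w) (y 0) = y T"
    apply (rule C1_flow[OF opU w0 V'], assumption)
    subgoal premises prems by (rule prems(1)[OF prems(2-)])
    done
  \<comment> \<open>The flow is available up to time \<open>T\<close>; parameter \<xi> / T for time
    \<open>T\<close> amounts to parameter \<xi> for time 1.\<close>
  define \<iota> where "\<iota> h = ((1 / T) *\<^sub>R h, B h)" for h
  have "linear \<iota>" unfolding \<iota>_def
    by (intro linearI) (simp_all add: linear_add[OF B] linear_cmul[OF B] scaleR_add_right)
  then have bl: "bounded_linear \<iota>" by (simp add: linear_conv_bounded_linear)
  define j where "j \<xi> = (0, x0) + \<iota> \<xi>" for \<xi>
  define W where "W = j -` ball (0, x0) \<delta>"
  have jc: "Ck_on 1 j UNIV" unfolding j_def by (intro C1_on_add C1_on_const C1_on_ident[OF bl])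
  define \<Phi> where "\<Phi> \<xi> = snd (\<phi> (j \<xi>) T)" for \<xi>
  have j0: "j 0 = (0, x0)" using linear_0[OF \<open>linear \<iota>\<close>] by (simp add: j_def)
  have jd: "(j has_derivative \<iota>) (at \<xi>)" for \<xi>
    unfolding j_def using bounded_linear_imp_has_derivative[OF bl] by (auto intro!: derivative_eq_intros)
  have X0: "X z 0 = 0" if "z \<in> U" for z using linear_0[OF lin[OF that]] .
  have TT: "T \<in> {0..T}" using T by auto
  have D: "(\<Phi> has_derivative (\<lambda>h. snd (A (j \<xi>) (\<iota> h)))) (at \<xi>)" if "\<xi> \<in> W" for \<xi>
    unfolding \<Phi>_def using that
    by (intro has_derivative_snd has_derivative_compose[OF jd \<phi>A]) (simp add: W_def)
  then have FD: "frechet_derivative \<Phi> (at \<xi>) = (\<lambda>h. snd (A (j \<xi>) (\<iota> h)))" if "\<xi> \<in> W" for \<xi>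
    using frechet_derivative_at that by metis
  show ?thesis
  proof (rule that[of W \<Phi>])
    show "open W" unfolding W_def using C1_on_continuous[OF jc] by (intro open_vimage) auto
    show "0 \<in> W" using T by (simp add: W_def j0)
    have "Ck_on 1 (\<lambda>w. \<phi> w T) (ball (0, x0) \<delta>)" by (rule C1_on_blinfunI[OF \<phi>A cA])
    then have "Ck_on 1 (\<lambda>\<xi>. \<phi> (j \<xi>) T) W"
      by (rule C1_on_compose[rotated, OF _ _ Ck_on_subset[OF jc]]) (auto simp: W_def)
    then show "Ck_on 1 \<Phi> W" unfolding \<Phi>_def by (rule C1_on_linear[OF bounded_linear_snd])
    show "\<Phi> ` W \<subseteq> U"
    proof clarify
      fix \<xi> assume "\<xi> \<in> W"
      then show "\<Phi> \<xi> \<in> U" using \<phi>U[OF _ TT, of "j \<xi>"] by (auto simp: W_def mem_Times_iff \<Phi>_def)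
    qed
    have V0: "V (0, x0) = 0" using X0[OF U(2)] by (simp add: V_def zero_prod_def)
    show "\<Phi> 0 = x0" using \<phi>eq[OF V0 TT] by (simp add: \<Phi>_def j0)
    show "frechet_derivative \<Phi> (at 0) h = X x0 h + B h" for h
    proof -
      have w: "(0, x0) \<in> ball (0, x0) \<delta>" using T by simp
      \<comment> \<open>At the rest point the variational equation has constant coefficients, and
        this affine function solves it.\<close>
      define y where "y t = (fst (\<iota> h), snd (\<iota> h) + t *\<^sub>R X x0 (fst (\<iota> h)))" for t :: real
      have "A (0, x0) (y 0) = y T"
      proof (rule Alin[OF w])
        fix t assume t: "t \<in> {0..T}"
        have "DX x0 0 = (\<lambda>k. 0)"
        proof (rule has_derivative_unique[OF DX[OF U(2)]])
          show "((\<lambda>z. X z 0) has_derivative (\<lambda>k. 0)) (at x0)"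
            by (rule has_derivative_transform_within_open[OF has_derivative_const[of 0] U]) (simp add: X0)
        qed
        then have "V' (\<phi> (0, x0) t) (y t) = (0, X x0 (fst (\<iota> h)))"
          using \<phi>eq[OF V0 t] V'eq[OF w0] by (simp add: y_def)
        moreover have "(y has_vector_derivative (0, X x0 (fst (\<iota> h)))) (at t within {0..T})"
          unfolding y_def by (auto intro!: derivative_eq_intros has_vector_derivative_Pair)
        ultimately show "(y has_vector_derivative V' (\<phi> (0, x0) t) (y t)) (at t within {0..T})" by simp
      qed
      then have "frechet_derivative \<Phi> (at 0) h = snd (y T)"
        using FD[OF \<open>0 \<in> W\<close>] by (simp add: j0 y_def)
      also have "\<dots> = X x0 h + B h" using T by (simp add: y_def \<iota>_def linear_cmul[OF lin[OF U(2)]])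
      finally show ?thesis .
    qed
    show "frechet_derivative \<Phi> (at \<xi>) h = X (\<Phi> \<xi>) h" if \<xi>: "\<xi> \<in> W" and h: "B h = 0" for \<xi> h
    proof -
      have w: "j \<xi> \<in> ball (0, x0) \<delta>" using \<xi> by (simp add: W_def)
      define \<zeta> where "\<zeta> = fst (j \<xi>)"
      define z where "z t = snd (\<phi> (j \<xi>) t)" for t
      have zU: "z t \<in> U" if "t \<in> {0..T}" for t using \<phi>U[OF w that] by (auto simp: z_def)
      have z': "(z has_vector_derivative X (z t) (fst (\<phi> (j \<xi>) t))) (at t within {0..T})" if "t \<in> {0..T}" for t
        using bounded_linear.has_vector_derivative[OF bounded_linear_snd \<phi>'[OF w that]] by (simp add: V_def z_def[abs_def])
      have "fst (\<phi> (j \<xi>) t) = fst (\<phi> (j \<xi>) 0)" if "t \<in> {0..T}" for t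
      proof (rule has_vector_derivative_zero_constant[of "{0..T}" "\<lambda>t. fst (\<phi> (j \<xi>) t)"])
        fix c assume c: "\<And>t. t \<in> {0..T} \<Longrightarrow> fst (\<phi> (j \<xi>) t) = c"
        then show ?thesis using that T by simp
      next
        show "((\<lambda>t. fst (\<phi> (j \<xi>) t)) has_vector_derivative 0) (at t within {0..T})" if "t \<in> {0..T}" for t
          using bounded_linear.has_vector_derivative[OF bounded_linear_fst \<phi>'[OF w that]] by (simp add: V_def)
      qed auto
      then have \<zeta>: "\<phi> (j \<xi>) t = (\<zeta>, z t)" if "t \<in> {0..T}" for t
        using that \<phi>0[OF w] by (simp add: \<zeta>_def z_def prod_eq_iff)
      have z'': "(z has_vector_derivative X (z t) \<zeta>) (at t within {0..T})" if "t \<in> {0..T}" for t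
        using z'[OF that] \<zeta>[OF that] by simp
      define k where "k = fst (\<iota> h)"
      \<comment> \<open>The expected effect of varying the parameter by \<open>k\<close>.
        Differentiating X(z) k along the orbit gives the derivative of the field of \<open>k\<close>
        in the direction of the field of \<zeta>; as the fields commute, the two roles may be
        exchanged, and this is what the variational equation asks for.\<close>
      define y where "y t = (k, t *\<^sub>R X (z t) k)" for t :: real
      have "A (j \<xi>) (y 0) = y T"
      proof (rule Alin[OF w])
        fix t assume t: "t \<in> {0..T}"
        have "((\<lambda>t. X (z t) k) has_vector_derivative DX (z t) k (X (z t) \<zeta>)) (at t within {0..T})"
        proof -
          have "((\<lambda>t. X (z t) k) has_derivative (\<lambda>r. DX (z t) k (r *\<^sub>R X (z t) \<zeta>))) (at t within {0..T})"
            using z''[OF t, unfolded has_vector_derivative_def] DX[OF zU[OF t]] by (rule has_derivative_compose)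
          then show ?thesis unfolding has_vector_derivative_def
            using linear_cmul[OF has_derivative_linear[OF DX[OF zU[OF t]]]] by simp
        qed
        then have "((\<lambda>t. t *\<^sub>R X (z t) k) has_vector_derivative t *\<^sub>R DX (z t) k (X (z t) \<zeta>) + X (z t) k) (at t within {0..T})"
          by (auto intro!: derivative_eq_intros simp: has_vector_derivative_def scaleR_add_right)
        then have "(y has_vector_derivative (0, t *\<^sub>R DX (z t) k (X (z t) \<zeta>) + X (z t) k)) (at t within {0..T})"
          unfolding y_def by (intro has_vector_derivative_Pair has_vector_derivative_const)
        moreover have "V' (\<phi> (j \<xi>) t) (y t) = (0, t *\<^sub>R DX (z t) k (X (z t) \<zeta>) + X (z t) k)"
        proof -
          have "DX (z t) \<zeta> (t *\<^sub>R X (z t) k) = t *\<^sub>R DX (z t) \<zeta> (X (z t) k)"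
            by (rule linear_cmul[OF has_derivative_linear[OF DX[OF zU[OF t]]]])
          then show ?thesis using V'eq[OF \<phi>U[OF w t]] comm[OF zU[OF t], of \<zeta> k]
            by (simp add: \<zeta>[OF t] y_def DX_def)
        qed
        ultimately show "(y has_vector_derivative V' (\<phi> (j \<xi>) t) (y t)) (at t within {0..T})" by simp
      qed
      moreover have "\<iota> h = y 0" using h by (simp add: y_def k_def \<iota>_def)
      ultimately have "frechet_derivative \<Phi> (at \<xi>) h = snd (y T)" using FD[OF \<xi>] by simp
      also have "\<dots> = X (\<Phi> \<xi>) h" using T linear_cmul[OF lin[OF zU[OF TT]]]
        by (simp add: y_def k_def \<iota>_def \<Phi>_def z_def)
      finally show ?thesis .
    qed
  qed
qed

text \<open>The derivative of the inverse at \<open>y\<close> is the inverse of the derivative of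
  \<Phi> at \<Theta>(y); its continuity comes from the continuous inverse of the family of
  derivatives.\<close>

lemma C1_inverse_function:
  fixes \<Phi> :: "real ^ 'n \<Rightarrow> real ^ 'n"
  assumes W: "open W" "x \<in> W" and C1: "Ck_on 1 \<Phi> W" and inj: "inj (frechet_derivative \<Phi> (at x))"
  obtains W' V \<Theta> where "open W'" "x \<in> W'" "W' \<subseteq> W" "open V" "homeomorphism W' V \<Phi> \<Theta>" "Ck_on 1 \<Theta> V"
proof -
  obtain \<Phi>' where \<Phi>': "\<And>x. x \<in> W \<Longrightarrow> (\<Phi> has_derivative blinfun_apply (\<Phi>' x)) (at x)" "continuous_on W \<Phi>'"
    by (rule C1_on_blinfun[OF C1]) blast
  have eq: "frechet_derivative \<Phi> (at x) = blinfun_apply (\<Phi>' x)" if "x \<in> W" for x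
    using frechet_derivative_at[OF \<Phi>'(1)[OF that]] by simp
  obtain U1 N where U1: "open U1" "x \<in> U1" "U1 \<subseteq> W" and N: "\<And>z. z \<in> U1 \<Longrightarrow> linear (N z)"
    "\<And>z v. z \<in> U1 \<Longrightarrow> \<Phi>' z (N z v) = v" "\<And>z v. z \<in> U1 \<Longrightarrow> N z (\<Phi>' z v) = v"
    "\<And>v. continuous_on U1 (\<lambda>z. N z v)"
    by (rule inverse_linear_family[OF W, of "\<lambda>z. blinfun_apply (\<Phi>' z)"])
      (use \<Phi>' inj eq[OF W(2)] in \<open>auto intro!: continuous_intros blinfun.bounded_linear_right bounded_linear.linear\<close>)
  have bl: "bounded_linear (N x)" using N(1)[OF U1(2)] by (simp add: linear_conv_bounded_linear)
  have inv: "Blinfun (N x) o\<^sub>L \<Phi>' x = id_blinfun"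
    by (rule blinfun_eqI) (simp add: bounded_linear_Blinfun_apply[OF bl] N(3)[OF U1(2)])
  obtain W' V \<Theta> \<Theta>' where *: "open W'" "W' \<subseteq> U1" "x \<in> W'" "open V" "\<Phi> x \<in> V" "homeomorphism W' V \<Phi> \<Theta>"
    "\<And>y. y \<in> V \<Longrightarrow> (\<Theta> has_derivative (\<Theta>' y)) (at y)"
    "\<And>y. y \<in> V \<Longrightarrow> \<Theta>' y = inv (blinfun_apply (\<Phi>'(\<Theta> y)))"
    by (rule inverse_function_theorem[OF U1(1) _ continuous_on_subset[OF \<Phi>'(2)] U1(2) inv]) (use \<Phi>' U1 in blast)+
  have \<Theta>V: "\<Theta> y \<in> U1" if "y \<in> V" for y using *(2,6) that by (auto simp: homeomorphism_def)
  have "Ck_on 1 \<Theta> V"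
  proof (rule C1_onI[OF *(7)])
    fix v
    have "\<Theta>' y v = N (\<Theta> y) v" if "y \<in> V" for y
      using *(8)[OF that] N(2,3)[OF \<Theta>V[OF that]] by (metis inv_equality)
    moreover have "continuous_on V (\<lambda>y. N (\<Theta> y) v)"
      by (rule continuous_on_compose2[OF N(4) homeomorphism_cont2[OF *(6)]]) (use \<Theta>V in blast)
    ultimately show "continuous_on V (\<lambda>y. \<Theta>' y v)" by (simp cong: continuous_on_cong)
  qed
  then show ?thesis using that * U1 by blast
qed

text \<open>The plane field is {v. p (M z v) = M z v}: the components of the coframe complementary
  to the image of the projection \<open>p\<close> vanish on it. \<open>integ\<close> makes dM vanish
  on the plane field in all components, including those along \<open>p\<close>, and this is what
  lets the fields N z (p \<xi>) commute. The resulting \<Phi> carries the image of \<open>p\<close>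
  to the plane field at every point of its domain.\<close>

lemma frobenius:
  fixes M :: "real ^ 'n \<Rightarrow> real ^ 'n \<Rightarrow> real ^ 'n"
  assumes U: "open U" "x0 \<in> U" and lin: "\<And>z. z \<in> U \<Longrightarrow> linear (M z)"
    and C1: "\<And>v. Ck_on 1 (\<lambda>z. M z v) U" and inj: "inj (M x0)"
    and p: "linear p" "\<And>v. p (p v) = p v"
    and integ: "\<And>z u v. z \<in> U \<Longrightarrow> p (M z u) = M z u \<Longrightarrow> p (M z v) = M z v \<Longrightarrow>
      frechet_derivative (\<lambda>z. M z u) (at z) v = frechet_derivative (\<lambda>z. M z v) (at z) u"
  obtains W V \<Phi> \<Theta> where "open W" "0 \<in> W" "open V" "V \<subseteq> U" "\<Phi> 0 = x0" "homeomorphism W V \<Phi> \<Theta>"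
    "Ck_on 1 \<Phi> W" "Ck_on 1 \<Theta> V"
    "\<And>\<xi> h. \<xi> \<in> W \<Longrightarrow> M (\<Phi> \<xi>) (frechet_derivative \<Phi> (at \<xi>) (p h)) = p h"
    "\<And>z. z \<in> V \<Longrightarrow> inj (M z)"
proof -
  obtain U1 N where U1: "open U1" "x0 \<in> U1" "U1 \<subseteq> U" and linN: "\<And>z. z \<in> U1 \<Longrightarrow> linear (N z)"
    and MN: "\<And>z v. z \<in> U1 \<Longrightarrow> M z (N z v) = v" and NM: "\<And>z v. z \<in> U1 \<Longrightarrow> N z (M z v) = v"
    and "\<And>v. \<forall>v. Ck_on 1 (\<lambda>z. M z v) U \<Longrightarrow> Ck_on 1 (\<lambda>z. N z v) U1"
    apply (rule inverse_linear_family[OF U lin C1_on_continuous[OF C1] inj], assumption)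
    subgoal premises prems by (rule prems(1)[OF prems(2-7,9)])
    done
  with C1 have C1N: "\<And>v. Ck_on 1 (\<lambda>z. N z v) U1" by blast
  define X where "X z \<xi> = N z (p \<xi>)" for z \<xi>
  have linX: "linear (X z)" if "z \<in> U1" for z
    unfolding X_def using linear_compose[OF p(1) linN[OF that]] by (simp add: o_def)
  have C1X: "Ck_on 1 (\<lambda>z. X z v) U1" for v unfolding X_def by (rule C1N)
  have comm: "frechet_derivative (\<lambda>z. X z u) (at z) (X z v) = frechet_derivative (\<lambda>z. X z v) (at z) (X z u)"
    if z: "z \<in> U1" for z u v
    unfolding X_def
  proof (rule commuting_frame[where M=M and N=N and u="p u" and v="p v"
        and N'="\<lambda>v. frechet_derivative (\<lambda>z. N z v) (at z)"
        and M'="\<lambda>v. frechet_derivative (\<lambda>z. M z v) (at z)", OF U1(1) z])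
    have zU: "z \<in> U" using z U1 by auto
    show "linear (M z)" if "z \<in> U1" for z using lin U1 that by auto
    show "((\<lambda>z. M z v) has_derivative frechet_derivative (\<lambda>z. M z v) (at z)) (at z)" for v
      by (rule C1_on_has_derivative[OF C1 zU])
    show "((\<lambda>z. N z v) has_derivative frechet_derivative (\<lambda>z. N z v) (at z)) (at z)" for v
      by (rule C1_on_has_derivative[OF C1N z])
    show "frechet_derivative (\<lambda>za. M za (N z (p u))) (at z) (N z (p v)) =
      frechet_derivative (\<lambda>za. M za (N z (p v))) (at z) (N z (p u))"
      by (rule integ[OF zU]) (simp_all add: MN[OF z] p)
  qed (use MN NM in auto)
  \<comment> \<open>\<open>B\<close> vanishes on the image of \<open>p\<close>, and with it the
    derivative of \<Phi> at 0 becomes \<open>N x0\<close>, which is invertible.\<close>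
  define B where "B h = N x0 (h - p h)" for h
  have "linear (\<lambda>h. h - p h)" by (intro linear_compose_sub linear_ident p)
  then have linB: "linear B" unfolding B_def using linear_compose[OF _ linN[OF U1(2)]] by (auto simp: o_def)
  obtain W \<Phi> where W: "open W" "0 \<in> W" "Ck_on 1 \<Phi> W" "\<Phi> ` W \<subseteq> U1" "\<Phi> 0 = x0"
    and D: "\<And>\<xi> h. \<xi> \<in> W \<Longrightarrow> B h = 0 \<Longrightarrow> frechet_derivative \<Phi> (at \<xi>) h = X (\<Phi> \<xi>) h"
    and D0: "\<And>h. frechet_derivative \<Phi> (at 0) h = X x0 h + B h"
    by (rule commuting_frame_flow[OF U1(1,2) linX C1X comm linB]) blast+
  have D0N: "frechet_derivative \<Phi> (at 0) h = N x0 h" for h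
    using D0[of h] by (simp add: X_def B_def linear_diff[OF linN[OF U1(2)]])
  have "inj (frechet_derivative \<Phi> (at 0))"
    by (rule injI) (metis D0N MN[OF U1(2)])
  then obtain W' V \<Theta> where *: "open W'" "0 \<in> W'" "W' \<subseteq> W" "open V" "homeomorphism W' V \<Phi> \<Theta>" "Ck_on 1 \<Theta> V"
    by (rule C1_inverse_function[OF W(1,2,3)]) blast
  have V: "V \<subseteq> U1" using * W by (auto simp: homeomorphism_def)
  show ?thesis
  proof (rule that[of W' V \<Phi> \<Theta>])
    show "Ck_on 1 \<Phi> W'" using Ck_on_subset W * by blast
    show "M (\<Phi> \<xi>) (frechet_derivative \<Phi> (at \<xi>) (p h)) = p h" if "\<xi> \<in> W'" for \<xi> h
    proof -
      have "B (p h) = 0" using linear_0[OF linN[OF U1(2)]] by (simp add: B_def p)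
      then have "frechet_derivative \<Phi> (at \<xi>) (p h) = N (\<Phi> \<xi>) (p h)"
        using D[of \<xi> "p h"] that * by (auto simp: X_def p)
      then show ?thesis using MN[of "\<Phi> \<xi>" "p h"] W * that by auto
    qed
    show "inj (M z)" if "z \<in> V" for z using NM V that by (metis injI subsetD)
  qed (use * W V U1 in auto)
qed

section \<open>Tangent maps in coordinates\<close>

lemma chart_inv_map: "is_chart c \<Longrightarrow> p \<in> chart_dom c \<Longrightarrow> chart_inv c (chart_map c p) = p"
  by (auto simp: is_chart_def homeomorphism_def)

lemma chart_map_inv:
  "is_chart c \<Longrightarrow> x \<in> chart_map c ` chart_dom c \<Longrightarrow> chart_map c (chart_inv c x) = x"
  by (auto simp: is_chart_def homeomorphism_def)

lemma chart_inv_in_dom: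
  "is_chart c \<Longrightarrow> x \<in> chart_map c ` chart_dom c \<Longrightarrow> chart_inv c x \<in> chart_dom c"
  by (auto simp: is_chart_def homeomorphism_def)

lemma open_chart_image:
  assumes "is_chart c" "open U" shows "open (chart_map c ` (chart_dom c \<inter> U))"
proof -
  have "openin (top_of_set (chart_map c ` chart_dom c)) (chart_map c ` (chart_dom c \<inter> U))"
    using assms by (intro homeomorphism_imp_open_map[of _ _ "chart_map c" "chart_inv c"])
      (auto simp: is_chart_def openin_open)
  then show ?thesis using assms openin_open_eq by (auto simp: is_chart_def)
qed

lemma chart_map_continuous: "is_chart c \<Longrightarrow> continuous_on (chart_dom c) (chart_map c)"
  by (auto simp: is_chart_def homeomorphism_def)

lemma chart_inv_continuous: "is_chart c \<Longrightarrow> continuous_on (chart_map c ` chart_dom c) (chart_inv c)"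
  by (auto simp: is_chart_def homeomorphism_def)

lemma open_chart_preimage:
  assumes "is_chart c" "open V" shows "open (chart_dom c \<inter> chart_map c -` V)"
  using continuous_open_preimage[OF chart_map_continuous[OF assms(1)] _ assms(2)] assms(1)
  by (simp add: is_chart_def)

definition rep :: "('m, 'e) chart \<Rightarrow> ('m \<Rightarrow> 'm) \<Rightarrow> ('m, 'e) chart \<Rightarrow> 'e \<Rightarrow> 'e" where
  "rep c h d = chart_map d \<circ> h \<circ> chart_inv c"

locale atlas =
  fixes A :: "('m::t2_space, 'e::euclidean_space) chart set"
  assumes smooth_atlas: "smooth_atlas A"
begin

lemma Ck_chart_atlas: "c \<in> A \<Longrightarrow> Ck_chart A k c"
  unfolding Ck_chart_def
proof (intro conjI ballI)
  assume c: "c \<in> A"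
  show "is_chart c" using smooth_atlas c by (simp add: smooth_atlas_def)
  fix d assume d: "d \<in> A"
  show "Ck_on k (transition c d) (chart_map c ` (chart_dom c \<inter> chart_dom d))"
    using smooth_atlas c d by (simp add: smooth_atlas_def smooth_on_def)
  show "Ck_on k (transition d c) (chart_map d ` (chart_dom c \<inter> chart_dom d))"
    using smooth_atlas c d by (simp add: smooth_atlas_def smooth_on_def Int_commute[of "chart_dom c" "chart_dom d"])
qed

lemma chart_at: "chart_at A p \<in> A" "p \<in> chart_dom (chart_at A p)"
proof -
  have "\<exists>c. c \<in> A \<and> p \<in> chart_dom c" using smooth_atlas unfolding smooth_atlas_def by blast
  from someI_ex[OF this] show "chart_at A p \<in> A" "p \<in> chart_dom (chart_at A p)"
    by (simp_all add: chart_at_def)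
qed

lemma is_chart: "Ck_chart A k c \<Longrightarrow> is_chart c"
  by (simp add: Ck_chart_def)

lemma is_chart_at: "is_chart (chart_at A p)"
  using Ck_chart_atlas[OF chart_at(1)] is_chart by blast

lemma transition_C1:
  assumes "Ck_chart A 1 c"
  shows "Ck_on 1 (transition c (chart_at A p)) (chart_map c ` (chart_dom c \<inter> chart_dom (chart_at A p)))"
    and "Ck_on 1 (transition (chart_at A p) c) (chart_map (chart_at A p) ` (chart_dom (chart_at A p) \<inter> chart_dom c))"
  using assms chart_at(1)[of p] by (auto simp: Ck_chart_def Int_commute simp del: Ck_on.simps One_nat_def)

lemma coord_has_derivative:
  assumes "Ck_chart A 1 c" "p \<in> chart_dom c"
  shows "(transition (chart_at A p) c has_derivative coord A c p) (at (chart_map (chart_at A p) p))"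
    and "(transition c (chart_at A p) has_derivative coord_inv A c p) (at (chart_map c p))"
  using C1_on_has_derivative[OF transition_C1(1)[OF assms(1)]]
    C1_on_has_derivative[OF transition_C1(2)[OF assms(1)]] assms(2) chart_at(2)
  by (auto simp: coord_def coord_inv_def)

lemma linear_coord:
  assumes "Ck_chart A 1 c" "p \<in> chart_dom c"
  shows "linear (coord A c p)" "linear (coord_inv A c p)"
  using coord_has_derivative[OF assms] has_derivative_linear by blast+

text \<open>Chain rule for the composite of the two transitions, which is the identity near the
  point.\<close>

lemma transition_inverse_derivatives:
  assumes c: "is_chart c" "p \<in> chart_dom c" and d: "is_chart d" "p \<in> chart_dom d"
    and L: "(transition c d has_derivative L) (at (chart_map c p))"
    and K: "(transition d c has_derivative K) (at (chart_map d p))"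
  shows "K (L v) = v"
proof -
  have *: "transition c d (chart_map c p) = chart_map d p"
    using c by (simp add: transition_def chart_inv_map)
  have "((\<lambda>x. transition d c (transition c d x)) has_derivative (\<lambda>v. K (L v))) (at (chart_map c p))"
    by (rule has_derivative_compose[OF L]) (use K * in simp)
  then have "((\<lambda>x. x) has_derivative (\<lambda>v. K (L v))) (at (chart_map c p))"
  proof (rule has_derivative_transform_within_open)
    show "open (chart_map c ` (chart_dom c \<inter> chart_dom d))" using c d
      by (intro open_chart_image) (auto simp: is_chart_def)
    show "chart_map c p \<in> chart_map c ` (chart_dom c \<inter> chart_dom d)" using c d by auto
    fix x assume "x \<in> chart_map c ` (chart_dom c \<inter> chart_dom d)"
    then show "transition d c (transition c d x) = x"
      using c(1) d(1) by (auto simp: transition_def chart_inv_map)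
  qed
  from has_derivative_unique[OF this has_derivative_ident] show ?thesis by (auto dest: fun_cong)
qed

lemma coord_coord_inv:
  assumes "Ck_chart A 1 c" "p \<in> chart_dom c"
  shows "coord A c p (coord_inv A c p v) = v" "coord_inv A c p (coord A c p v) = v"
  using transition_inverse_derivatives[OF _ _ _ _ coord_has_derivative(2,1)[OF assms]]
    transition_inverse_derivatives[OF _ _ _ _ coord_has_derivative(1,2)[OF assms]]
    is_chart[OF assms(1)] assms(2) is_chart_at chart_at(2) by blast+

text \<open>Differentiability at one point, together with global continuity so that chart domains
  have open preimages. The notion is stable under composition pointwise; iterates can thus be
  handled without showing that they are of class C^1.\<close>

definition has_tangent :: "('m \<Rightarrow> 'm) \<Rightarrow> 'm \<Rightarrow> ('e \<Rightarrow> 'e) \<Rightarrow> bool" where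
  "has_tangent h p L \<longleftrightarrow> continuous_on UNIV h \<and>
     (rep (chart_at A p) h (chart_at A (h p)) has_derivative L) (at (chart_map (chart_at A p) p))"

lemma has_tangent_tangent_map: "has_tangent h p L \<Longrightarrow> tangent_map A h p = L"
  unfolding has_tangent_def tangent_map_def rep_def using frechet_derivative_at by metis

lemma Ck_map_has_tangent:
  assumes "Ck_map A 1 h" shows "has_tangent h p (tangent_map A h p)"
proof -
  have "Ck_on 1 (rep (chart_at A p) h (chart_at A (h p)))
     (chart_map (chart_at A p) ` (chart_dom (chart_at A p) \<inter> h -` chart_dom (chart_at A (h p))))"
    using assms chart_at by (simp add: Ck_map_def rep_def)
  from C1_on_has_derivative[OF this, of "chart_map (chart_at A p) p"] show ?thesis
    using assms chart_at(2) by (auto simp: has_tangent_def tangent_map_def rep_def Ck_map_def)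
qed

text \<open>The tangent map refers to the selected charts. Conjugation with the differentials of the
  coordinate changes gives the derivative in any pair of C^1 charts, in particular in those produced
  by Frobenius' theorem.\<close>

lemma rep_has_derivative:
  assumes h: "has_tangent h p L" and c: "Ck_chart A 1 c" "p \<in> chart_dom c"
    and d: "Ck_chart A 1 d" "h p \<in> chart_dom d"
  shows "(rep c h d has_derivative (\<lambda>v. coord A d (h p) (L (coord_inv A c p v)))) (at (chart_map c p))"
proof -
  let ?c = "chart_at A p" and ?d = "chart_at A (h p)"
  have cp: "transition c ?c (chart_map c p) = chart_map ?c p"
    using c is_chart by (simp add: transition_def chart_inv_map)
  have hp: "rep ?c h ?d (chart_map ?c p) = chart_map ?d (h p)"
    using is_chart_at chart_at by (simp add: rep_def chart_inv_map)
  have L: "(rep ?c h ?d has_derivative L) (at (transition c ?c (chart_map c p)))"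
    using h by (simp add: has_tangent_def cp)
  have D: "(transition ?d d has_derivative coord A d (h p)) (at (rep ?c h ?d (transition c ?c (chart_map c p))))"
    using coord_has_derivative(1)[OF d] by (simp add: cp hp)
  have "((\<lambda>x. transition ?d d (rep ?c h ?d (transition c ?c x))) has_derivative
      (\<lambda>v. coord A d (h p) (L (coord_inv A c p v)))) (at (chart_map c p))"
    by (rule has_derivative_compose[OF has_derivative_compose[OF coord_has_derivative(2)[OF c] L] D])
  then show ?thesis
  proof (rule has_derivative_transform_within_open)
    let ?U = "chart_dom ?c \<inter> h -` (chart_dom d \<inter> chart_dom ?d)"
    have "open (h -` (chart_dom d \<inter> chart_dom ?d))"
      using h is_chart[OF d(1)] is_chart_at[of "h p"] by (intro open_vimage) (auto simp: has_tangent_def is_chart_def)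
    then have "open ?U" using is_chart_at[of p] by (auto simp: is_chart_def)
    then show "open (chart_map c ` (chart_dom c \<inter> ?U))" by (rule open_chart_image[OF is_chart[OF c(1)]])
    show "chart_map c p \<in> chart_map c ` (chart_dom c \<inter> ?U)" using c d chart_at by auto
    fix x assume "x \<in> chart_map c ` (chart_dom c \<inter> ?U)"
    then show "transition ?d d (rep ?c h ?d (transition c ?c x)) = rep c h d x"
      using is_chart[OF c(1)] is_chart_at by (auto simp: transition_def rep_def chart_inv_map)
  qed
qed

lemma has_tangent_id: "has_tangent (\<lambda>p. p) p (\<lambda>v. v)"
  unfolding has_tangent_def
proof
  show "(rep (chart_at A p) (\<lambda>p. p) (chart_at A p) has_derivative (\<lambda>v. v)) (at (chart_map (chart_at A p) p))"
  proof (rule has_derivative_transform_within_open[OF has_derivative_ident])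
    show "open (chart_map (chart_at A p) ` chart_dom (chart_at A p))" using is_chart_at[of p] by (simp add: is_chart_def)
  qed (use chart_at in \<open>auto simp: rep_def chart_inv_map is_chart_at\<close>)
qed simp

lemma has_tangent_compose:
  assumes "has_tangent h p L" "has_tangent k (h p) K"
  shows "has_tangent (\<lambda>x. k (h x)) p (\<lambda>v. K (L v))"
  unfolding has_tangent_def
proof
  let ?c = "chart_at A p" and ?d = "chart_at A (h p)" and ?e = "chart_at A (k (h p))"
  have ch: "continuous_on UNIV h" and ck: "continuous_on UNIV k" using assms by (auto simp: has_tangent_def)
  show "continuous_on UNIV (\<lambda>x. k (h x))" using continuous_on_compose2[OF ck ch] by simp
  have hp: "rep ?c h ?d (chart_map ?c p) = chart_map ?d (h p)"
    using is_chart_at chart_at by (simp add: rep_def chart_inv_map)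
  have "((\<lambda>x. rep ?d k ?e (rep ?c h ?d x)) has_derivative (\<lambda>v. K (L v))) (at (chart_map ?c p))"
    by (rule has_derivative_compose) (use assms hp in \<open>auto simp: has_tangent_def\<close>)
  then show "(rep ?c (\<lambda>x. k (h x)) ?e has_derivative (\<lambda>v. K (L v))) (at (chart_map ?c p))"
  proof (rule has_derivative_transform_within_open)
    have "open (h -` chart_dom ?d)"
      using ch is_chart_at[of "h p"] by (intro open_vimage) (auto simp: is_chart_def)
    then show "open (chart_map ?c ` (chart_dom ?c \<inter> h -` chart_dom ?d))"
      by (rule open_chart_image[OF is_chart_at])
    fix x assume "x \<in> chart_map ?c ` (chart_dom ?c \<inter> h -` chart_dom ?d)"
    then show "rep ?d k ?e (rep ?c h ?d x) = rep ?c (\<lambda>x. k (h x)) ?e x"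
      using is_chart_at by (auto simp: rep_def chart_inv_map)
  qed (use chart_at in auto)
qed

lemma tangent_map_id: "tangent_map A (\<lambda>p. p) p = (\<lambda>v. v)"
  by (rule has_tangent_tangent_map[OF has_tangent_id])

lemma tangent_map_compose:
  assumes "Ck_map A 1 h" "Ck_map A 1 k"
  shows "tangent_map A (\<lambda>x. k (h x)) p v = tangent_map A k (h p) (tangent_map A h p v)"
  using has_tangent_tangent_map[OF has_tangent_compose[OF Ck_map_has_tangent[OF assms(1), of p] Ck_map_has_tangent[OF assms(2)]]]
  by simp

lemma has_tangent_funpow:
  assumes "Ck_map A 1 h" shows "\<exists>L. has_tangent (h ^^ n) p L"
proof (induction n)
  case 0
  then show ?case using has_tangent_id[of p] by (auto simp: id_def)
next
  case (Suc n)
  then obtain L where "has_tangent (h ^^ n) p L" by blast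
  from has_tangent_compose[OF this Ck_map_has_tangent[OF assms]] show ?case by (auto simp: o_def)
qed

lemma tangent_map_funpow_Suc:
  assumes "Ck_map A 1 h"
  shows "tangent_map A (h ^^ Suc n) p v = tangent_map A h ((h ^^ n) p) (tangent_map A (h ^^ n) p v)"
proof -
  obtain L where L: "has_tangent (h ^^ n) p L" using has_tangent_funpow[OF assms] by blast
  from has_tangent_tangent_map[OF has_tangent_compose[OF this Ck_map_has_tangent[OF assms]]]
  show ?thesis using has_tangent_tangent_map[OF L] by (simp add: o_def)
qed

lemma linear_tangent_map: "Ck_map A 1 h \<Longrightarrow> linear (tangent_map A h p)"
  using Ck_map_has_tangent[of h p] has_derivative_linear unfolding has_tangent_def by blast

lemma linear_tangent_map_funpow: "Ck_map A 1 h \<Longrightarrow> linear (tangent_map A (h ^^ n) p)"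
  using has_tangent_funpow[of h n p] has_tangent_tangent_map has_derivative_linear
  by (force simp: has_tangent_def)

lemma Ck_map_id: "Ck_map A k (\<lambda>p. p)"
  unfolding Ck_map_def
proof (intro conjI ballI)
  fix c d assume cd: "c \<in> A" "d \<in> A"
  have "chart_dom c \<inter> (\<lambda>p. p) -` chart_dom d = chart_dom c \<inter> chart_dom d" by auto
  then show "Ck_on k (chart_map d \<circ> (\<lambda>p. p) \<circ> chart_inv c) (chart_map c ` (chart_dom c \<inter> (\<lambda>p. p) -` chart_dom d))"
    using Ck_chart_atlas[OF cd(1), of k] cd(2) by (simp add: Ck_chart_def transition_def o_def)
qed simp

lemma Ck_map_le: "Ck_map A l h \<Longrightarrow> k \<le> l \<Longrightarrow> Ck_map A k h"
  unfolding Ck_map_def using Ck_on_le by blast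

lemma tangent_map_inv:
  assumes "Ck_map A 1 h" "Ck_map A 1 k" "\<And>x. k (h x) = x"
  shows "tangent_map A k (h p) (tangent_map A h p v) = v"
  using tangent_map_compose[OF assms(1,2), of p v] assms(3) tangent_map_id by simp

end

section \<open>Foliations from charts adapted to a plane field\<close>

text \<open>By Lindelof's theorem countably many of the neighbourhoods on which \<open>g\<close> is
  constant cover \<open>S\<close>.\<close>

lemma countable_locally_constant_image:
  fixes S :: "'e::second_countable_topology set"
  assumes "\<And>x. x \<in> S \<Longrightarrow> \<exists>N. open N \<and> x \<in> N \<and> (\<forall>y\<in>S \<inter> N. g y = g x)"
  shows "countable (g ` S)"
proof -
  obtain N where N: "\<And>x. x \<in> S \<Longrightarrow> open (N x) \<and> x \<in> N x \<and> (\<forall>y\<in>S \<inter> N x. g y = g x)"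
    using assms by metis
  obtain \<F> where F: "\<F> \<subseteq> N ` S" "countable \<F>" "\<Union>\<F> = \<Union>(N ` S)"
  proof (rule Lindelof[of "N ` S"])
    show "open T" if "T \<in> N ` S" for T using N that by blast
  qed (rule that)
  obtain S0 where S0: "S0 \<subseteq> S" "countable S0" "\<F> = N ` S0"
    using F(1,2) by (meson countable_subset_image)
  have "g ` S \<subseteq> g ` S0"
  proof clarify
    fix x assume x: "x \<in> S"
    then obtain y where y: "y \<in> S0" "x \<in> N y" using F(3) N S0(3) by blast
    have "\<forall>z\<in>S \<inter> N y. g z = g y" using N y(1) S0(1) by blast
    then have "g x = g y" using x y(2) by (metis IntI)
    then show "g x \<in> g ` S0" using y(1) by (metis imageI)
  qed
  then show ?thesis by (rule countable_subset[OF _ countable_image[OF S0(2)]])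
qed

definition coord_plane :: "'e::euclidean_space set \<Rightarrow> 'e \<Rightarrow> 'e set" where
  "coord_plane J y = {x. \<forall>b\<in>Basis - J. x \<bullet> b = y \<bullet> b}"

lemma coord_plane_span:
  assumes "J \<subseteq> Basis" shows "coord_plane J 0 = span J"
proof -
  have "x \<in> span J" if "\<forall>b\<in>Basis - J. x \<bullet> b = 0" for x :: 'a
  proof -
    have "x = (\<Sum>b\<in>Basis. (x \<bullet> b) *\<^sub>R b)" by (simp add: euclidean_representation)
    also have "\<dots> = (\<Sum>b\<in>J. (x \<bullet> b) *\<^sub>R b)"
      using assms that by (intro sum.mono_neutral_right) auto
    also have "\<dots> \<in> span J" by (intro span_sum span_scale span_base)
    finally show ?thesis .
  qed
  moreover have "x \<in> coord_plane J 0" if "x \<in> span J" for x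
    using that
  proof (rule span_induct)
    show "subspace {x. x \<in> coord_plane J 0}"
      by (auto simp: coord_plane_def subspace_def inner_add_left)
    show "x \<in> coord_plane J 0" if "x \<in> J" for x
      using that assms by (auto simp: coord_plane_def inner_Basis)
  qed
  ultimately show ?thesis by (auto simp: coord_plane_def)
qed

lemma dim_coord_plane: "J \<subseteq> Basis \<Longrightarrow> dim (coord_plane J 0) = card J"
  using dim_eq_card_independent[OF independent_mono[OF independent_Basis]] by (simp add: coord_plane_span)

lemma affine_coord_plane: "affine (coord_plane J y)"
  unfolding affine_def
proof (intro ballI allI impI)
  fix x z and u v :: real assume *: "x \<in> coord_plane J y" "z \<in> coord_plane J y" "u + v = 1"
  then have "(u *\<^sub>R x + v *\<^sub>R z) \<bullet> b = (u + v) * (y \<bullet> b)" if "b \<in> Basis - J" for b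
    unfolding distrib_right using that by (auto simp: coord_plane_def inner_add_left)
  then show "u *\<^sub>R x + v *\<^sub>R z \<in> coord_plane J y" using * by (simp add: coord_plane_def)
qed

lemma aff_dim_coord_plane:
  assumes "J \<subseteq> Basis" shows "aff_dim (coord_plane J y) = int (card J)"
proof -
  have "coord_plane J y = (+) y ` coord_plane J 0"
  proof (intro equalityI subsetI)
    fix x assume "x \<in> coord_plane J y"
    then have "x - y \<in> coord_plane J 0" by (auto simp: coord_plane_def inner_diff_left)
    then show "x \<in> (+) y ` coord_plane J 0" by (metis add_diff_cancel_left' diff_add_cancel image_eqI add.commute)
  qed (auto simp: coord_plane_def inner_add_left)
  then show ?thesis using assms
    by (simp add: aff_dim_translation_eq aff_dim_subspace coord_plane_span
        flip: dim_coord_plane)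
qed

lemma slice_alt: "slice c J p = {q \<in> chart_dom c. chart_map c q \<in> coord_plane J (chart_map c p)}"
  by (auto simp: slice_def coord_plane_def)

lemma slice_eq: "r \<in> slice c J q \<Longrightarrow> slice c J r = slice c J q"
  by (auto simp: slice_def)

lemma slice_self: "q \<in> chart_dom c \<Longrightarrow> q \<in> slice c J q"
  by (auto simp: slice_def)

locale plane_field = atlas A for A :: "('m::t2_space, 'e::euclidean_space) chart set" +
  fixes E :: "'m \<Rightarrow> 'e set" and I :: "'e set"
  assumes I: "I \<subseteq> Basis" and dim_E: "\<And>p. dim (E p) = card I"
begin

text \<open>The coordinate planes are tangent to \<open>E\<close> over the whole domain, not just
  along one slice; a box as image makes every slice path connected.\<close>

definition center_chart :: "('m, 'e) chart \<Rightarrow> bool" where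
  "center_chart c \<longleftrightarrow> Ck_chart A 1 c \<and> (\<exists>a b. chart_map c ` chart_dom c = box a b) \<and>
    (\<forall>q\<in>chart_dom c. {v. \<forall>b\<in>Basis - I. coord A c q v \<bullet> b = 0} = E q)"

definition preserving :: "('m \<Rightarrow> 'm) \<Rightarrow> bool" where
  "preserving h \<longleftrightarrow> Ck_map A 1 h \<and> (\<forall>q. \<forall>v\<in>E q. tangent_map A h q v \<in> E (h q))"

text \<open>An inclusion instead of an equality, and a coordinate set \<open>J\<close> of its own:
  the charts that \<open>tangent_to\<close> provides choose their own coordinates, whose number is
  compared with that of \<open>I\<close> only later.\<close>

definition integral_slice :: "('m, 'e) chart \<Rightarrow> 'e set \<Rightarrow> 'm \<Rightarrow> bool" where
  "integral_slice c J q \<longleftrightarrow> Ck_chart A 1 c \<and> q \<in> chart_dom c \<and>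
    (\<forall>r\<in>slice c J q. {v. \<forall>b\<in>Basis - J. coord A c r v \<bullet> b = 0} \<subseteq> E r)"

lemma preserving_id: "preserving (\<lambda>p. p)"
  by (simp add: preserving_def Ck_map_id tangent_map_id)

lemma center_chart_C1: "center_chart c \<Longrightarrow> Ck_chart A 1 c"
  by (simp add: center_chart_def)

lemma center_chart_is_chart: "center_chart c \<Longrightarrow> is_chart c"
  by (rule is_chart[OF center_chart_C1])

lemma center_chart_integral_slice: "center_chart c \<Longrightarrow> q \<in> chart_dom c \<Longrightarrow> integral_slice c I q"
  by (auto simp: center_chart_def integral_slice_def slice_def)

text \<open>Along a segment inside the slice the transversal coordinates of \<open>h\<close> in
  \<open>d\<close> have derivative 0, since the direction lies in \<open>E\<close> and
  \<open>h\<close> preserves \<open>E\<close>. With the identity for \<open>h\<close> this compares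
  two charts; with the dynamics it gives the invariance of the foliation.\<close>

lemma slice_to_slice:
  assumes S: "integral_slice c J q" and h: "preserving h" and d: "center_chart d" "h q \<in> chart_dom d"
  obtains N where "open N" "q \<in> N" "\<And>r. r \<in> slice c J q \<inter> N \<Longrightarrow> h r \<in> slice d I (h q)"
proof -
  have c: "Ck_chart A 1 c" "q \<in> chart_dom c" using S by (simp_all add: integral_slice_def)
  then have ic: "is_chart c" using is_chart by blast
  note dC = center_chart_C1[OF d(1)] center_chart_is_chart[OF d(1)]
  have hC: "Ck_map A 1 h" and hcont: "continuous_on UNIV h" using h by (auto simp: preserving_def Ck_map_def)
  define O' where "O' = chart_map c ` (chart_dom c \<inter> h -` chart_dom d)"
  have "open O'" unfolding O'_def using hcont dC(2)
    by (intro open_chart_image ic open_vimage) (auto simp: is_chart_def)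
  moreover have "chart_map c q \<in> O'" using c d by (auto simp: O'_def)
  \<comment> \<open>A ball in coordinates is convex, so a segment in it stays in the region that
    \<open>h\<close> maps into the domain of \<open>d\<close>.\<close>
  ultimately obtain \<epsilon> where \<epsilon>: "\<epsilon> > 0" "ball (chart_map c q) \<epsilon> \<subseteq> O'" using open_contains_ball by blast
  let ?B = "ball (chart_map c q) \<epsilon>"
  show ?thesis
  proof (rule that[of "chart_dom c \<inter> chart_map c -` ?B"])
    show "open (chart_dom c \<inter> chart_map c -` ?B)" by (rule open_chart_preimage[OF ic open_ball])
    show "q \<in> chart_dom c \<inter> chart_map c -` ?B" using c \<epsilon> by simp
    fix r assume "r \<in> slice c J q \<inter> (chart_dom c \<inter> chart_map c -` ?B)"
    then have r: "r \<in> slice c J q" "r \<in> chart_dom c" "chart_map c r \<in> ?B" by auto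
    define x where "x = chart_map c q"
    define u where "u = chart_map c r - x"
    have u: "u \<bullet> b = 0" if "b \<in> Basis - J" for b using r(1) that by (simp add: u_def x_def slice_def inner_diff_left)
    have seg: "x + t *\<^sub>R u \<in> O'" if "t \<in> {0..1}" for t
    proof -
      have "(1 - t) *\<^sub>R x + t *\<^sub>R chart_map c r \<in> ?B"
        using r(3) that \<epsilon> by (intro convexD[OF convex_ball]) (auto simp: x_def)
      then show ?thesis using \<epsilon> by (auto simp: u_def algebra_simps)
    qed
    have "rep c h d (x + 1 *\<^sub>R u) \<bullet> b = rep c h d (x + 0 *\<^sub>R u) \<bullet> b" if b: "b \<in> Basis - I" for b
    proof -
      have "((\<lambda>t. rep c h d (x + t *\<^sub>R u) \<bullet> b) has_derivative (\<lambda>_. 0)) (at t within {0..1})"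
        if t: "t \<in> {0..1}" for t
      proof -
        define r' where "r' = chart_inv c (x + t *\<^sub>R u)"
        have im: "x + t *\<^sub>R u \<in> chart_map c ` chart_dom c" using seg[OF t] by (auto simp: O'_def)
        have r': "r' \<in> chart_dom c" "chart_map c r' = x + t *\<^sub>R u" "h r' \<in> chart_dom d"
          using chart_inv_in_dom[OF ic im] chart_map_inv[OF ic im] seg[OF t] chart_inv_map[OF ic]
          by (auto simp: r'_def O'_def)
        have rs: "r' \<in> slice c J q" using r' u by (auto simp: slice_def inner_add_left x_def)
        define L where "L v = coord A d (h r') (tangent_map A h r' (coord_inv A c r' v))" for v
        have D: "(rep c h d has_derivative L) (at (x + t *\<^sub>R u))"
          using rep_has_derivative[OF Ck_map_has_tangent[OF hC] c(1) r'(1) dC(1) r'(3)] r'(2) by (simp add: L_def[abs_def])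
        have "((\<lambda>t. x + t *\<^sub>R u) has_derivative (\<lambda>s. s *\<^sub>R u)) (at t within {0..1})"
          by (auto intro!: derivative_eq_intros)
        then have D2: "((\<lambda>t. rep c h d (x + t *\<^sub>R u)) has_derivative (\<lambda>s. L (s *\<^sub>R u))) (at t within {0..1})"
          using D by (rule has_derivative_compose)
        have "coord_inv A c r' u \<in> {v. \<forall>b\<in>Basis - J. coord A c r' v \<bullet> b = 0}"
          using u coord_coord_inv(1)[OF c(1) r'(1)] by simp
        then have "coord_inv A c r' u \<in> E r'" using S rs unfolding integral_slice_def by blast
        then have "tangent_map A h r' (coord_inv A c r' u) \<in> E (h r')" using h by (auto simp: preserving_def)
        then have "L u \<bullet> b = 0" using d r'(3) b by (auto simp: center_chart_def L_def)
        then have "(\<lambda>s. L (s *\<^sub>R u) \<bullet> b) = (\<lambda>_. 0)"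
          using linear_cmul[OF has_derivative_linear[OF D]] by auto
        then show ?thesis using has_derivative_inner_left[OF D2, of b] by simp
      qed
      then have "(\<lambda>t. rep c h d (x + t *\<^sub>R u) \<bullet> b) constant_on {0..1::real}"
        using has_derivative_zero_constant[OF convex_real_interval(5)] unfolding constant_on_def by blast
      then show ?thesis unfolding constant_on_def by (metis atLeastAtMost_iff order_refl zero_le_one)
    qed
    moreover have "rep c h d (x + 1 *\<^sub>R u) = chart_map d (h r)" "rep c h d (x + 0 *\<^sub>R u) = chart_map d (h q)"
      using chart_inv_map[OF ic] r c by (auto simp: rep_def u_def x_def)
    moreover have "h r \<in> chart_dom d" using seg[of 1] chart_inv_map[OF ic] r by (auto simp: u_def O'_def x_def)
         (metis inj_onD chart_inv_map[OF ic])
    ultimately show "h r \<in> slice d I (h q)" by (simp add: slice_def)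
  qed
qed

lemma path_connected_slice:
  assumes "center_chart c" shows "path_connected (slice c I p)"
proof -
  obtain a b where ab: "chart_map c ` chart_dom c = box a b" using assms by (auto simp: center_chart_def)
  note c = center_chart_is_chart[OF assms]
  let ?P = "box a b \<inter> coord_plane I (chart_map c p)"
  have "slice c I p = chart_inv c ` ?P"
  proof (intro equalityI subsetI)
    fix q assume "q \<in> slice c I p"
    then have "chart_map c q \<in> ?P" "chart_inv c (chart_map c q) = q"
      using ab chart_inv_map[OF c] by (auto simp: slice_alt)
    then show "q \<in> chart_inv c ` ?P" by (metis image_eqI)
  next
    fix q assume "q \<in> chart_inv c ` ?P"
    then obtain x where "x \<in> ?P" "q = chart_inv c x" by auto
    then show "q \<in> slice c I p"
      using ab chart_inv_in_dom[OF c] chart_map_inv[OF c] by (auto simp: slice_alt)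
  qed
  moreover have "path_connected ?P"
    by (intro convex_imp_path_connected convex_Int convex_box affine_imp_convex affine_coord_plane)
  moreover have "continuous_on ?P (chart_inv c)"
    using chart_inv_continuous[OF c] ab by (auto intro: continuous_on_subset)
  ultimately show ?thesis using path_connected_continuous_image by metis
qed

lemma slice_subset_path_component:
  assumes "center_chart c" "q \<in> chart_dom c" "slice c I q \<subseteq> L"
  shows "slice c I q \<subseteq> path_component_set (L \<inter> chart_dom c) q"
  by (rule path_component_maximal[OF slice_self[OF assms(2)] path_connected_slice[OF assms(1)]])
    (use assms(3) in \<open>auto simp: slice_def\<close>)

text \<open>\<open>tangent_to\<close> fixes the tangent plane of this slice at \<open>p\<close>
  only; at another point \<open>r\<close> it speaks of another chart \<open>d\<close>. Straight
  lines in the slice of \<open>c\<close> through \<open>r\<close> stay in the leaf, hence near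
  \<open>r\<close> in the path component of \<open>r\<close> within the domain of \<open>d\<close>,
  and this component is a slice of \<open>d\<close> tangent to \<open>E r\<close>.\<close>

lemma tangent_to_integral_slice:
  assumes L: "tangent_to A L E" and p: "p \<in> L" "p \<in> chart_dom c" and c: "Ck_chart A 1 c"
    and pc: "path_component_set (L \<inter> chart_dom c) p = slice c J p"
  shows "integral_slice c J p"
  unfolding integral_slice_def
proof (intro conjI ballI subsetI)
  fix r v assume r: "r \<in> slice c J p" and v: "v \<in> {v. \<forall>b\<in>Basis - J. coord A c r v \<bullet> b = 0}"
  have sub: "slice c J r \<subseteq> L" using slice_eq[OF r] pc path_component_subset[of "L \<inter> chart_dom c" p] by auto
  have rd: "r \<in> chart_dom c" using r by (simp add: slice_def)
  have rL: "r \<in> L" using sub slice_self[OF rd] by auto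
  have ic: "is_chart c" using is_chart[OF c] .
  obtain d K where d: "Ck_chart A 1 d" "r \<in> chart_dom d"
    and pd: "path_component_set (L \<inter> chart_dom d) r = slice d K r"
    and Ed: "{v. \<forall>b\<in>Basis - K. coord A d r v \<bullet> b = 0} = E r"
    using L rL unfolding tangent_to_def by blast
  have id: "is_chart d" using is_chart[OF d(1)] .
  define u where "u = coord A c r v"
  define x where "x = chart_map c r"
  have u: "u \<bullet> b = 0" if "b \<in> Basis - J" for b using v that by (simp add: u_def)
  define F where "F = rep c (\<lambda>p. p) d"
  define D where "D w = coord A d r (coord_inv A c r w)" for w
  have FD: "(F has_derivative D) (at x)"
    using rep_has_derivative[OF has_tangent_id c rd d] by (simp add: F_def D_def[abs_def] x_def)
  have Du: "D u = coord A d r v" using coord_coord_inv(2)[OF c rd] by (simp add: D_def u_def)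
  have "open (chart_map c ` (chart_dom c \<inter> chart_dom d))" using id by (intro open_chart_image ic) (simp add: is_chart_def)
  moreover have "x \<in> chart_map c ` (chart_dom c \<inter> chart_dom d)" using rd d by (auto simp: x_def)
  ultimately obtain \<epsilon> where \<epsilon>: "\<epsilon> > 0" "ball x \<epsilon> \<subseteq> chart_map c ` (chart_dom c \<inter> chart_dom d)"
    using open_contains_ball by blast
  have curve: "F (x + t *\<^sub>R u) \<bullet> b = F x \<bullet> b" if t: "x + t *\<^sub>R u \<in> ball x \<epsilon>" and b: "b \<in> Basis - K" for t b
  proof -
    let ?S = "closed_segment x (x + t *\<^sub>R u)"
    have Sb: "?S \<subseteq> ball x \<epsilon>" using t \<epsilon> by (intro closed_segment_subset) auto
    have Si: "?S \<subseteq> chart_map c ` chart_dom c" using Sb \<epsilon> by auto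
    have "path_connected (chart_inv c ` ?S)"
      by (intro path_connected_continuous_image continuous_on_subset[OF chart_inv_continuous[OF ic] Si]) simp
    moreover have "r \<in> chart_inv c ` ?S" using chart_inv_map[OF ic rd] by (metis ends_in_segment(1) image_eqI x_def)
    moreover have "chart_inv c ` ?S \<subseteq> L \<inter> chart_dom d"
    proof clarify
      fix y assume y: "y \<in> ?S"
      then obtain s where s: "y = x + (s * t) *\<^sub>R u" by (auto simp: closed_segment_def algebra_simps)
      have "chart_inv c y \<in> chart_dom c" "chart_map c (chart_inv c y) = y"
        using chart_inv_in_dom[OF ic] chart_map_inv[OF ic] Si y by blast+
      then have "chart_inv c y \<in> slice c J r" using u by (auto simp: slice_def s inner_add_left x_def)
      moreover have "chart_inv c y \<in> chart_dom d" using y Sb \<epsilon> chart_inv_map[OF ic] by force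
      ultimately show "chart_inv c y \<in> L \<inter> chart_dom d" using sub by auto
    qed
    ultimately have "chart_inv c ` ?S \<subseteq> slice d K r" using path_component_maximal pd by metis
    then have "chart_inv c (x + t *\<^sub>R u) \<in> slice d K r" by auto
    then show ?thesis using b chart_inv_map[OF ic rd] by (auto simp: slice_def F_def rep_def x_def)
  qed
  \<comment> \<open>The derivative at 0 of a transversal coordinate of \<open>d\<close> that is
    constant along the line.\<close>
  have "D u \<bullet> b = 0" if b: "b \<in> Basis - K" for b
  proof -
    have "((\<lambda>t. x + t *\<^sub>R u) has_derivative (\<lambda>s. s *\<^sub>R u)) (at 0)"
      by (auto intro!: derivative_eq_intros)
    then have "((\<lambda>t. F (x + t *\<^sub>R u)) has_derivative (\<lambda>s. D (s *\<^sub>R u))) (at 0)"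
      by (rule has_derivative_compose) (simp add: FD)
    then have 1: "((\<lambda>t. F (x + t *\<^sub>R u) \<bullet> b) has_derivative (\<lambda>s. D (s *\<^sub>R u) \<bullet> b)) (at 0)"
      by (rule has_derivative_inner_left)
    have "((\<lambda>t::real. F (x + t *\<^sub>R u) \<bullet> b) has_derivative (\<lambda>s. 0)) (at 0)"
    proof (rule has_derivative_transform_within_open[OF has_derivative_const[of "F x \<bullet> b"]])
      show "open ((\<lambda>t. x + t *\<^sub>R u) -` ball x \<epsilon>)" by (intro open_vimage continuous_intros) auto
    qed (use \<epsilon> curve b in auto)
    from has_derivative_unique[OF 1 this] have "D (1 *\<^sub>R u) \<bullet> b = 0" by meson
    then show ?thesis by simp
  qed
  then show "v \<in> E r" using Ed Du by auto
qed (use assms in auto)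

text \<open>Locally a path in \<open>L\<close> runs in one slice provided by
  \<open>tangent_to\<close>, and near each point such a slice lies in one slice of \<open>d\<close>.
  So the slice of \<open>d\<close> through the moving point is locally constant in time.\<close>

lemma tangent_to_path_component:
  assumes L: "tangent_to A L E" and d: "center_chart d" and q: "q \<in> L \<inter> chart_dom d"
  shows "path_component_set (L \<inter> chart_dom d) q \<subseteq> slice d I q"
proof
  fix r assume "r \<in> path_component_set (L \<inter> chart_dom d) q"
  then obtain \<gamma> where \<gamma>: "path \<gamma>" "path_image \<gamma> \<subseteq> L \<inter> chart_dom d" "pathstart \<gamma> = q" "pathfinish \<gamma> = r"
    by (auto simp: path_component_def)
  have \<gamma>c: "continuous_on {0..1} \<gamma>" using \<gamma>(1) by (simp add: path_def)
  have "(\<lambda>t. slice d I (\<gamma> t)) constant_on {0..1}"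
  proof (rule locally_constant_imp_constant)
    fix t0 :: real assume t0: "t0 \<in> {0..1}"
    define p where "p = \<gamma> t0"
    have p: "p \<in> L" "p \<in> chart_dom d" using \<gamma>(2) t0 by (auto simp: path_image_def p_def)
    obtain c J where c: "Ck_chart A 1 c" "p \<in> chart_dom c" and pc: "path_component_set (L \<inter> chart_dom c) p = slice c J p"
      using L p(1) unfolding tangent_to_def by blast
    have S: "integral_slice c J p" by (rule tangent_to_integral_slice[OF L p(1) c(2,1) pc])
    obtain N where N: "open N" "p \<in> N" "\<And>r. r \<in> slice c J p \<inter> N \<Longrightarrow> r \<in> slice d I p"
      using slice_to_slice[OF S preserving_id d p(2)] by blast
    have "open (chart_dom c \<inter> N)" using N is_chart[OF c(1)] by (auto simp: is_chart_def)
    then have "openin (top_of_set {0..1}) ({0..1} \<inter> \<gamma> -` (chart_dom c \<inter> N))"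
      using continuous_openin_preimage_gen[OF \<gamma>c] by blast
    then obtain e where e: "e > 0" "ball t0 e \<inter> {0..1} \<subseteq> \<gamma> -` (chart_dom c \<inter> N)"
      using t0 N c(2) unfolding openin_contains_ball p_def by (metis IntI Int_subset_iff p_def vimage_eq)
    let ?T = "ball t0 e \<inter> {0..1}"
    have "path_connected (\<gamma> ` ?T)"
      by (intro path_connected_continuous_image continuous_on_subset[OF \<gamma>c] convex_imp_path_connected convex_Int) auto
    moreover have "p \<in> \<gamma> ` ?T" using t0 e by (auto simp: p_def)
    moreover have "\<gamma> ` ?T \<subseteq> L \<inter> chart_dom c" using e(2) \<gamma>(2) by (auto simp: path_image_def)
    ultimately have "\<gamma> ` ?T \<subseteq> slice c J p" using path_component_maximal pc by metis
    then have "\<gamma> t \<in> slice c J p \<inter> N" if "t \<in> ?T" for t using that e(2) by blast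
    then have const: "slice d I (\<gamma> t) = slice d I p" if "t \<in> ?T" for t
      using N(3) that by (intro slice_eq) blast
    show "\<exists>T. openin (top_of_set {0..1}) T \<and> t0 \<in> T \<and> (\<forall>t\<in>T. slice d I (\<gamma> t) = slice d I (\<gamma> t0))"
    proof (intro exI[of _ ?T] conjI)
      show "openin (top_of_set {0..1}) ?T"
        using openin_open_Int[of "ball t0 e" "{0..1}"] by (simp add: Int_commute)
      show "\<forall>t\<in>?T. slice d I (\<gamma> t) = slice d I (\<gamma> t0)" using const unfolding p_def by blast
    qed (use e t0 in auto)
  qed simp
  then have "slice d I (\<gamma> 1) = slice d I (\<gamma> 0)" by (auto simp: constant_on_def)
  moreover have "r \<in> chart_dom d" using \<gamma>(2,4) by (auto simp: path_image_def pathfinish_def)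
  ultimately show "r \<in> slice d I q" using \<gamma>(3,4) slice_self[of r d I] by (simp add: pathstart_def pathfinish_def)
qed

text \<open>Near \<open>r\<close> the slice of \<open>c\<close> lies in the leaf and injects
  continuously into the slice of \<open>d\<close>. Both have the dimension of \<open>E r\<close>, so
  by invariance of domain the image is open there.\<close>

lemma tangent_to_open_in_slice:
  assumes L: "tangent_to A L E" and d: "center_chart d" and r: "r \<in> L" "r \<in> chart_dom d"
  shows "\<exists>T. openin (top_of_set (slice d I r)) T \<and> r \<in> T \<and> T \<subseteq> L"
proof -
  obtain c J where c: "Ck_chart A 1 c" "r \<in> chart_dom c" and J: "J \<subseteq> Basis"
    and pc: "path_component_set (L \<inter> chart_dom c) r = slice c J r"
    and Er: "{v. \<forall>b\<in>Basis - J. coord A c r v \<bullet> b = 0} = E r"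
    using L r(1) unfolding tangent_to_def by blast
  have S: "integral_slice c J r" by (rule tangent_to_integral_slice[OF L r(1) c(2,1) pc])
  obtain N where N: "open N" "r \<in> N" "\<And>q. q \<in> slice c J r \<inter> N \<Longrightarrow> q \<in> slice d I r"
    using slice_to_slice[OF S preserving_id d r(2)] by blast
  note ic = is_chart[OF c(1)] center_chart_is_chart[OF d]
  have "E r = coord_inv A c r ` coord_plane J 0"
  proof (intro equalityI subsetI)
    fix v assume "v \<in> E r"
    then have "coord A c r v \<in> coord_plane J 0" using Er by (auto simp: coord_plane_def)
    then show "v \<in> coord_inv A c r ` coord_plane J 0" using coord_coord_inv(2)[OF c, of v] by (metis image_eqI)
  qed (use Er coord_coord_inv(1)[OF c] in \<open>auto simp: coord_plane_def\<close>)
  moreover have "inj (coord_inv A c r)" by (rule injI) (metis coord_coord_inv(1)[OF c])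
  ultimately have "dim (E r) = card J"
    using dim_image_eq[OF linear_coord(2)[OF c]] dim_coord_plane[OF J] by (metis inj_on_subset subset_UNIV)
  then have cardJ: "card I = card J" using dim_E by simp
  define O' where "O' = chart_map c ` (chart_dom c \<inter> (N \<inter> chart_dom d))"
  have opO: "open O'" unfolding O'_def using N(1) ic(2) by (intro open_chart_image ic) (auto simp: is_chart_def)
  define D where "D = coord_plane J (chart_map c r) \<inter> O'"
  define f where "f = chart_map d \<circ> chart_inv c"
  have inv: "chart_inv c x \<in> slice c J r \<inter> N \<inter> chart_dom d" "chart_map c (chart_inv c x) = x" if "x \<in> D" for x
    using that chart_inv_map[OF ic(1)] by (auto simp: D_def O'_def slice_alt)
  have "openin (top_of_set (coord_plane I (chart_map d r))) (f ` D)"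
  proof (rule invariance_of_domain_affine_sets)
    show "openin (top_of_set (coord_plane J (chart_map c r))) D" unfolding D_def by (rule openin_open_Int[OF opO])
    show "aff_dim (coord_plane I (chart_map d r)) \<le> aff_dim (coord_plane J (chart_map c r))"
      using I J cardJ by (simp add: aff_dim_coord_plane)
    show "continuous_on D f" unfolding f_def
      by (intro continuous_on_compose continuous_on_subset[OF chart_inv_continuous[OF ic(1)]]
          continuous_on_subset[OF chart_map_continuous[OF ic(2)]]) (use inv in \<open>auto simp: D_def O'_def\<close>)
    show "f \<in> D \<rightarrow> coord_plane I (chart_map d r)" using inv(1) N(3) by (auto simp: f_def slice_alt)
    show "inj_on f D"
    proof (rule inj_onI)
      fix x y assume "x \<in> D" "y \<in> D" "f x = f y"
      then have "chart_inv c x = chart_inv c y" using inv(1) chart_inv_map[OF ic(2)] by (metis IntD2 comp_apply f_def)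
      then show "x = y" using inv(2) \<open>x \<in> D\<close> \<open>y \<in> D\<close> by metis
    qed
  qed (auto intro: affine_coord_plane)
  then obtain W where W: "open W" "f ` D = coord_plane I (chart_map d r) \<inter> W" by (auto simp: openin_open)
  show ?thesis
  proof (intro exI[of _ "slice d I r \<inter> (chart_dom d \<inter> chart_map d -` W)"] conjI subsetI)
    show "openin (top_of_set (slice d I r)) (slice d I r \<inter> (chart_dom d \<inter> chart_map d -` W))"
      by (intro openin_open_Int open_chart_preimage ic W)
    have "chart_map c r \<in> D" using c r N by (auto simp: D_def O'_def coord_plane_def)
    then have "f (chart_map c r) \<in> W" using W by blast
    then show "r \<in> slice d I r \<inter> (chart_dom d \<inter> chart_map d -` W)"
      using r(2) slice_self[OF r(2)] chart_inv_map[OF ic(1) c(2)] by (auto simp: f_def)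
    fix q assume q: "q \<in> slice d I r \<inter> (chart_dom d \<inter> chart_map d -` W)"
    then have "chart_map d q \<in> f ` D" unfolding W by (auto simp: slice_alt)
    then obtain x where x: "x \<in> D" "chart_map d q = chart_map d (chart_inv c x)" by (auto simp: f_def)
    then have "q = chart_inv c x" using inv(1) q chart_inv_map[OF ic(2)] by (metis IntD1 IntD2)
    then have "q \<in> slice c J r" using inv(1)[OF x(1)] by auto
    then show "q \<in> L" using pc path_component_subset[of "L \<inter> chart_dom c" r] by auto
  qed
qed

text \<open>The leaves are disjoint and open in the slices that they meet, and a slice is connected,
  so it lies in a single leaf.\<close>

lemma partition_tangent_path_component:
  assumes F: "partition_on UNIV F" "\<forall>L\<in>F. tangent_to A L E" and d: "center_chart d"
    and L: "L \<in> F" and q: "q \<in> L \<inter> chart_dom d"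
  shows "path_component_set (L \<inter> chart_dom d) q = slice d I q"
proof
  show "path_component_set (L \<inter> chart_dom d) q \<subseteq> slice d I q"
    using tangent_to_path_component F(2) L d q by blast
  have leaf: "\<exists>K\<in>F. x \<in> K" for x using F(1) by (auto simp: partition_on_def)
  have uniq: "{M \<in> F. x \<in> M} = {K}" if "K \<in> F" "x \<in> K" for x K
    using F(1) that by (fastforce simp: partition_on_def disjoint_def)
  \<comment> \<open>The set of leaves that contain \<open>x\<close>, a singleton, serves as the
    locally constant function.\<close>
  have "(\<lambda>x. {K \<in> F. x \<in> K}) constant_on slice d I q"
  proof (rule locally_constant_imp_constant)
    show "connected (slice d I q)" by (rule path_connected_imp_connected[OF path_connected_slice[OF d]])
    fix a assume a: "a \<in> slice d I q"
    obtain K where K: "K \<in> F" "a \<in> K" using leaf by blast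
    obtain T where T: "openin (top_of_set (slice d I a)) T" "a \<in> T" "T \<subseteq> K"
      using tangent_to_open_in_slice[of K d a] F(2) K d a by (auto simp: slice_def)
    have const: "{K \<in> F. x \<in> K} = {K \<in> F. a \<in> K}" if "x \<in> T" for x
      using uniq[OF K(1) subsetD[OF T(3) that]] uniq[OF K] by simp
    show "\<exists>T. openin (top_of_set (slice d I q)) T \<and> a \<in> T \<and> (\<forall>x\<in>T. {K \<in> F. x \<in> K} = {K \<in> F. a \<in> K})"
      using T(1,2) unfolding slice_eq[OF a] by (intro exI[of _ T] conjI ballI const)
  qed
  then have "{K \<in> F. x \<in> K} = {K \<in> F. q \<in> K}" if "x \<in> slice d I q" for x
    using that slice_self[of q d I] q by (auto simp: constant_on_def)
  then have "slice d I q \<subseteq> L" using L q by blast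
  then show "slice d I q \<subseteq> path_component_set (L \<inter> chart_dom d) q"
    using slice_subset_path_component[OF d] q by blast
qed

lemma Ck_chart_0: assumes "Ck_chart A 1 c" shows "Ck_chart A 0 c"
  using assms Ck_on_le[of 1 _ _ 0] by (auto simp: Ck_chart_def simp del: Ck_on.simps One_nat_def)

text \<open>The adapted charts are foliated charts of class C^1 for every center foliation at once,
  whatever topological charts it came with.\<close>

lemma center_foliation_C1:
  assumes charts: "\<And>p. \<exists>c. center_chart c \<and> p \<in> chart_dom c" and F: "center_foliation A f E F"
  shows "foliation A 1 (card I) F"
  unfolding foliation_def
proof (intro conjI allI)
  show part: "partition_on UNIV F" and "\<forall>L\<in>F. path_connected L"
    using F by (auto simp: center_foliation_def foliation_def)
  have tan: "\<forall>L\<in>F. tangent_to A L E" using F by (auto simp: center_foliation_def)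
  fix p
  obtain c where c: "center_chart c" "p \<in> chart_dom c" using charts by blast
  then obtain a b where ab: "chart_map c ` chart_dom c = box a b" by (auto simp: center_chart_def)
  show "\<exists>c J a b. Ck_chart A 1 c \<and> p \<in> chart_dom c \<and> chart_map c ` chart_dom c = box a b \<and> J \<subseteq> Basis \<and> card J = card I \<and>
    (\<forall>L\<in>F. \<forall>q\<in>L \<inter> chart_dom c. path_component_set (L \<inter> chart_dom c) q = slice c J q)"
    using c ab I partition_tangent_path_component[OF part tan c(1)] center_chart_C1[OF c(1)] by blast
qed

section \<open>Leaves as chains of plaques\<close>

text \<open>A slice of \<open>d\<close> may meet the domain of \<open>c\<close> in infinitely many
  pieces, but on their union the slice of \<open>c\<close> through a point is locally
  constant.\<close>

lemma countable_slices_of_slice: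
  assumes c: "center_chart c" and d: "center_chart d" and p: "p \<in> chart_dom d"
  shows "countable (slice c I ` (slice d I p \<inter> chart_dom c))"
proof -
  note ic = center_chart_is_chart[OF c] center_chart_is_chart[OF d]
  let ?S = "slice d I p \<inter> chart_dom c"
  have inv: "chart_inv d (chart_map d q) = q" if "q \<in> ?S" for q
    using that chart_inv_map[OF ic(2)] by (simp add: slice_def)
  \<comment> \<open>The count takes place in the coordinates of \<open>d\<close>, in a second
    countable space.\<close>
  have "countable ((\<lambda>x. slice c I (chart_inv d x)) ` (chart_map d ` ?S))"
  proof (rule countable_locally_constant_image)
    fix x assume "x \<in> chart_map d ` ?S"
    then obtain q where q: "q \<in> ?S" "x = chart_map d q" by blast
    then have qd: "q \<in> chart_dom d" by (simp add: slice_def)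
    obtain N where N: "open N" "q \<in> N" "\<And>r. r \<in> slice d I q \<inter> N \<Longrightarrow> r \<in> slice c I q"
      using slice_to_slice[OF center_chart_integral_slice[OF d qd] preserving_id c] q by blast
    show "\<exists>N. open N \<and> x \<in> N \<and> (\<forall>y\<in>chart_map d ` ?S \<inter> N. slice c I (chart_inv d y) = slice c I (chart_inv d x))"
    proof (intro exI[of _ "chart_map d ` (chart_dom d \<inter> N)"] conjI ballI)
      show "open (chart_map d ` (chart_dom d \<inter> N))" by (rule open_chart_image[OF ic(2) N(1)])
      show "x \<in> chart_map d ` (chart_dom d \<inter> N)" using q qd N by auto
      fix y assume "y \<in> chart_map d ` ?S \<inter> chart_map d ` (chart_dom d \<inter> N)"
      then obtain r r' where r: "r \<in> ?S" "y = chart_map d r" "r' \<in> chart_dom d \<inter> N" "y = chart_map d r'" by blast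
      have "chart_inv d y = r" unfolding r(2) by (rule inv[OF r(1)])
      moreover have "chart_inv d y = r'" unfolding r(4) using r(3) by (intro chart_inv_map[OF ic(2)]) blast
      ultimately have "r = r'" by metis
      have "slice d I q = slice d I p" by (rule slice_eq) (use q(1) in simp)
      then have "r \<in> slice d I q \<inter> N" using r(1,3) \<open>r = r'\<close> by simp
      then have "slice c I r = slice c I q" by (intro slice_eq N(3))
      then show "slice c I (chart_inv d y) = slice c I (chart_inv d x)" using inv q r by simp
    qed
  qed
  moreover have "(\<lambda>x. slice c I (chart_inv d x)) ` chart_map d ` ?S = slice c I ` ?S"
    unfolding image_image by (intro image_cong refl) (simp only: inv)
  ultimately show ?thesis by simp
qed

definition plaque_rel :: "('m, 'e) chart set \<Rightarrow> ('m \<times> 'm) set" where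
  "plaque_rel C = {(q, r). \<exists>c\<in>C. q \<in> chart_dom c \<and> r \<in> slice c I q}"

definition leaf :: "('m, 'e) chart set \<Rightarrow> 'm \<Rightarrow> 'm set" where
  "leaf C q = (plaque_rel C)\<^sup>* `` {q}"

context
  fixes C :: "('m, 'e) chart set"
  assumes C: "countable C" "\<And>c. c \<in> C \<Longrightarrow> center_chart c" and cover: "\<And>p. \<exists>c\<in>C. p \<in> chart_dom c"
begin

lemma sym_plaque_rel: "sym (plaque_rel C)"
  by (auto simp: sym_def plaque_rel_def slice_def)

lemma equiv_leaf: "equiv UNIV ((plaque_rel C)\<^sup>*)"
  by (intro equivI refl_rtrancl sym_rtrancl sym_plaque_rel trans_rtrancl) simp

lemma leaf_eq_iff: "leaf C q = leaf C r \<longleftrightarrow> r \<in> leaf C q"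
  using eq_equiv_class_iff[OF equiv_leaf, of q r] by (simp add: leaf_def)

lemma leaf_self: "q \<in> leaf C q"
  by (simp add: leaf_def)

lemma slice_subset_leaf:
  assumes "c \<in> C" "q \<in> chart_dom c" "q \<in> leaf C p" shows "slice c I q \<subseteq> leaf C p"
  using assms by (auto simp: leaf_def plaque_rel_def intro: rtrancl_into_rtrancl)

lemma path_connected_leaf: "path_connected (leaf C q)"
proof -
  have "path_component (leaf C q) q r" if "(q, r) \<in> (plaque_rel C)\<^sup>*" for r
    using that
  proof (induction rule: rtrancl_induct)
    case base
    then show ?case using path_component_refl leaf_self by blast
  next
    case (step y z)
    then obtain c where c: "c \<in> C" "y \<in> chart_dom c" "z \<in> slice c I y" by (auto simp: plaque_rel_def)
    have sub: "slice c I y \<subseteq> leaf C q" using slice_subset_leaf[OF c(1,2)] step by (simp add: leaf_def)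
    have "path_component (slice c I y) y z"
      using path_connected_slice[OF C(2)[OF c(1)]] c(3) slice_self[OF c(2)] by (simp add: path_connected_component)
    then show ?case using path_component_of_subset[OF sub] step.IH path_component_trans by blast
  qed
  then show ?thesis unfolding path_connected_component
    by (auto simp: leaf_def) (meson path_component_sym path_component_trans)
qed

text \<open>Induction on the length of chains: in each step, countably many plaques of countably
  many charts meet the domain of \<open>c\<close> in countably many slices each.\<close>

lemma countable_slices_of_leaf:
  assumes c: "c \<in> C" shows "countable (slice c I ` (leaf C q \<inter> chart_dom c))"
proof -
  have step: "\<forall>c\<in>C. countable (slice c I ` ((plaque_rel C ^^ n) `` {q} \<inter> chart_dom c))" for n
  proof (induction n)
    case 0
    have "slice c I ` ((plaque_rel C ^^ 0) `` {q} \<inter> chart_dom c) \<subseteq> {slice c I q}" for c by auto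
    then show ?case by (meson countable_empty countable_insert countable_subset)
  next
    case (Suc n)
    show ?case
    proof
      fix c assume c: "c \<in> C"
      let ?Q = "\<lambda>d. (plaque_rel C ^^ n) `` {q} \<inter> chart_dom d"
      have "x \<in> (plaque_rel C ^^ Suc n) `` {q} \<longleftrightarrow>
          (\<exists>y. (q, y) \<in> plaque_rel C ^^ n \<and> (\<exists>d\<in>C. y \<in> chart_dom d \<and> x \<in> slice d I y))" for x
        by (auto simp: plaque_rel_def)
      then have "(plaque_rel C ^^ Suc n) `` {q} = (\<Union>d\<in>C. \<Union>s\<in>slice d I ` ?Q d. s)" by blast
      then have eq: "slice c I ` ((plaque_rel C ^^ Suc n) `` {q} \<inter> chart_dom c) =
          (\<Union>d\<in>C. \<Union>s\<in>slice d I ` ?Q d. slice c I ` (s \<inter> chart_dom c))" by auto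
      have cnt: "countable (slice c I ` (s \<inter> chart_dom c))" if "d \<in> C" "s \<in> slice d I ` ?Q d" for d s
        using countable_slices_of_slice[OF C(2)[OF c] C(2)[OF that(1)]] that(2) by auto
      show "countable (slice c I ` ((plaque_rel C ^^ Suc n) `` {q} \<inter> chart_dom c))"
        unfolding eq using Suc.IH by (intro countable_UN C(1) cnt) blast+
    qed
  qed
  have "leaf C q = (\<Union>n. (plaque_rel C ^^ n) `` {q})" by (auto simp: leaf_def rtrancl_power)
  then have "slice c I ` (leaf C q \<inter> chart_dom c) = (\<Union>n. slice c I ` ((plaque_rel C ^^ n) `` {q} \<inter> chart_dom c))"
    by auto
  then show ?thesis using step c by simp
qed

text \<open>Along a path in the leaf, a transversal coordinate takes only countably many values, and
  a countable connected set of reals is a point. This rules out a passage between slices even when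
  the leaf is dense.\<close>

lemma path_component_leaf:
  assumes c: "c \<in> C" and q: "q \<in> leaf C p \<inter> chart_dom c"
  shows "path_component_set (leaf C p \<inter> chart_dom c) q = slice c I q"
proof
  show "slice c I q \<subseteq> path_component_set (leaf C p \<inter> chart_dom c) q"
    using slice_subset_path_component[OF C(2)[OF c]] slice_subset_leaf[OF c] q by blast
  show "path_component_set (leaf C p \<inter> chart_dom c) q \<subseteq> slice c I q"
  proof
    fix r assume "r \<in> path_component_set (leaf C p \<inter> chart_dom c) q"
    then obtain \<gamma> where \<gamma>: "path \<gamma>" "path_image \<gamma> \<subseteq> leaf C p \<inter> chart_dom c" "pathstart \<gamma> = q" "pathfinish \<gamma> = r"
      by (auto simp: path_component_def)
    then have rq: "r \<in> path_image \<gamma>" "q \<in> path_image \<gamma>" by auto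
    have "chart_map c r \<bullet> b = chart_map c q \<bullet> b" if b: "b \<in> Basis - I" for b
    proof -
      let ?g = "\<lambda>r. chart_map c r \<bullet> b"
      have "connected (?g ` path_image \<gamma>)"
        by (intro connected_continuous_image connected_path_image \<gamma>(1) continuous_intros
            continuous_on_subset[OF chart_map_continuous[OF center_chart_is_chart[OF C(2)[OF c]]]]) (use \<gamma>(2) in auto)
      moreover have "countable (?g ` path_image \<gamma>)"
      proof (rule countable_subset)
        \<comment> \<open>\<open>?g\<close> is constant on each slice, so its value can be read off
          at a chosen point of the slice.\<close>
        show "?g ` path_image \<gamma> \<subseteq> (\<lambda>s. ?g (SOME r. r \<in> s)) ` slice c I ` (leaf C p \<inter> chart_dom c)"
        proof clarify
          fix x assume "x \<in> path_image \<gamma>"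
          then have x: "x \<in> leaf C p \<inter> chart_dom c" using \<gamma>(2) by blast
          then have "(SOME r. r \<in> slice c I x) \<in> slice c I x"
            by (intro someI[of "\<lambda>r. r \<in> slice c I x", OF slice_self]) simp
          then have "?g x = ?g (SOME r. r \<in> slice c I x)" using b by (simp add: slice_def)
          then show "?g x \<in> (\<lambda>s. ?g (SOME r. r \<in> s)) ` slice c I ` (leaf C p \<inter> chart_dom c)" using x by blast
        qed
        show "countable ((\<lambda>s. ?g (SOME r. r \<in> s)) ` slice c I ` (leaf C p \<inter> chart_dom c))"
          by (intro countable_image countable_slices_of_leaf c)
      qed
      ultimately show ?thesis using connected_uncountable rq by blast
    qed
    then show "r \<in> slice c I q" using rq \<gamma>(2) by (auto simp: slice_def)
  qed
qed

text \<open>As \<open>x\<close> runs through a plaque, the leaf of \<open>h x\<close> is locally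
  constant because \<open>h\<close> sends small pieces of plaques into plaques; connectedness of the
  plaque carries this over each link of a chain.\<close>

lemma preserving_maps_leaf:
  assumes h: "preserving h" and r: "r \<in> leaf C q" shows "h r \<in> leaf C (h q)"
proof -
  have "(q, r) \<in> (plaque_rel C)\<^sup>*" using r by (simp add: leaf_def)
  then show ?thesis
  proof (induction rule: rtrancl_induct)
    case base
    then show ?case by (rule leaf_self)
  next
    case (step y z)
    then obtain c where c: "c \<in> C" "y \<in> chart_dom c" "z \<in> slice c I y" by (auto simp: plaque_rel_def)
    have "(\<lambda>x. leaf C (h x)) constant_on slice c I y"
    proof (rule locally_constant_imp_constant)
      show "connected (slice c I y)" by (rule path_connected_imp_connected[OF path_connected_slice[OF C(2)[OF c(1)]]])
      fix a assume a: "a \<in> slice c I y"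
      then have ad: "a \<in> chart_dom c" by (simp add: slice_def)
      obtain d where d: "d \<in> C" "h a \<in> chart_dom d" using cover by blast
      obtain N where N: "open N" "a \<in> N" "\<And>x. x \<in> slice c I a \<inter> N \<Longrightarrow> h x \<in> slice d I (h a)"
        using slice_to_slice[OF center_chart_integral_slice[OF C(2)[OF c(1)] ad] h C(2)[OF d(1)] d(2)] by blast
      have "leaf C (h x) = leaf C (h a)" if "x \<in> slice c I y \<inter> N" for x
        using N(3)[of x] that slice_eq[OF a] slice_subset_leaf[OF d leaf_self] leaf_eq_iff[of "h a" "h x"] by blast
      then show "\<exists>T. openin (top_of_set (slice c I y)) T \<and> a \<in> T \<and> (\<forall>x\<in>T. leaf C (h x) = leaf C (h a))"
        using openin_open_Int[OF N(1)] N(2) a by blast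
    qed
    then have "leaf C (h z) = leaf C (h y)"
      using c(3) slice_self[OF c(2)] by (auto simp: constant_on_def)
    then show ?case using step.IH leaf_eq_iff leaf_self by metis
  qed
qed

lemma center_foliation_leaves:
  assumes f: "preserving f" "preserving (inv f)" "bij f"
  shows "center_foliation A f E (range (leaf C))"
  unfolding center_foliation_def
proof (intro conjI ballI exI)
  show "foliation A 0 (card I) (range (leaf C))"
    unfolding foliation_def
  proof (intro conjI allI ballI)
    have "range (leaf C) = UNIV // (plaque_rel C)\<^sup>*" by (auto simp: quotient_def leaf_def)
    then show "partition_on UNIV (range (leaf C))" using partition_on_quotient[OF equiv_leaf] by simp
    show "path_connected L" if "L \<in> range (leaf C)" for L using that path_connected_leaf by auto
    fix p
    obtain c where c: "c \<in> C" "p \<in> chart_dom c" using cover by blast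
    then obtain a b where ab: "chart_map c ` chart_dom c = box a b"
      using C(2)[OF c(1)] unfolding center_chart_def by blast
    show "\<exists>c J a b. Ck_chart A 0 c \<and> p \<in> chart_dom c \<and> chart_map c ` chart_dom c = box a b \<and> J \<subseteq> Basis \<and> card J = card I \<and>
      (\<forall>L\<in>range (leaf C). \<forall>q\<in>L \<inter> chart_dom c. path_component_set (L \<inter> chart_dom c) q = slice c J q)"
      using c ab I path_component_leaf[OF c(1)] Ck_chart_0[OF center_chart_C1[OF C(2)[OF c(1)]]] by blast
  qed
  fix L assume "L \<in> range (leaf C)"
  then obtain q where q: "L = leaf C q" by auto
  show "tangent_to A L E" unfolding tangent_to_def
  proof
    fix p assume p: "p \<in> L"
    obtain c where c: "c \<in> C" "p \<in> chart_dom c" using cover by blast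
    then show "\<exists>c J. Ck_chart A 1 c \<and> p \<in> chart_dom c \<and> J \<subseteq> Basis \<and>
        path_component_set (L \<inter> chart_dom c) p = slice c J p \<and> {v. \<forall>b\<in>Basis - J. coord A c p v \<bullet> b = 0} = E p"
      using C(2)[OF c(1)] I path_component_leaf[OF c(1)] p q center_chart_C1[OF C(2)[OF c(1)]]
      by (intro exI[of _ c] exI[of _ I]) (auto simp: center_chart_def)
  qed
  have "f ` leaf C q = leaf C (f q)"
  proof
    show "f ` leaf C q \<subseteq> leaf C (f q)" using preserving_maps_leaf[OF f(1)] by blast
    show "leaf C (f q) \<subseteq> f ` leaf C q"
    proof
      fix r assume "r \<in> leaf C (f q)"
      then have "inv f r \<in> leaf C q" using preserving_maps_leaf[OF f(2)] f(3) by (metis bij_inv_eq_iff)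
      then show "r \<in> f ` leaf C q" using f(3) by (metis bij_inv_eq_iff image_eqI)
    qed
  qed
  then show "f ` L \<in> range (leaf C)" using q by auto
qed

end

text \<open>Compactness leaves finitely many adapted charts, which gives the countability on which
  the description of the leaves depends.\<close>

lemma center_foliation_exists:
  assumes charts: "\<And>p. \<exists>c. center_chart c \<and> p \<in> chart_dom c" and comp: "compact (UNIV :: 'm set)"
    and f: "preserving f" "preserving (inv f)" "bij f"
  shows "\<exists>F. center_foliation A f E F"
proof -
  let ?U = "chart_dom ` {c. center_chart c}"
  have "\<forall>B\<in>?U. open B" using center_chart_is_chart by (auto simp: is_chart_def)
  moreover have "UNIV \<subseteq> \<Union>?U" using charts by blast
  ultimately obtain \<D> where D: "\<D> \<subseteq> ?U" "finite \<D>" "UNIV \<subseteq> \<Union>\<D>"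
    using comp unfolding compact_eq_Heine_Borel by metis
  then obtain C where C: "C \<subseteq> {c. center_chart c}" "finite C" "\<D> = chart_dom ` C" by (meson finite_subset_image)
  then have "\<exists>c\<in>C. p \<in> chart_dom c" for p using D(3) by blast
  from center_foliation_leaves[OF _ _ this f] show ?thesis using C countable_finite by blast
qed

end

section \<open>Uniform bounds and the symplectic orthogonal of the hyperbolic bundles\<close>

text \<open>As \<open>P\<close> is monotone in the constant, the finitely many local constants may
  be replaced by the sum of their absolute values.\<close>

lemma compact_uniform_bound:
  fixes P :: "'m::topological_space \<Rightarrow> real \<Rightarrow> bool"
  assumes comp: "compact (UNIV :: 'm set)"
    and loc: "\<And>p. \<exists>U K. open U \<and> p \<in> U \<and> (\<forall>q\<in>U. P q K)"
    and mono: "\<And>q K K'. P q K \<Longrightarrow> K \<le> K' \<Longrightarrow> P q K'"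
  obtains K where "\<And>q. P q K"
proof -
  obtain U K where UK: "\<And>p. open (U p)" "\<And>p. p \<in> U p" "\<And>p q. q \<in> U p \<Longrightarrow> P q (K p)"
    using loc by metis
  have "\<forall>B\<in>range U. open B" "UNIV \<subseteq> \<Union>(range U)" using UK by auto
  then obtain \<D> where D: "\<D> \<subseteq> range U" "finite \<D>" "UNIV \<subseteq> \<Union>\<D>"
    using comp unfolding compact_eq_Heine_Borel by metis
  then obtain S where S: "finite S" "\<D> = U ` S" by (meson finite_subset_image)
  have "P q (\<Sum>p\<in>S. \<bar>K p\<bar>)" for q
  proof -
    obtain p where p: "p \<in> S" "q \<in> U p" using D(3) S(2) by blast
    have "K p \<le> \<bar>K p\<bar>" by simp
    also have "\<dots> \<le> (\<Sum>p\<in>S. \<bar>K p\<bar>)" using p S by (intro member_le_sum) auto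
    finally show ?thesis using mono UK(3)[OF p(2)] by blast
  qed
  then show ?thesis using that by blast
qed

text \<open>The extreme values of \<open>Q\<close> on a compact ball times the unit sphere, spread
  to all vectors by homogeneity. It is meant for the metric and for a sum of squares that measures
  the nondegeneracy of \<open>w\<close>.\<close>

lemma quadratic_bounds:
  fixes Q :: "'e::euclidean_space \<Rightarrow> 'e \<Rightarrow> real"
  assumes S: "open S" "x0 \<in> S" and cont: "continuous_on (S \<times> UNIV) (\<lambda>z. Q (fst z) (snd z))"
    and hom: "\<And>x t v. x \<in> S \<Longrightarrow> Q x (t *\<^sub>R v) = t^2 * Q x v"
    and pos: "\<And>x v. x \<in> S \<Longrightarrow> v \<noteq> 0 \<Longrightarrow> Q x v > 0"
  obtains e k K where "e > 0" "k > 0" "ball x0 e \<subseteq> S"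
    "\<And>x v. x \<in> ball x0 e \<Longrightarrow> k * (norm v)^2 \<le> Q x v"
    "\<And>x v. x \<in> ball x0 e \<Longrightarrow> Q x v \<le> K * (norm v)^2"
proof -
  obtain e where e: "e > 0" "cball x0 e \<subseteq> S" using S open_contains_cball by blast
  let ?K = "cball x0 e \<times> sphere (0::'e) 1"
  obtain b :: 'e where "b \<in> Basis" using nonempty_Basis by blast
  then have ne: "?K \<noteq> {}" using e by (auto intro!: exI[of _ b])
  have comp: "compact ?K" by (intro compact_Times) auto
  have c: "continuous_on ?K (\<lambda>z. Q (fst z) (snd z))" using e by (intro continuous_on_subset[OF cont]) auto
  obtain z where z: "z \<in> ?K" "\<And>y. y \<in> ?K \<Longrightarrow> Q (fst z) (snd z) \<le> Q (fst y) (snd y)"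
    using continuous_attains_inf[OF comp ne c] by auto
  obtain z' where z': "z' \<in> ?K" "\<And>y. y \<in> ?K \<Longrightarrow> Q (fst y) (snd y) \<le> Q (fst z') (snd z')"
    using continuous_attains_sup[OF comp ne c] by auto
  have eq: "Q x v = (norm v)^2 * Q x (v /\<^sub>R norm v)" if "x \<in> S" for x v
    using hom[OF that, of "norm v" "v /\<^sub>R norm v"] hom[OF that, of 0 v] by (cases "v = 0") auto
  show ?thesis
  proof (rule that[OF e(1)])
    show "Q (fst z) (snd z) > 0" using z(1) e by (intro pos) auto
    show "ball x0 e \<subseteq> S" using e ball_subset_cball by blast
    fix x v assume x: "x \<in> ball x0 e"
    then have xS: "x \<in> S" "x \<in> cball x0 e" using e by auto
    show "Q (fst z) (snd z) * (norm v)^2 \<le> Q x v"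
    proof (cases "v = 0")
      case False
      then have "Q (fst z) (snd z) \<le> Q x (v /\<^sub>R norm v)" using z(2)[of "(x, v /\<^sub>R norm v)"] xS by simp
      from mult_left_mono[OF this, of "(norm v)^2"] show ?thesis by (subst eq[OF xS(1)]) (simp add: mult_ac)
    qed (use eq[OF xS(1), of v] in simp)
    show "Q x v \<le> Q (fst z') (snd z') * (norm v)^2"
    proof (cases "v = 0")
      case False
      then have "Q x (v /\<^sub>R norm v) \<le> Q (fst z') (snd z')" using z'(2)[of "(x, v /\<^sub>R norm v)"] xS by simp
      from mult_left_mono[OF this, of "(norm v)^2"] show ?thesis by (subst eq[OF xS(1)]) (simp add: mult_ac)
    qed (use eq[OF xS(1), of v] in simp)
  qed
qed

lemma bilinear_linear:
  assumes "bilinear b" shows "linear (b u)" "linear (\<lambda>u. b u v)"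
  using assms by (simp_all add: bilinear_def)

lemma bilinear_sum_Basis:
  fixes b :: "'e::euclidean_space \<Rightarrow> 'e \<Rightarrow> real"
  assumes "bilinear b"
  shows "b u v = (\<Sum>i\<in>Basis. \<Sum>j\<in>Basis. (u \<bullet> i) * (v \<bullet> j) * b i j)"
proof -
  have *: "b i v = (\<Sum>j\<in>Basis. (v \<bullet> j) *\<^sub>R b i j)" for i
    by (rule linear_sum_Basis[OF bilinear_linear(1)[OF assms]])
  have "b u v = (\<Sum>i\<in>Basis. (u \<bullet> i) *\<^sub>R b i v)"
    by (rule linear_sum_Basis[OF bilinear_linear(2)[OF assms]])
  also have "\<dots> = (\<Sum>i\<in>Basis. (u \<bullet> i) *\<^sub>R (\<Sum>j\<in>Basis. (v \<bullet> j) *\<^sub>R b i j))"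
    unfolding *[symmetric] ..
  finally show ?thesis by (simp add: sum_distrib_left mult.assoc)
qed

section \<open>Metric, forms and frames in charts\<close>

context atlas
begin

lemma bilinear_local_form:
  assumes b: "\<And>p. bilinear (b p)" and c: "Ck_chart A 1 c" and x: "x \<in> chart_map c ` chart_dom c"
  shows "bilinear (\<lambda>u v. local_form A b c u v x)"
  unfolding bilinear_def local_form_def
  using linear_compose[OF linear_coord(2)[OF c chart_inv_in_dom[OF is_chart[OF c] x]] bilinear_linear(1)[OF b]]
    linear_compose[OF linear_coord(2)[OF c chart_inv_in_dom[OF is_chart[OF c] x]] bilinear_linear(2)[OF b]]
  by (auto simp: o_def)

lemma local_form_coord:
  assumes c: "Ck_chart A 1 c" and q: "q \<in> chart_dom c"
  shows "local_form A b c (coord A c q u) (coord A c q v) (chart_map c q) = b q u v"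
  using coord_coord_inv(2)[OF c q] chart_inv_map[OF is_chart[OF c] q] by (simp add: local_form_def)

text \<open>Joint continuity in point and vector, by expansion in the coefficients of the
  form.\<close>

lemma continuous_local_form_along:
  assumes b: "smooth_bilinear_field A b" and c: "c \<in> A" and S: "S \<subseteq> chart_map c ` chart_dom c"
    and u: "continuous_on (S \<times> UNIV) (\<lambda>z. U (fst z) (snd z))"
    and v: "continuous_on (S \<times> UNIV) (\<lambda>z. V (fst z) (snd z))"
  shows "continuous_on (S \<times> (UNIV :: 'e set)) (\<lambda>z. local_form A b c (U (fst z) (snd z)) (V (fst z) (snd z)) (fst z))"
proof -
  have cC: "Ck_chart A 1 c" by (rule Ck_chart_atlas[OF c])
  have cont: "continuous_on (chart_map c ` chart_dom c) (local_form A b c i j)" for i j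
    using b c unfolding smooth_bilinear_field_def smooth_on_def by (metis Ck_on.simps(1))
  have cont': "continuous_on (S \<times> (UNIV :: 'e set)) (\<lambda>z. local_form A b c i j (fst z))" for i j
    by (rule continuous_on_compose2[OF cont continuous_on_fst[OF continuous_on_id]]) (use S in auto)
  have "continuous_on (S \<times> (UNIV :: 'e set)) (\<lambda>z. \<Sum>i\<in>Basis. \<Sum>j\<in>Basis.
      (U (fst z) (snd z) \<bullet> i) * (V (fst z) (snd z) \<bullet> j) * local_form A b c i j (fst z))"
    by (intro continuous_intros cont' u v)
  moreover have "local_form A b c (U (fst z) (snd z)) (V (fst z) (snd z)) (fst z) = (\<Sum>i\<in>Basis. \<Sum>j\<in>Basis.
      (U (fst z) (snd z) \<bullet> i) * (V (fst z) (snd z) \<bullet> j) * local_form A b c i j (fst z))"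
    if "z \<in> S \<times> (UNIV :: 'e set)" for z
    by (rule bilinear_sum_Basis[OF bilinear_local_form[OF _ cC]])
      (use b that S in \<open>auto simp: smooth_bilinear_field_def\<close>)
  ultimately show ?thesis by (simp cong: continuous_on_cong)
qed

lemma metric_coord_bounds:
  assumes g: "riemannian_metric A g"
  obtains U k K where "open U" "p \<in> U" "U \<subseteq> chart_dom (chart_at A p)" "k > 0" "K > 0"
    "\<And>q v. q \<in> U \<Longrightarrow> norm (coord A (chart_at A p) q v) \<le> k * riem_norm g q v"
    "\<And>q v. q \<in> U \<Longrightarrow> riem_norm g q v \<le> K * norm (coord A (chart_at A p) q v)"
proof -
  let ?c = "chart_at A p"
  have cA: "?c \<in> A" "p \<in> chart_dom ?c" by (rule chart_at)+
  have cC: "Ck_chart A 1 ?c" by (rule Ck_chart_atlas[OF cA(1)])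
  have b: "smooth_bilinear_field A g" "\<And>p. bilinear (g p)" and pos: "\<And>p v. v \<noteq> 0 \<Longrightarrow> g p v v > 0"
    using g by (auto simp: riemannian_metric_def smooth_bilinear_field_def)
  let ?S = "chart_map ?c ` chart_dom ?c"
  let ?Q = "\<lambda>x v. local_form A g ?c v v x"
  have bl: "bilinear (\<lambda>u v. local_form A g ?c u v x)" if "x \<in> ?S" for x
    by (rule bilinear_local_form[OF b(2) cC that])
  obtain e k K where e: "e > 0" "k > 0" "ball (chart_map ?c p) e \<subseteq> ?S"
    and kK: "\<And>x v. x \<in> ball (chart_map ?c p) e \<Longrightarrow> k * (norm v)^2 \<le> ?Q x v"
    "\<And>x v. x \<in> ball (chart_map ?c p) e \<Longrightarrow> ?Q x v \<le> K * (norm v)^2"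
  proof (rule quadratic_bounds[of ?S "chart_map ?c p" ?Q])
    show "open ?S" using is_chart_at by (simp add: is_chart_def)
    show "chart_map ?c p \<in> ?S" using cA by auto
    show "continuous_on (?S \<times> UNIV) (\<lambda>z. ?Q (fst z) (snd z))"
      by (rule continuous_local_form_along[OF b(1) cA(1)]) (auto intro: continuous_intros)
    show "?Q x (t *\<^sub>R v) = t^2 * ?Q x v" if "x \<in> ?S" for x t v
      using bilinear_lmul[OF bl[OF that]] bilinear_rmul[OF bl[OF that]] by (simp add: power2_eq_square)
    fix x v assume x: "x \<in> ?S" and v: "v \<noteq> (0::'e)"
    have "coord_inv A ?c (chart_inv ?c x) v \<noteq> 0"
      using coord_coord_inv(1)[OF cC chart_inv_in_dom[OF is_chart_at x], of v] v
        linear_0[OF linear_coord(1)[OF cC chart_inv_in_dom[OF is_chart_at x]]] by metis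
    then show "?Q x v > 0" using pos by (simp add: local_form_def)
  qed (rule that)
  let ?U = "chart_dom ?c \<inter> chart_map ?c -` ball (chart_map ?c p) e"
  \<comment> \<open>Square roots of the two bounds of the quadratic form; the absolute value of
    \<open>K\<close> plus 1 is positive whatever the sign of \<open>K\<close>.\<close>
  show ?thesis
  proof (rule that[of ?U "1 / sqrt k" "sqrt (\<bar>K\<bar> + 1)"])
    show "open ?U" by (intro open_chart_preimage is_chart_at open_ball)
    show "p \<in> ?U" using e cA by simp
    fix q v assume q: "q \<in> ?U"
    have eq: "?Q (chart_map ?c q) (coord A ?c q v) = g q v v" using q by (intro local_form_coord[OF cC]) auto
    have "k * (norm (coord A ?c q v))^2 \<le> g q v v" using kK(1)[of "chart_map ?c q"] q eq by (metis IntD2 vimageD)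
    then have "sqrt (k * (norm (coord A ?c q v))^2) \<le> riem_norm g q v" by (simp add: riem_norm_def)
    then show "norm (coord A ?c q v) \<le> 1 / sqrt k * riem_norm g q v"
      using e by (simp add: real_sqrt_mult field_simps)
    have "g q v v \<le> K * (norm (coord A ?c q v))^2" using kK(2)[of "chart_map ?c q"] q eq by (metis IntD2 vimageD)
    also have "\<dots> \<le> (\<bar>K\<bar> + 1) * (norm (coord A ?c q v))^2" by (intro mult_right_mono) auto
    finally have "riem_norm g q v \<le> sqrt ((\<bar>K\<bar> + 1) * (norm (coord A ?c q v))^2)" by (simp add: riem_norm_def)
    then show "riem_norm g q v \<le> sqrt (\<bar>K\<bar> + 1) * norm (coord A ?c q v)" by (simp add: real_sqrt_mult)
  qed (use e in auto)
qed

lemma form_bound: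
  assumes comp: "compact (UNIV :: 'm set)" and g: "riemannian_metric A g" and b: "smooth_bilinear_field A b"
  obtains K where "K > 0" "\<And>q u v. \<bar>b q u v\<bar> \<le> K * (riem_norm g q u * riem_norm g q v)"
proof -
  have nn: "riem_norm g q v \<ge> 0" for q v
    using g bilinear_lzero[of "g q"]
    by (cases "v = 0") (auto simp: riem_norm_def riemannian_metric_def smooth_bilinear_field_def intro: less_imp_le)
  have bil: "\<And>p. bilinear (b p)" using b by (auto simp: smooth_bilinear_field_def)
  obtain K where K: "\<And>q. \<forall>u v. \<bar>b q u v\<bar> \<le> K * (riem_norm g q u * riem_norm g q v)"
  proof (rule compact_uniform_bound[OF comp])
    fix p
    let ?c = "chart_at A p"
    have cA: "?c \<in> A" "p \<in> chart_dom ?c" by (rule chart_at)+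
    have cC: "Ck_chart A 1 ?c" by (rule Ck_chart_atlas[OF cA(1)])
    let ?S = "chart_map ?c ` chart_dom ?c"
    obtain U k where U: "open U" "p \<in> U" "U \<subseteq> chart_dom ?c" "k > 0"
      "\<And>q v. q \<in> U \<Longrightarrow> norm (coord A ?c q v) \<le> k * riem_norm g q v"
      using metric_coord_bounds[OF g, of p] by metis
    define s where "s x = (\<Sum>i\<in>Basis. \<Sum>j\<in>Basis. \<bar>local_form A b ?c i j x\<bar>)" for x
    have opS: "open ?S" using is_chart_at by (simp add: is_chart_def)
    have cont: "continuous_on ?S (local_form A b ?c i j)" for i j
      using b cA(1) unfolding smooth_bilinear_field_def smooth_on_def by (metis Ck_on.simps(1))
    have sc: "continuous_on ?S s" unfolding s_def by (intro continuous_intros cont)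
    \<comment> \<open>The summand 1 leaves room: by continuity \<open>s\<close> stays below
      \<open>M\<close> on a neighbourhood of \<open>p\<close>.\<close>
    define M where "M = s (chart_map ?c p) + 1"
    have "s x \<ge> 0" for x unfolding s_def by (intro sum_nonneg) auto
    then have M: "M > 0" by (simp add: M_def add_nonneg_pos)
    have "open (?S \<inter> s -` {..<M})" by (intro continuous_open_preimage sc opS) auto
    then have op: "open (chart_dom ?c \<inter> chart_map ?c -` (?S \<inter> s -` {..<M}))" by (rule open_chart_preimage[OF is_chart_at])
    have bd: "\<bar>b q u v\<bar> \<le> (M * k^2) * (riem_norm g q u * riem_norm g q v)"
      if q: "q \<in> U" "s (chart_map ?c q) < M" for q u v
    proof -
      define u' v' where "u' = coord A ?c q u" and "v' = coord A ?c q v"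
      have qd: "q \<in> chart_dom ?c" using q U by auto
      have "b q u v = local_form A b ?c u' v' (chart_map ?c q)"
        using local_form_coord[OF cC qd] by (simp add: u'_def v'_def)
      also have "\<dots> = (\<Sum>i\<in>Basis. \<Sum>j\<in>Basis. (u' \<bullet> i) * (v' \<bullet> j) * local_form A b ?c i j (chart_map ?c q))"
        by (rule bilinear_sum_Basis[OF bilinear_local_form[OF bil cC]]) (use qd in auto)
      also have "\<bar>\<dots>\<bar> \<le> (\<Sum>i\<in>Basis. \<Sum>j\<in>Basis. (norm u' * norm v') * \<bar>local_form A b ?c i j (chart_map ?c q)\<bar>)"
        by (intro order_trans[OF sum_abs] sum_mono)
          (auto simp: abs_mult intro!: mult_right_mono mult_mono Basis_le_norm)
      also have "\<dots> = (norm u' * norm v') * s (chart_map ?c q)" by (simp add: s_def sum_distrib_left)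
      also have "\<dots> \<le> ((k * riem_norm g q u) * (k * riem_norm g q v)) * M"
        using U(4,5) q M nn by (intro mult_mono) (auto simp: u'_def v'_def \<open>\<And>x. s x \<ge> 0\<close>)
      finally show ?thesis by (simp add: power2_eq_square mult_ac)
    qed
    show "\<exists>U K. open U \<and> p \<in> U \<and> (\<forall>q\<in>U. \<forall>u v. \<bar>b q u v\<bar> \<le> K * (riem_norm g q u * riem_norm g q v))"
    proof (intro exI conjI ballI allI)
      let ?V = "U \<inter> (chart_dom ?c \<inter> chart_map ?c -` (?S \<inter> s -` {..<M}))"
      show "open ?V" using U(1) op by blast
      show "p \<in> ?V" using U(2) cA by (simp add: M_def)
      fix q u v assume "q \<in> ?V"
      then show "\<bar>b q u v\<bar> \<le> (M * k^2) * (riem_norm g q u * riem_norm g q v)" by (intro bd) auto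
    qed
  next
    fix q K K' assume "\<forall>u v. \<bar>b q u v\<bar> \<le> K * (riem_norm g q u * riem_norm g q v)" "K \<le> (K' :: real)"
    then show "\<forall>u v. \<bar>b q u v\<bar> \<le> K' * (riem_norm g q u * riem_norm g q v)"
      using nn by (meson mult_nonneg_nonneg mult_right_mono order_trans)
  qed (rule that)
  show ?thesis
  proof (rule that[of "\<bar>K\<bar> + 1"])
    fix q u v
    have "K * (riem_norm g q u * riem_norm g q v) \<le> (\<bar>K\<bar> + 1) * (riem_norm g q u * riem_norm g q v)"
      using nn by (intro mult_right_mono) auto
    then show "\<bar>b q u v\<bar> \<le> (\<bar>K\<bar> + 1) * (riem_norm g q u * riem_norm g q v)" using K by (meson order_trans)
  qed auto
qed

text \<open>The frame is restricted to a neighbourhood where its norms are bounded, so that division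
  by a constant turns its members into test vectors of norm at most 1.\<close>

lemma subbundle_local_frame:
  assumes g: "riemannian_metric A g" and E: "Ck_subbundle A k E"
  obtains U r X M where "open U" "p \<in> U" "U \<subseteq> chart_dom (chart_at A p)" "r = dim (E p)"
    "\<And>i. i < r \<Longrightarrow> Ck_on k (\<lambda>x. coord A (chart_at A p) (chart_inv (chart_at A p) x) (X i (chart_inv (chart_at A p) x)))
       (chart_map (chart_at A p) ` U)"
    "\<And>q. q \<in> U \<Longrightarrow> span ((\<lambda>i. X i q) ` {..<r}) = E q" "\<And>q. q \<in> U \<Longrightarrow> dim (E q) = r"
    "M > 0" "\<And>q i. q \<in> U \<Longrightarrow> i < r \<Longrightarrow> riem_norm g q (X i q) \<le> M"
proof -
  let ?c = "chart_at A p"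
  have cA: "?c \<in> A" "p \<in> chart_dom ?c" by (rule chart_at)+
  from E[unfolded Ck_subbundle_def, rule_format, of p]
  obtain U r and X :: "nat \<Rightarrow> 'm \<Rightarrow> 'e" where "open U \<and> p \<in> U \<and> (\<forall>i<r. Ck_vector_field_on A k U (X i)) \<and>
    (\<forall>q\<in>U. span ((\<lambda>i. X i q) ` {..<r}) = E q \<and> dim (E q) = r)"
    by blast
  then have U: "open U" "p \<in> U" "\<forall>i<r. Ck_vector_field_on A k U (X i)"
    "\<forall>q\<in>U. span ((\<lambda>i. X i q) ` {..<r}) = E q \<and> dim (E q) = r" by simp_all
  obtain U' K where U': "open U'" "p \<in> U'" "U' \<subseteq> chart_dom ?c" "K > 0"
    "\<And>q v. q \<in> U' \<Longrightarrow> riem_norm g q v \<le> K * norm (coord A ?c q v)"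
    using metric_coord_bounds[OF g, of p] by metis
  define Z where "Z i x = coord A ?c (chart_inv ?c x) (X i (chart_inv ?c x))" for i x
  have Z: "Ck_on k (Z i) (chart_map ?c ` (chart_dom ?c \<inter> U))" if "i < r" for i
    using U(3) that cA(1) by (auto simp: Ck_vector_field_on_def Z_def[abs_def])
  let ?O = "chart_map ?c ` (chart_dom ?c \<inter> U)"
  have opO: "open ?O" by (rule open_chart_image[OF is_chart_at U(1)])
  define s where "s x = (\<Sum>i<r. norm (Z i x))" for x
  have sc: "continuous_on ?O s" unfolding s_def
    using Ck_on_le[OF Z, of _ 0] by (intro continuous_intros) auto
  define M where "M = s (chart_map ?c p) + 1"
  have "s x \<ge> 0" for x unfolding s_def by (intro sum_nonneg) auto
  then have M: "M > 0" by (simp add: M_def add_nonneg_pos)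
  have "open (?O \<inter> s -` {..<M})" by (intro continuous_open_preimage sc opO) auto
  then have op: "open (chart_dom ?c \<inter> chart_map ?c -` (?O \<inter> s -` {..<M}))" by (rule open_chart_preimage[OF is_chart_at])
  define U'' where "U'' = U \<inter> U' \<inter> (chart_dom ?c \<inter> chart_map ?c -` (?O \<inter> s -` {..<M}))"
  show ?thesis
  proof (rule that[of U'' r X "K * M"])
    show "open U''" unfolding U''_def using op U U' by auto
    show "p \<in> U''" using U U' cA by (auto simp: U''_def M_def)
    show "U'' \<subseteq> chart_dom ?c" by (auto simp: U''_def)
    show "r = dim (E p)" using U by auto
    show "Ck_on k (\<lambda>x. coord A ?c (chart_inv ?c x) (X i (chart_inv ?c x))) (chart_map ?c ` U'')" if "i < r" for i
    proof -
      have "Ck_on k (Z i) (chart_map ?c ` U'')" by (rule Ck_on_subset[OF Z[OF that]]) (auto simp: U''_def)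
      then show ?thesis by (simp add: Z_def[abs_def])
    qed
    show "K * M > 0" using M U' by simp
    fix q assume q: "q \<in> U''"
    then show "span ((\<lambda>i. X i q) ` {..<r}) = E q" "dim (E q) = r" using U by (auto simp: U''_def)
    fix i assume i: "i < r"
    have "norm (Z i (chart_map ?c q)) \<le> s (chart_map ?c q)" unfolding s_def
      using i by (intro member_le_sum) auto
    then have "norm (coord A ?c q (X i q)) \<le> M" using q chart_inv_map[OF is_chart_at, of q p] by (auto simp: Z_def U''_def)
    then have "K * norm (coord A ?c q (X i q)) \<le> K * M" using U' by simp
    then show "riem_norm g q (X i q) \<le> K * M" using U'(5)[of q "X i q"] q by (auto simp: U''_def)
  qed
qed

end

section \<open>Symplectic splittings with uniform rates\<close>

lemma riem_norm_pos: "riemannian_metric A g \<Longrightarrow> v \<noteq> 0 \<Longrightarrow> riem_norm g p v > 0"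
  by (auto simp: riem_norm_def riemannian_metric_def)

lemma riem_norm_scaleR:
  assumes "riemannian_metric A g" shows "riem_norm g p (t *\<^sub>R v) = \<bar>t\<bar> * riem_norm g p v"
proof -
  have "bilinear (g p)" using assms by (auto simp: riemannian_metric_def smooth_bilinear_field_def)
  from bilinear_lmul[OF this] bilinear_rmul[OF this] show ?thesis
    by (simp add: riem_norm_def real_sqrt_mult mult.assoc[symmetric])
qed

lemma funpow_left_inverse:
  fixes h k :: "'b \<Rightarrow> 'b"
  assumes "\<And>x. k (h x) = x" shows "(k ^^ n) ((h ^^ n) x) = x"
proof (induction n)
  case (Suc n)
  have "(k ^^ Suc n) ((h ^^ Suc n) x) = (k ^^ n) (k (h ((h ^^ n) x)))"
    by (simp only: funpow_Suc_right[of n k] funpow.simps(2)[of n h] o_apply)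
  then show ?case using assms Suc by simp
qed simp

lemma (in atlas) tangent_map_funpow_inverse:
  assumes h: "Ck_map A 1 h" and k: "Ck_map A 1 k" and inv: "\<And>x. k (h x) = x"
  shows "tangent_map A (k ^^ n) ((h ^^ n) p) (tangent_map A (h ^^ n) p v) = v"
proof -
  have kh: "(k ^^ n) ((h ^^ n) x) = x" for x by (rule funpow_left_inverse[of k h, OF inv])
  obtain L where L: "has_tangent (h ^^ n) p L" using has_tangent_funpow[OF h] by blast
  obtain K where K: "has_tangent (k ^^ n) ((h ^^ n) p) K" using has_tangent_funpow[OF k] by blast
  have "has_tangent (\<lambda>x. x) p (\<lambda>v. K (L v))" using has_tangent_compose[OF L K] kh by simp
  then have "(\<lambda>v. v) = (\<lambda>v. K (L v))" using has_tangent_tangent_map tangent_map_id by metis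
  then show ?thesis using has_tangent_tangent_map[OF L] has_tangent_tangent_map[OF K] by metis
qed

text \<open>The splitting and the rates are stated in a form that is symmetric under exchanging
  \<open>f\<close> with its inverse \<open>h\<close> and \<open>Es\<close> with \<open>Eu\<close>.\<close>

locale symplectic_splitting = atlas A for A :: "('m::t2_space, 'e::euclidean_space) chart set" +
  fixes g w :: "'m \<Rightarrow> 'e \<Rightarrow> 'e \<Rightarrow> real" and f h :: "'m \<Rightarrow> 'm" and Es Ec Eu :: "'m \<Rightarrow> 'e set"
    and lam C :: real
  assumes comp: "compact (UNIV :: 'm set)" and metric: "riemannian_metric A g" and symplectic: "symplectic_form A w"
    and f2: "Ck_map A 2 f" and h2: "Ck_map A 2 h" and hf: "\<And>x. h (f x) = x" and fh: "\<And>x. f (h x) = x"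
    and pull: "\<And>p u v. w (f p) (tangent_map A f p u) (tangent_map A f p v) = w p u v"
    and cont: "Ck_subbundle A 0 Es" "Ck_subbundle A 0 Ec" "Ck_subbundle A 0 Eu"
    and decomp: "\<And>p v. \<exists>a\<in>Es p. \<exists>b\<in>Ec p. \<exists>c\<in>Eu p. v = a + b + c"
    and inv: "\<And>p. tangent_map A f p ` Es p = Es (f p)" "\<And>p. tangent_map A f p ` Ec p = Ec (f p)"
      "\<And>p. tangent_map A f p ` Eu p = Eu (f p)"
    and lam: "0 < lam" "lam < 1" and C: "1 \<le> C"
    and contr: "\<And>n p X. 1 \<le> n \<Longrightarrow> X \<in> Es p \<Longrightarrow>
       riem_norm g ((f ^^ n) p) (tangent_map A (f ^^ n) p X) \<le> C * lam ^ n * riem_norm g p X"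
    and expand: "\<And>n p X. 1 \<le> n \<Longrightarrow> X \<in> Eu p \<Longrightarrow>
       riem_norm g p X \<le> C * lam ^ n * riem_norm g ((f ^^ n) p) (tangent_map A (f ^^ n) p X)"
    and dom_sc: "\<And>n p X Y. 1 \<le> n \<Longrightarrow> X \<in> Es p \<Longrightarrow> Y \<in> Ec p \<Longrightarrow>
       riem_norm g ((f ^^ n) p) (tangent_map A (f ^^ n) p X) * riem_norm g p Y
         \<le> C * lam ^ n * (riem_norm g p X * riem_norm g ((f ^^ n) p) (tangent_map A (f ^^ n) p Y))"
    and dom_cu: "\<And>n p X Y. 1 \<le> n \<Longrightarrow> X \<in> Ec p \<Longrightarrow> Y \<in> Eu p \<Longrightarrow>
       riem_norm g ((f ^^ n) p) (tangent_map A (f ^^ n) p X) * riem_norm g p Y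
         \<le> C * lam ^ n * (riem_norm g p X * riem_norm g ((f ^^ n) p) (tangent_map A (f ^^ n) p Y))"
    and dim_s: "\<And>p. dim (Es p) = 1" and dim_c: "\<And>p. dim (Ec p) = 2" and dim_u: "\<And>p. dim (Eu p) = 1"
    and C1_s: "Ck_subbundle A 1 Es" and C1_u: "Ck_subbundle A 1 Eu"
begin

abbreviation nrm :: "'m \<Rightarrow> 'e \<Rightarrow> real" where "nrm \<equiv> riem_norm g"
abbreviation T :: "nat \<Rightarrow> 'm \<Rightarrow> 'e \<Rightarrow> 'e" where "T n p \<equiv> tangent_map A (f ^^ n) p"

lemma f1: "Ck_map A 1 f" and h1: "Ck_map A 1 h"
  using Ck_map_le[OF f2] Ck_map_le[OF h2] by simp_all

lemma w_smooth: "smooth_bilinear_field A w" and w_bilinear: "bilinear (w p)" and w_alt: "w p v v = 0"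
  using symplectic
  by (auto simp: symplectic_form_def closed_two_form_def two_form_def smooth_bilinear_field_def)

lemma w_nondeg: "(\<And>v. w p u v = 0) \<Longrightarrow> u = 0"
  using symplectic unfolding symplectic_form_def by blast

lemma w_skew: "w p u v = - w p v u"
  using w_alt[of p "u + v"] w_alt[of p u] w_alt[of p v]
    bilinear_ladd[OF w_bilinear, of p u v "u + v"] bilinear_radd[OF w_bilinear, of p u u v]
    bilinear_radd[OF w_bilinear, of p v u v] by simp

lemmas nrm_pos = riem_norm_pos[OF metric] and nrm_scaleR = riem_norm_scaleR[OF metric]

lemma nrm_0 [simp]: "nrm p 0 = 0"
  using nrm_scaleR[of p 0 0] by simp

lemma nrm_nonneg: "nrm p v \<ge> 0"
  by (cases "v = 0") (auto intro: less_imp_le nrm_pos)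

lemma subspace_subbundle: "Ck_subbundle A k E \<Longrightarrow> subspace (E p)"
  unfolding Ck_subbundle_def by (metis subspace_span)

lemma w_T: "w ((f ^^ n) p) (T n p u) (T n p v) = w p u v"
proof (induction n)
  case 0
  then show ?case using tangent_map_id by (simp add: id_def)
next
  case (Suc n)
  show ?case unfolding tangent_map_funpow_Suc[OF f1] using Suc pull by simp
qed

lemma T_image:
  assumes "\<And>p. tangent_map A f p ` E p = E (f p)" shows "T n p ` E p = E ((f ^^ n) p)"
proof (induction n)
  case 0
  then show ?case using tangent_map_id by (simp add: id_def)
next
  case (Suc n)
  have "T (Suc n) p ` E p = tangent_map A f ((f ^^ n) p) ` T n p ` E p"
    unfolding tangent_map_funpow_Suc[OF f1] image_image ..
  also have "\<dots> = tangent_map A f ((f ^^ n) p) ` E ((f ^^ n) p)" using Suc by simp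
  also have "\<dots> = E ((f ^^ Suc n) p)" using assms by simp
  finally show ?case .
qed

section \<open>Orthogonality of the center bundle to the line bundles\<close>

lemma line_multiple:
  assumes "dim (E :: 'e set) = 1" "subspace E" "Z \<in> E" "Z \<noteq> 0" "X \<in> E"
  obtains t where "X = t *\<^sub>R Z"
proof -
  have "span {Z} = E"
    using assms dim_eq_span[of "{Z}" E] by (simp add: dim_insert span_eq_iff)
  then show ?thesis using assms(5) that by (auto simp: span_singleton)
qed

lemma nonzero_in_line: assumes "dim (E :: 'e set) = 1" obtains Z where "Z \<in> E" "Z \<noteq> 0"
  using assms by (metis dim_eq_0 subset_iff singleton_iff zero_neq_one)

text \<open>Nondegeneracy is quantified with test vectors from the invariant bundles, so that a test
  vector can be pulled back along the orbit inside its bundle. The sum of the squares of the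
  pairings with local frames of the three bundles is a positive definite quadratic form, and one of
  its terms must be comparable to the whole.\<close>

lemma uniform_nondegenerate:
  obtains c where "c > 0"
    "\<And>q v. \<exists>W\<in>Es q \<union> Ec q \<union> Eu q. nrm q W \<le> 1 \<and> c * nrm q v \<le> \<bar>w q v W\<bar>"
proof -
  define E where "E k = (if k = 0 then Es else if k = 1 then Ec else Eu)" for k :: nat
  have E: "Ck_subbundle A 0 (E k)" for k using cont by (simp add: E_def)
  have EU: "E k q \<subseteq> Es q \<union> Ec q \<union> Eu q" for k q by (auto simp: E_def)
  obtain K where K: "\<And>q. \<forall>v. \<exists>W\<in>Es q \<union> Ec q \<union> Eu q. nrm q W \<le> 1 \<and> nrm q v \<le> K * \<bar>w q v W\<bar>"
  proof (rule compact_uniform_bound[OF comp])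
    fix p
    let ?c = "chart_at A p"
    have cA: "?c \<in> A" "p \<in> chart_dom ?c" by (rule chart_at)+
    have cC: "Ck_chart A 1 ?c" by (rule Ck_chart_atlas[OF cA(1)])
    define P where "P k U r X M \<longleftrightarrow> open U \<and> p \<in> U \<and> U \<subseteq> chart_dom ?c \<and>
      (\<forall>i<r. continuous_on (chart_map ?c ` U) (\<lambda>x. coord A ?c (chart_inv ?c x) (X i (chart_inv ?c x)))) \<and>
      (\<forall>q\<in>U. span ((\<lambda>i. X i q) ` {..<r}) = E k q) \<and> M > 0 \<and> (\<forall>q\<in>U. \<forall>i<(r::nat). nrm q (X i q) \<le> M)"
      for k U r X M
    have "\<exists>U r X M. P k U r X M" for k
    proof (rule subbundle_local_frame[OF metric E, of p k])
      fix U r X M assume "open U" "p \<in> U" "U \<subseteq> chart_dom ?c" "r = dim (E k p)"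
        "\<And>i. i < r \<Longrightarrow> Ck_on 0 (\<lambda>x. coord A ?c (chart_inv ?c x) (X i (chart_inv ?c x))) (chart_map ?c ` U)"
        "\<And>q. q \<in> U \<Longrightarrow> span ((\<lambda>i. X i q) ` {..<r}) = E k q"
        "M > 0" "\<And>q i. q \<in> U \<Longrightarrow> i < r \<Longrightarrow> nrm q (X i q) \<le> M"
      then have "P k U r X M" by (simp add: P_def)
      then show ?thesis by blast
    qed
    then obtain U r X M where P: "\<And>k. P k (U k) (r k) (X k) (M k)" by metis
    have U: "\<And>k. open (U k)" "\<And>k. p \<in> U k" "\<And>k. U k \<subseteq> chart_dom ?c"
      and Xc: "\<And>k i. i < r k \<Longrightarrow> continuous_on (chart_map ?c ` U k) (\<lambda>x. coord A ?c (chart_inv ?c x) (X k i (chart_inv ?c x)))"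
      and Xs: "\<And>k q. q \<in> U k \<Longrightarrow> span ((\<lambda>i. X k i q) ` {..<r k}) = E k q"
      and M: "\<And>k. M k > 0" "\<And>k q i. q \<in> U k \<Longrightarrow> i < r k \<Longrightarrow> nrm q (X k i q) \<le> M k"
      using P unfolding P_def by blast+
    obtain U' L where U': "open U'" "p \<in> U'" "U' \<subseteq> chart_dom ?c" "L > 0"
      "\<And>q v. q \<in> U' \<Longrightarrow> nrm q v \<le> L * norm (coord A ?c q v)"
      using metric_coord_bounds[OF metric, of p] by metis
    define V where "V = U' \<inter> U 0 \<inter> U 1 \<inter> U 2"
    have VU: "V \<subseteq> U k" if "k < 3" for k
      using that by (auto simp: V_def numeral_3_eq_3 less_Suc_eq numeral_2_eq_2)
    have V: "open V" "p \<in> V" "V \<subseteq> chart_dom ?c" using U U' by (auto simp: V_def)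
    define S where "S = chart_map ?c ` V"
    have opS: "open S" using open_chart_image[OF is_chart_at V(1), of p] V(3) by (simp add: S_def Int_absorb1)
    define Z where "Z k i x = coord A ?c (chart_inv ?c x) (X k i (chart_inv ?c x))" for k i x
    \<comment> \<open>The frames of the three bundles together span the tangent space, so by
      nondegeneracy \<open>Q\<close> vanishes on no nonzero vector.\<close>
    define Q where "Q x v = (\<Sum>k<3. \<Sum>i<r k. (local_form A w ?c v (Z k i x) x)^2)" for x v
    have Sd: "S \<subseteq> chart_map ?c ` chart_dom ?c" using V by (auto simp: S_def)
    have Qeq: "Q (chart_map ?c q) (coord A ?c q v) = (\<Sum>k<3. \<Sum>i<r k. (w q v (X k i q))^2)" if "q \<in> V" for q v
      using that V(3) local_form_coord[OF cC] chart_inv_map[OF is_chart_at] by (auto simp: Q_def Z_def)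
    have zero: "v = 0" if q: "q \<in> V" and v: "\<And>k i. k < 3 \<Longrightarrow> i < r k \<Longrightarrow> w q v (X k i q) = 0" for q v
    proof (rule w_nondeg)
      have *: "w q v u = 0" if "k < 3" "u \<in> E k q" for u k
      proof -
        have "u \<in> span ((\<lambda>i. X k i q) ` {..<r k})" using Xs VU[OF that(1)] q that(2) by blast
        then show ?thesis
        proof (rule span_induct)
          show "subspace {u. w q v u = 0}"
            using w_bilinear[of q] by (simp add: subspace_def bilinear_rzero bilinear_radd bilinear_rmul)
        qed (use v that in auto)
      qed
      fix u
      obtain a b c where "a \<in> Es q" "b \<in> Ec q" "c \<in> Eu q" "u = a + b + c" using decomp by blast
      then show "w q v u = 0" using *[of 0 a] *[of 1 b] *[of 2 c]
        by (simp add: E_def bilinear_radd[OF w_bilinear])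
    qed
    obtain e k0 where e: "e > 0" "k0 > 0" "ball (chart_map ?c p) e \<subseteq> S"
      and k0: "\<And>x v. x \<in> ball (chart_map ?c p) e \<Longrightarrow> k0 * (norm v)^2 \<le> Q x v"
    proof (rule quadratic_bounds[of S "chart_map ?c p" Q])
      show "chart_map ?c p \<in> S" using V by (simp add: S_def)
      have "continuous_on (S \<times> UNIV) (\<lambda>z. local_form A w ?c (snd z) (Z k i (fst z)) (fst z))" if "k < 3" "i < r k" for k i
      proof (rule continuous_local_form_along[OF w_smooth cA(1) Sd, where U="\<lambda>x v. v" and V="\<lambda>x v. Z k i x"])
        have "continuous_on S (Z k i)" unfolding Z_def[abs_def]
          by (rule continuous_on_subset[OF Xc[OF that(2)]]) (use VU[OF that(1)] in \<open>auto simp: S_def\<close>)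
        then show "continuous_on (S \<times> UNIV) (\<lambda>z. Z k i (fst z))"
          by (rule continuous_on_compose2[OF _ continuous_on_fst[OF continuous_on_id]]) auto
      qed (intro continuous_intros)
      then show "continuous_on (S \<times> UNIV) (\<lambda>z. Q (fst z) (snd z))" unfolding Q_def
        by (intro continuous_intros) auto
      fix x v assume x: "x \<in> S"
      show "Q x (t *\<^sub>R v) = t^2 * Q x v" for t
        using bilinear_lmul[OF bilinear_local_form[OF w_bilinear cC], of x] x Sd
        by (auto simp: Q_def power_mult_distrib sum_distrib_left)
      assume v: "v \<noteq> 0"
      obtain q where q: "q \<in> V" "x = chart_map ?c q" using x by (auto simp: S_def)
      have qd: "q \<in> chart_dom ?c" using q V by auto
      define u where "u = coord_inv A ?c q v"
      have uv: "coord A ?c q u = v" using coord_coord_inv(1)[OF cC qd] by (simp add: u_def)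
      have Q0: "Q x v = (\<Sum>k<3. \<Sum>i<r k. (w q u (X k i q))^2)" using Qeq[OF q(1), of u] uv q(2) by simp
      have "Q x v \<noteq> 0"
      proof
        assume "Q x v = 0"
        then have "\<forall>k<3. \<forall>i<r k. w q u (X k i q) = 0"
          unfolding Q0 by (subst (asm) sum_nonneg_eq_0_iff) (auto simp: sum_nonneg sum_nonneg_eq_0_iff)
        then have "u = 0" using zero[OF q(1)] by blast
        then show False using uv v linear_0[OF linear_coord(1)[OF cC qd]] by simp
      qed
      moreover have "Q x v \<ge> 0" unfolding Q_def by (intro sum_nonneg) auto
      ultimately show "Q x v > 0" by simp
    qed (use opS in \<open>auto intro: that\<close>)
    \<comment> \<open>\<open>R\<close> counts the frame vectors. If all pairings were smaller than
      the norm of \<open>v\<close> divided by \<open>B\<close>, then \<open>Q\<close> would be at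
      most k0 R / (R + 1) times the squared coordinate norm, strictly below its lower bound; this is
      what R + 1 in the definition of \<open>B\<close> is for.\<close>
    define R where "R = (\<Sum>k<3. \<Sum>i<r k. 1 :: real)"
    have R: "R \<ge> 0" unfolding R_def by (intro sum_nonneg) auto
    define B where "B = sqrt ((R + 1) * L^2 / k0)"
    have B: "B > 0" "B^2 = (R + 1) * L^2 / k0" using R U'(4) e(2) by (auto simp: B_def)
    define MM where "MM = M 0 + M 1 + M 2"
    have MM: "M k \<le> MM" if "k < 3" for k
      using that M(1)[of 0] M(1)[of 1] M(1)[of 2]
      by (auto simp: MM_def numeral_3_eq_3 less_Suc_eq numeral_2_eq_2)
    have MM0: "MM > 0" using M(1)[of 0] MM[of 0] by simp
    have key: "\<exists>W\<in>Es q \<union> Ec q \<union> Eu q. nrm q W \<le> 1 \<and> nrm q v \<le> B * MM * \<bar>w q v W\<bar>"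
      if q: "q \<in> V" "chart_map ?c q \<in> ball (chart_map ?c p) e" for q v
    proof (cases "v = 0")
      case True
      then show ?thesis using subspace_0[OF subspace_subbundle[OF cont(1)], of q] bilinear_lzero[OF w_bilinear]
        by (intro bexI[of _ 0]) auto
    next
      case False
      have qd: "q \<in> chart_dom ?c" using q V by auto
      have "\<exists>k<3. \<exists>i<r k. nrm q v \<le> B * \<bar>w q v (X k i q)\<bar>"
      proof (rule ccontr)
        assume "\<not> ?thesis"
        then have lt: "B * \<bar>w q v (X k i q)\<bar> < nrm q v" if "k < 3" "i < r k" for k i using that by force
        have sq: "(w q v (X k i q))^2 \<le> (nrm q v)^2 / B^2" if "k < 3" "i < r k" for k i
        proof -
          have "\<bar>w q v (X k i q)\<bar> \<le> nrm q v / B" using lt[OF that] B by (simp add: field_simps)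
          then have "\<bar>w q v (X k i q)\<bar>^2 \<le> (nrm q v / B)^2" by (intro power_mono) auto
          then show ?thesis by (simp add: power_divide)
        qed
        define n where "n = (norm (coord A ?c q v))^2"
        have "coord A ?c q v \<noteq> 0" using False coord_coord_inv(2)[OF cC qd, of v]
          linear_0[OF linear_coord(2)[OF cC qd]] by metis
        then have n: "n > 0" by (simp add: n_def)
        have "k0 * n \<le> (\<Sum>k<3. \<Sum>i<r k. (w q v (X k i q))^2)"
          unfolding Qeq[OF q(1), symmetric] n_def by (rule k0[OF q(2)])
        also have "\<dots> \<le> (\<Sum>k<3. \<Sum>i<r k. (nrm q v)^2 / B^2)" by (intro sum_mono sq) auto
        also have "\<dots> = R * ((nrm q v)^2 / B^2)" by (simp add: R_def sum_distrib_right sum_divide_distrib)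
        also have "\<dots> \<le> R * (L^2 * n / B^2)"
        proof (intro mult_left_mono divide_right_mono R)
          have "nrm q v \<le> L * norm (coord A ?c q v)" using U'(5) q by (simp add: V_def)
          then have "(nrm q v)^2 \<le> (L * norm (coord A ?c q v))^2" by (intro power_mono nrm_nonneg)
          then show "(nrm q v)^2 \<le> L^2 * n" by (simp add: n_def power_mult_distrib)
        qed auto
        finally have le: "k0 * n \<le> R * (L^2 * n / B^2)" .
        have "L^2 * n / (m * L^2 / k0) = k0 * n / m" if "m > 0" for m
          using U'(4) e(2) that by (simp add: field_simps)
        then have "L^2 * n / B^2 = k0 * n / (R + 1)" unfolding B(2) using R by simp
        then have "R * (L^2 * n / B^2) = k0 * n * (R / (R + 1))" by simp
        also have "\<dots> < k0 * n * 1" using e(2) n R by (intro mult_strict_left_mono) auto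
        finally show False using le by simp
      qed
      then obtain k i where ki: "k < 3" "i < r k" "nrm q v \<le> B * \<bar>w q v (X k i q)\<bar>" by blast
      define W where "W = (1 / MM) *\<^sub>R X k i q"
      have qk: "q \<in> U k" using VU[OF ki(1)] q by auto
      have "X k i q \<in> span ((\<lambda>i. X k i q) ` {..<r k})" using ki(2) by (intro span_base) auto
      then have "X k i q \<in> E k q" using Xs[OF qk] by simp
      then have "W \<in> E k q" unfolding W_def using subspace_subbundle[OF E] by (intro subspace_scale)
      moreover have "nrm q W \<le> 1" using M(2)[OF qk ki(2)] MM[OF ki(1)] MM0 by (simp add: W_def nrm_scaleR field_simps)
      moreover have "\<bar>w q v W\<bar> = \<bar>w q v (X k i q)\<bar> / MM"
        using MM0 by (simp add: W_def bilinear_rmul[OF w_bilinear] abs_mult)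
      ultimately show ?thesis using EU ki(3) MM0 by (intro bexI[of _ W]) auto
    qed
    show "\<exists>U K. open U \<and> p \<in> U \<and> (\<forall>q\<in>U. \<forall>v. \<exists>W\<in>Es q \<union> Ec q \<union> Eu q. nrm q W \<le> 1 \<and> nrm q v \<le> K * \<bar>w q v W\<bar>)"
    proof (intro exI conjI ballI allI)
      let ?V = "V \<inter> (chart_dom ?c \<inter> chart_map ?c -` ball (chart_map ?c p) e)"
      show "open ?V" by (intro open_Int V open_chart_preimage is_chart_at open_ball)
      show "p \<in> ?V" using V cA e by simp
      fix q v assume "q \<in> ?V"
      then show "\<exists>W\<in>Es q \<union> Ec q \<union> Eu q. nrm q W \<le> 1 \<and> nrm q v \<le> B * MM * \<bar>w q v W\<bar>" by (intro key) auto
    qed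
  next
    fix q K K' assume "\<forall>v. \<exists>W\<in>Es q \<union> Ec q \<union> Eu q. nrm q W \<le> 1 \<and> nrm q v \<le> K * \<bar>w q v W\<bar>" and "K \<le> (K' :: real)"
    then show "\<forall>v. \<exists>W\<in>Es q \<union> Ec q \<union> Eu q. nrm q W \<le> 1 \<and> nrm q v \<le> K' * \<bar>w q v W\<bar>"
      by (meson abs_ge_zero mult_right_mono order_trans)
  qed (rule that)
  show ?thesis
  proof (rule that[of "1 / (\<bar>K\<bar> + 1)"])
    fix q v
    obtain W where W: "W \<in> Es q \<union> Ec q \<union> Eu q" "nrm q W \<le> 1" "nrm q v \<le> K * \<bar>w q v W\<bar>" using K by blast
    have "K * \<bar>w q v W\<bar> \<le> (\<bar>K\<bar> + 1) * \<bar>w q v W\<bar>" by (intro mult_right_mono) auto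
    then have "1 / (\<bar>K\<bar> + 1) * nrm q v \<le> \<bar>w q v W\<bar>" using W(3) by (simp add: field_simps)
    then show "\<exists>W\<in>Es q \<union> Ec q \<union> Eu q. nrm q W \<le> 1 \<and> 1 / (\<bar>K\<bar> + 1) * nrm q v \<le> \<bar>w q v W\<bar>" using W by blast
  qed simp
qed

text \<open>Nondegeneracy bounds the product of the growth rates along \<open>Es\<close> and \<open>Eu\<close>; as the growth
  along \<open>Ec\<close> is dominated by that along \<open>Eu\<close>, the invariant number \<open>w p Z Y\<close> must vanish.\<close>

lemma stable_center_orthogonal:
  assumes Z: "Z \<in> Es p" and Y: "Y \<in> Ec p" shows "w p Z Y = 0"
proof (cases "Z = 0")
  case True
  then show ?thesis using bilinear_lzero[OF w_bilinear] by simp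
next
  case False
  obtain c where c: "c > 0" "\<And>q v. \<exists>W\<in>Es q \<union> Ec q \<union> Eu q. nrm q W \<le> 1 \<and> c * nrm q v \<le> \<bar>w q v W\<bar>"
    by (rule uniform_nondegenerate) blast
  obtain K where K: "K > 0" "\<And>q u v. \<bar>w q u v\<bar> \<le> K * (nrm q u * nrm q v)"
    by (rule form_bound[OF comp metric w_smooth]) blast
  obtain U where U: "U \<in> Eu p" "U \<noteq> 0" using nonzero_in_line[OF dim_u] by blast
  define N where "N n v = nrm ((f ^^ n) p) (T n p v)" for n v
  have N0: "N n v \<ge> 0" for n v by (simp add: N_def nrm_nonneg)
  have l1: "lam ^ n \<le> 1" "0 \<le> lam ^ n" for n using lam by (auto intro: power_le_one)
  have Cl: "C * lam ^ n \<le> C" for n using l1[of n] C mult_left_mono[of "lam ^ n" 1 C] by simp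
  have CC: "C \<le> C^2" "1 \<le> C^2" using C by (auto simp: power2_eq_square mult_le_cancel_left1 intro: order_trans)
  \<comment> \<open>The product of the growths along \<open>Eu\<close> and \<open>Es\<close> stays
    bounded. The image of \<open>U\<close> pairs well with some \<open>W\<close> of norm at most 1,
    so its size is bounded by the norm of the preimage \<open>W'\<close> of \<open>W\<close>, and
    this norm is in turn at most a constant divided by the growth of \<open>Z\<close>.\<close>
  have main: "c * N n U * N n Z \<le> K * C^2 * (nrm p U * nrm p Z)" if n: "1 \<le> n" for n
  proof -
    obtain W where W: "W \<in> Es ((f ^^ n) p) \<union> Ec ((f ^^ n) p) \<union> Eu ((f ^^ n) p)" "nrm ((f ^^ n) p) W \<le> 1"
      "c * nrm ((f ^^ n) p) (T n p U) \<le> \<bar>w ((f ^^ n) p) (T n p U) W\<bar>" using c(2) by blast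
    obtain W' where W': "W' \<in> Es p \<union> Ec p \<union> Eu p" "W = T n p W'"
      using W(1) T_image[OF inv(1), of n p] T_image[OF inv(2), of n p] T_image[OF inv(3), of n p] by blast
    have NW: "N n W' \<le> 1" using W(2) W'(2) by (simp add: N_def)
    have "c * N n U \<le> \<bar>w p U W'\<bar>" using W(3) w_T[of n p U W'] by (simp add: N_def W'(2))
    also have "\<dots> \<le> K * (nrm p U * nrm p W')" by (rule K(2))
    finally have 1: "c * N n U \<le> K * nrm p U * nrm p W'" by simp
    \<comment> \<open>Up to constants: in \<open>Es\<close> the vector \<open>W'\<close> is a
      multiple of \<open>Z\<close>; in \<open>Ec\<close> it grows faster than \<open>Z\<close> by
      domination; in \<open>Eu\<close> it expands while \<open>Z\<close> contracts.\<close>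
    have 2: "nrm p W' * N n Z \<le> C^2 * nrm p Z"
      using W'(1)
    proof (elim UnE)
      assume "W' \<in> Es p"
      then obtain t where t: "W' = t *\<^sub>R Z"
        using line_multiple[OF dim_s subspace_subbundle[OF cont(1)] Z False] by blast
      have "N n W' = \<bar>t\<bar> * N n Z" unfolding N_def t
        using linear_cmul[OF linear_tangent_map_funpow[OF f1]] by (simp add: nrm_scaleR)
      then have "nrm p W' * N n Z = N n W' * nrm p Z" by (simp add: t nrm_scaleR)
      also have "\<dots> \<le> 1 * nrm p Z" using NW nrm_nonneg by (intro mult_right_mono)
      also have "\<dots> \<le> C^2 * nrm p Z" using CC nrm_nonneg by (intro mult_right_mono)
      finally show ?thesis .
    next
      assume "W' \<in> Ec p"
      from dom_sc[OF n Z this] have "nrm p W' * N n Z \<le> C * lam ^ n * (nrm p Z * N n W')" by (simp add: N_def mult.commute)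
      also have "\<dots> \<le> C^2 * (nrm p Z * 1)"
        using NW nrm_nonneg N0 C order_trans[OF Cl[of n] CC(1)]
        by (intro mult_mono mult_left_mono mult_nonneg_nonneg) auto
      finally show ?thesis by simp
    next
      assume "W' \<in> Eu p"
      from expand[OF n this] have "nrm p W' \<le> C * lam ^ n * N n W'" by (simp add: N_def)
      also have "\<dots> \<le> C * 1" using NW N0 C Cl[of n] by (intro mult_mono) auto
      finally have "nrm p W' \<le> C" by simp
      moreover have "N n Z \<le> C * nrm p Z"
        using contr[OF n Z] mult_right_mono[OF Cl[of n] nrm_nonneg[of p Z]] by (simp add: N_def)
      ultimately have "nrm p W' * N n Z \<le> C * (C * nrm p Z)" using N0 C by (intro mult_mono) auto
      then show ?thesis by (simp add: power2_eq_square)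
    qed
    have "c * N n U * N n Z \<le> (K * nrm p U * nrm p W') * N n Z" using 1 N0 by (intro mult_right_mono)
    also have "\<dots> = K * nrm p U * (nrm p W' * N n Z)" by simp
    also have "\<dots> \<le> K * nrm p U * (C^2 * nrm p Z)" using 2 K nrm_nonneg by (intro mult_left_mono) auto
    finally show ?thesis by (simp add: mult_ac)
  qed
  \<comment> \<open>The growth of \<open>Y\<close> is at most lam^n times that of \<open>U\<close>,
    up to a constant; with \<open>main\<close> to bound the product of the growths of
    \<open>U\<close> and \<open>Z\<close>, only lam^n times the constant \<open>D\<close>
    remains.\<close>
  define D where "D = K * C * nrm p Y * (K * C^2 * (nrm p U * nrm p Z))"
  have bd: "\<bar>w p Z Y\<bar> * (c * nrm p U) \<le> D * lam ^ n" if n: "1 \<le> n" for n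
  proof -
    have "\<bar>w p Z Y\<bar> \<le> K * (N n Z * N n Y)" using K(2)[of "(f ^^ n) p"] w_T[of n p Z Y] by (metis N_def)
    then have "\<bar>w p Z Y\<bar> * (c * nrm p U) \<le> K * (N n Z * N n Y) * (c * nrm p U)"
      using c nrm_nonneg by (intro mult_right_mono) auto
    also have "\<dots> = K * N n Z * c * (N n Y * nrm p U)" by simp
    also have "\<dots> \<le> K * N n Z * c * (C * lam ^ n * (nrm p Y * N n U))"
      using dom_cu[OF n Y U(1)] K N0 c by (intro mult_left_mono) (auto simp: N_def)
    also have "\<dots> = K * C * lam ^ n * nrm p Y * (c * N n U * N n Z)" by simp
    also have "\<dots> \<le> K * C * lam ^ n * nrm p Y * (K * C^2 * (nrm p U * nrm p Z))"
      using main[OF n] K C l1 nrm_nonneg by (intro mult_left_mono) auto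
    finally show ?thesis by (simp add: D_def mult_ac)
  qed
  have "(\<lambda>n. D * lam ^ n) \<longlonglongrightarrow> D * 0" using lam by (intro tendsto_mult LIMSEQ_power_zero) auto
  then have "\<bar>w p Z Y\<bar> * (c * nrm p U) \<le> D * 0"
    by (rule LIMSEQ_le_const) (use bd in blast)
  then have "\<bar>w p Z Y\<bar> \<le> 0" using c(1) nrm_pos[OF U(2), of p] by (simp add: mult_le_0_iff)
  then show ?thesis by simp
qed

text \<open>Time reversal: the estimates for \<open>f\<close>, read at the n-th backward image of
  \<open>p\<close>, are those for \<open>h\<close> at \<open>p\<close> with the roles of stable and
  unstable exchanged. Everything proved for \<open>Es\<close> thereby holds for
  \<open>Eu\<close>.\<close>

lemma inverse_splitting: "symplectic_splitting A g w h f Eu Ec Es lam C"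
proof -
  have inv': "tangent_map A h p ` E p = E (h p)" if "\<And>p. tangent_map A f p ` E p = E (f p)" for E p
  proof -
    have "tangent_map A h p ` E p = tangent_map A h (f (h p)) ` tangent_map A f (h p) ` E (h p)"
      using that[of "h p"] fh by simp
    also have "\<dots> = E (h p)" unfolding image_image using tangent_map_inv[OF f1 h1 hf] by simp
    finally show ?thesis .
  qed
  have fn: "(f ^^ n) ((h ^^ n) x) = x" for n x by (rule funpow_left_inverse[of f h, OF fh])
  define S where "S n p = tangent_map A (h ^^ n) p" for n p
  have TS: "T n ((h ^^ n) p) (S n p v) = v" for n p v
    unfolding S_def by (rule tangent_map_funpow_inverse[OF h1 f1 fh])
  have S_in: "S n p v \<in> E ((h ^^ n) p)" if inv: "\<And>p. tangent_map A f p ` E p = E (f p)" and v: "v \<in> E p" for n p v E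
  proof -
    have "v \<in> T n ((h ^^ n) p) ` E ((h ^^ n) p)" using T_image[OF inv, of n "(h ^^ n) p"] v fn by simp
    then obtain u where u: "u \<in> E ((h ^^ n) p)" "v = T n ((h ^^ n) p) u" by blast
    then have "S n p v = u" using tangent_map_funpow_inverse[OF f1 h1 hf, of n "(h ^^ n) p" u] fn by (simp add: S_def)
    then show ?thesis using u by simp
  qed
  show ?thesis
  proof (unfold_locales)
    show "w (h p) (tangent_map A h p u) (tangent_map A h p v) = w p u v" for p u v
      using pull[of "h p" "tangent_map A h p u" "tangent_map A h p v"] fh tangent_map_inv[OF h1 f1 fh] by simp
    show "\<exists>a\<in>Eu p. \<exists>b\<in>Ec p. \<exists>c\<in>Es p. v = a + b + c" for p v
      using decomp[of p v] by (metis add.commute add.left_commute)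
    fix n :: nat and p X Y assume n: "1 \<le> n"
    show "nrm ((h ^^ n) p) (tangent_map A (h ^^ n) p X) \<le> C * lam ^ n * nrm p X" if "X \<in> Eu p"
      using expand[OF n S_in[OF inv(3) that, of n]] TS[of n p X] fn[of n p] by (simp add: S_def)
    show "nrm p X \<le> C * lam ^ n * nrm ((h ^^ n) p) (tangent_map A (h ^^ n) p X)" if "X \<in> Es p"
      using contr[OF n S_in[OF inv(1) that, of n]] TS[of n p X] fn[of n p] by (simp add: S_def)
    show "nrm ((h ^^ n) p) (tangent_map A (h ^^ n) p X) * nrm p Y
         \<le> C * lam ^ n * (nrm p X * nrm ((h ^^ n) p) (tangent_map A (h ^^ n) p Y))" if "X \<in> Eu p" "Y \<in> Ec p"
      using dom_cu[OF n S_in[OF inv(2) that(2), of n] S_in[OF inv(3) that(1), of n]] TS[of n p] fn[of n p]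
      by (simp add: S_def mult_ac)
    show "nrm ((h ^^ n) p) (tangent_map A (h ^^ n) p X) * nrm p Y
         \<le> C * lam ^ n * (nrm p X * nrm ((h ^^ n) p) (tangent_map A (h ^^ n) p Y))" if "X \<in> Ec p" "Y \<in> Es p"
      using dom_sc[OF n S_in[OF inv(1) that(2), of n] S_in[OF inv(2) that(1), of n]] TS[of n p] fn[of n p]
      by (simp add: S_def mult_ac)
  qed (use comp metric symplectic f2 h2 hf fh cont inv' inv lam C dim_s dim_c dim_u C1_s C1_u in auto)
qed

lemma unstable_center_orthogonal: "Z \<in> Eu p \<Longrightarrow> Y \<in> Ec p \<Longrightarrow> w p Z Y = 0"
  by (rule symplectic_splitting.stable_center_orthogonal[OF inverse_splitting])

end

section \<open>Involutivity of the center bundle\<close>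

lemma in_span_2E:
  assumes "x \<in> span {u, v}" obtains a b where "x = a *\<^sub>R u + b *\<^sub>R v"
proof -
  obtain a where "x - a *\<^sub>R u \<in> span {v}" using assms span_breakdown_eq[of x u "{v}"] by blast
  then obtain b where "x - a *\<^sub>R u = b *\<^sub>R v" by (auto simp: span_singleton)
  then show ?thesis using that[of a b] by (simp add: algebra_simps)
qed

text \<open>The derivative along \<open>u\<close> of the form on \<open>v\<close> is bilinear in the
  pair, with the partial derivatives of the coefficients of the form as coefficients.\<close>

lemma frechet_derivative_linear_family:
  fixes M :: "'d::euclidean_space \<Rightarrow> 'e::euclidean_space \<Rightarrow> real"
  assumes U: "open U" "z0 \<in> U" and lin: "\<And>z. z \<in> U \<Longrightarrow> linear (M z)" and C1: "\<And>v. Ck_on 1 (\<lambda>z. M z v) U"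
  shows "frechet_derivative (\<lambda>z. M z v) (at z0) u =
    (\<Sum>i\<in>Basis. \<Sum>j\<in>Basis. (u \<bullet> i) * (v \<bullet> j) * frechet_derivative (\<lambda>z. M z j) (at z0) i)"
proof -
  let ?D = "\<lambda>v. frechet_derivative (\<lambda>z. M z v) (at z0)"
  have D: "((\<lambda>z. M z v) has_derivative ?D v) (at z0)" for v by (rule C1_on_has_derivative[OF C1 U(2)])
  have "((\<lambda>z. \<Sum>j\<in>Basis. (v \<bullet> j) *\<^sub>R M z j) has_derivative (\<lambda>k. \<Sum>j\<in>Basis. (v \<bullet> j) *\<^sub>R ?D j k)) (at z0)"
    by (intro has_derivative_sum has_derivative_scaleR_right D)
  then have "((\<lambda>z. M z v) has_derivative (\<lambda>k. \<Sum>j\<in>Basis. (v \<bullet> j) *\<^sub>R ?D j k)) (at z0)"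
    by (rule has_derivative_transform_within_open[OF _ U]) (simp only: linear_sum_Basis[OF lin, symmetric])
  from has_derivative_unique[OF D this] have "?D v u = (\<Sum>j\<in>Basis. (v \<bullet> j) * ?D j u)" by simp
  also have "\<dots> = (\<Sum>j\<in>Basis. (v \<bullet> j) * (\<Sum>i\<in>Basis. (u \<bullet> i) *\<^sub>R ?D j i))"
    unfolding linear_sum_Basis[OF has_derivative_linear[OF D], symmetric] ..
  also have "\<dots> = (\<Sum>j\<in>Basis. \<Sum>i\<in>Basis. (u \<bullet> i) * (v \<bullet> j) * ?D j i)"
    by (simp add: sum_distrib_left mult_ac)
  finally show ?thesis by (subst sum.swap)
qed

section \<open>One-forms attached to sections of a line bundle\<close>

context atlas
begin

definition line_frame :: "('m \<Rightarrow> 'e set) \<Rightarrow> ('m, 'e) chart \<Rightarrow> 'm set \<Rightarrow> ('m \<Rightarrow> 'e) \<Rightarrow> bool" where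
  "line_frame E c U X \<longleftrightarrow> c \<in> A \<and> open U \<and> U \<subseteq> chart_dom c \<and> (\<forall>q\<in>U. X q \<in> E q \<and> X q \<noteq> 0) \<and>
     Ck_on 1 (\<lambda>x. coord A c (chart_inv c x) (X (chart_inv c x))) (chart_map c ` U)"

text \<open>The one-form \<open>w(X, \<sqdot>)\<close> in the chart \<open>c\<close>, and its exterior derivative at \<open>p\<close>, evaluated on
  tangent vectors at \<open>p\<close>.\<close>

definition form_along :: "('m \<Rightarrow> 'e \<Rightarrow> 'e \<Rightarrow> real) \<Rightarrow> ('m, 'e) chart \<Rightarrow> ('m \<Rightarrow> 'e) \<Rightarrow> 'e \<Rightarrow> 'e \<Rightarrow> real" where
  "form_along w c X x v = local_form A w c (coord A c (chart_inv c x) (X (chart_inv c x))) v x"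

definition dform :: "('m \<Rightarrow> 'e \<Rightarrow> 'e \<Rightarrow> real) \<Rightarrow> ('m, 'e) chart \<Rightarrow> ('m \<Rightarrow> 'e) \<Rightarrow> 'm \<Rightarrow> 'e \<Rightarrow> 'e \<Rightarrow> real" where
  "dform w c X p y z =
     frechet_derivative (\<lambda>x. form_along w c X x (coord A c p z)) (at (chart_map c p)) (coord A c p y)
   - frechet_derivative (\<lambda>x. form_along w c X x (coord A c p y)) (at (chart_map c p)) (coord A c p z)"

lemma form_along_coord:
  assumes "c \<in> A" "q \<in> chart_dom c"
  shows "form_along w c X (chart_map c q) (coord A c q v) = w q (X q) v"
  using local_form_coord[OF Ck_chart_atlas[OF assms(1)] assms(2)]
    chart_inv_map[OF is_chart[OF Ck_chart_atlas[OF assms(1)]] assms(2)] by (simp add: form_along_def)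

lemma form_along_linear:
  assumes "\<And>p. bilinear (w p)" "c \<in> A" "x \<in> chart_map c ` chart_dom c"
  shows "linear (form_along w c X x)"
  using bilinear_linear(1)[OF bilinear_local_form[OF assms(1) Ck_chart_atlas[OF assms(2)] assms(3)]]
  by (simp add: form_along_def[abs_def])

lemma form_along_C1:
  assumes w: "smooth_bilinear_field A w" and X: "line_frame E c U X"
  shows "Ck_on 1 (\<lambda>x. form_along w c X x v) (chart_map c ` U)"
proof -
  have c: "c \<in> A" "open U" "U \<subseteq> chart_dom c" using X by (auto simp: line_frame_def)
  have op: "open (chart_map c ` U)"
    using open_chart_image[OF is_chart[OF Ck_chart_atlas[OF c(1)]] c(2)] c(3) by (simp add: Int_absorb1)
  have bil: "\<And>p. bilinear (w p)" using w by (simp add: smooth_bilinear_field_def)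
  show ?thesis unfolding form_along_def
  proof (rule C1_on_linear_family[OF op, where M="\<lambda>x u. local_form A w c u v x"])
    show "linear (\<lambda>u. local_form A w c u v x)" if "x \<in> chart_map c ` U" for x
    proof -
      have "x \<in> chart_map c ` chart_dom c" using that c(3) by blast
      then show ?thesis by (rule bilinear_linear(2)[OF bilinear_local_form[OF bil Ck_chart_atlas[OF c(1)]]])
    qed
    have "Ck_on 1 (local_form A w c u v) (chart_map c ` chart_dom c)" for u
      using w c(1) unfolding smooth_bilinear_field_def smooth_on_def by blast
    then show "Ck_on 1 (\<lambda>z. local_form A w c u v z) (chart_map c ` U)" for u
      by (rule Ck_on_subset) (use c(3) in auto)
    show "Ck_on 1 (\<lambda>x. coord A c (chart_inv c x) (X (chart_inv c x))) (chart_map c ` U)"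
      using X by (simp add: line_frame_def)
  qed
qed

text \<open>Written like this, \<open>dform\<close> is visibly bilinear and, on continuous fields,
  continuous in the base point; its local bound depends on both.\<close>

lemma dform_eq_sum:
  assumes w: "smooth_bilinear_field A w" and X: "line_frame E c U X" and q: "q \<in> U"
  shows "dform w c X q y z = (\<Sum>i\<in>Basis. \<Sum>j\<in>Basis. (coord A c q y \<bullet> i) * (coord A c q z \<bullet> j) *
    (frechet_derivative (\<lambda>x. form_along w c X x j) (at (chart_map c q)) i
    - frechet_derivative (\<lambda>x. form_along w c X x i) (at (chart_map c q)) j))"
proof -
  have c: "c \<in> A" "open U" "U \<subseteq> chart_dom c" using X by (auto simp: line_frame_def)
  have op: "open (chart_map c ` U)"
    using open_chart_image[OF is_chart[OF Ck_chart_atlas[OF c(1)]] c(2)] c(3) by (simp add: Int_absorb1)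
  have bil: "\<And>p. bilinear (w p)" using w by (simp add: smooth_bilinear_field_def)
  have lin: "linear (form_along w c X x)" if "x \<in> chart_map c ` U" for x
  proof -
    have "x \<in> chart_map c ` chart_dom c" using that c(3) by blast
    then show ?thesis by (rule form_along_linear[OF bil c(1)])
  qed
  have x: "chart_map c q \<in> chart_map c ` U" using q by auto
  let ?D = "\<lambda>v u. frechet_derivative (\<lambda>x. form_along w c X x v) (at (chart_map c q)) u"
  have D: "?D v u = (\<Sum>i\<in>Basis. \<Sum>j\<in>Basis. (u \<bullet> i) * (v \<bullet> j) * ?D j i)" for u v
    by (rule frechet_derivative_linear_family[OF op x lin form_along_C1[OF w X]])
  let ?y = "coord A c q y" and ?z = "coord A c q z"
  have "dform w c X q y z = ?D ?z ?y - ?D ?y ?z" by (simp add: dform_def)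
  also have "\<dots> = (\<Sum>i\<in>Basis. \<Sum>j\<in>Basis. (?y \<bullet> i) * (?z \<bullet> j) * ?D j i) - (\<Sum>i\<in>Basis. \<Sum>j\<in>Basis. (?z \<bullet> i) * (?y \<bullet> j) * ?D j i)"
    by (simp only: D[of ?z ?y] D[of ?y ?z])
  also have "(\<Sum>i\<in>Basis. \<Sum>j\<in>Basis. (?z \<bullet> i) * (?y \<bullet> j) * ?D j i) = (\<Sum>i\<in>Basis. \<Sum>j\<in>Basis. (?y \<bullet> i) * (?z \<bullet> j) * ?D i j)"
    by (subst sum.swap) (simp add: mult_ac)
  finally show ?thesis by (simp add: sum_subtractf[symmetric] right_diff_distrib)
qed

lemma line_frame_exists:
  assumes g: "riemannian_metric A g" and E: "Ck_subbundle A 1 E" and dim: "dim (E p) = 1"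
  obtains U X where "line_frame E (chart_at A p) U X" "p \<in> U"
proof (rule subbundle_local_frame[OF g E, of p])
  fix U r X M assume *: "open U" "p \<in> U" "U \<subseteq> chart_dom (chart_at A p)" "r = dim (E p)"
    "\<And>i. i < r \<Longrightarrow> Ck_on 1 (\<lambda>x. coord A (chart_at A p) (chart_inv (chart_at A p) x) (X i (chart_inv (chart_at A p) x)))
       (chart_map (chart_at A p) ` U)"
    "\<And>q. q \<in> U \<Longrightarrow> span ((\<lambda>i. X i q) ` {..<r}) = E q" "\<And>q. q \<in> U \<Longrightarrow> dim (E q) = r"
  have r: "r = 1" using * dim by simp
  have "X 0 q \<in> E q \<and> X 0 q \<noteq> 0" if "q \<in> U" for q
  proof
    have s: "span {X 0 q} = E q" using *(6)[OF that] r by (simp add: lessThan_Suc)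
    then show "X 0 q \<in> E q" using span_base by blast
    show "X 0 q \<noteq> 0" using s *(7)[OF that] r by (metis dim_eq_0 dim_span one_neq_zero order_refl)
  qed
  moreover have "Ck_on 1 (\<lambda>x. coord A (chart_at A p) (chart_inv (chart_at A p) x) (X 0 (chart_inv (chart_at A p) x)))
       (chart_map (chart_at A p) ` U)" by (rule *(5)) (simp add: r)
  ultimately have "line_frame E (chart_at A p) U (X 0)"
    unfolding line_frame_def by (intro conjI ballI chart_at *) (auto simp: r)
  then show thesis using that *(2) by blast
qed

end

section \<open>Invariance and vanishing of the exterior derivatives\<close>

context symplectic_splitting
begin

text \<open>A map \<open>k\<close> that preserves \<open>w\<close> and the line bundle takes X to t
  Y for some function t. It therefore pulls w(Y, .) back to w(X, .) / t, and on the kernel of w(X,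
  .) the exterior derivatives correspond. With the identity for \<open>k\<close> the lemma compares
  two sections and two charts.\<close>

lemma dform_invariant:
  assumes E: "\<And>q. dim (E q) = 1" "\<And>q. subspace (E q)"
    and k2: "Ck_map A 2 k" and kw: "\<And>q u v. w (k q) (tangent_map A k q u) (tangent_map A k q v) = w q u v"
    and kE: "\<And>q v. v \<in> E q \<Longrightarrow> tangent_map A k q v \<in> E (k q)"
    and X: "line_frame E c U X" and Y: "line_frame E d V Y" and p: "p \<in> U" "k p \<in> V"
    and s: "tangent_map A k p (X p) = s *\<^sub>R Y (k p)" and y: "w p (X p) y = 0" and z: "w p (X p) z = 0"
  shows "dform w c X p y z = s * dform w d Y (k p) (tangent_map A k p y) (tangent_map A k p z)"
proof -
  have c: "c \<in> A" "open U" "U \<subseteq> chart_dom c" and X0: "\<And>q. q \<in> U \<Longrightarrow> X q \<in> E q \<and> X q \<noteq> 0"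
    using X by (auto simp: line_frame_def)
  have d: "d \<in> A" "open V" "V \<subseteq> chart_dom d" and Y0: "\<And>q. q \<in> V \<Longrightarrow> Y q \<in> E q \<and> Y q \<noteq> 0"
    using Y by (auto simp: line_frame_def)
  note cC = Ck_chart_atlas[OF c(1), of 1] and dC = Ck_chart_atlas[OF d(1), of 1]
  note ic = is_chart[OF cC] and id = is_chart[OF dC]
  have k1: "Ck_map A 1 k" using Ck_map_le[OF k2] by simp
  have kc: "continuous_on UNIV k" using k2 by (simp add: Ck_map_def)
  define O' where "O' = U \<inter> k -` V"
  have opO: "open O'" unfolding O'_def using c d kc by (intro open_Int open_vimage) auto
  define S where "S = chart_map c ` O'"
  have OU: "O' \<subseteq> chart_dom c" using c by (auto simp: O'_def)
  have opS: "open S" unfolding S_def using open_chart_image[OF ic opO] OU by (simp add: Int_absorb1)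
  define S' where "S' = chart_map d ` V"
  have opS': "open S'" unfolding S'_def using open_chart_image[OF id d(2)] d(3) by (simp add: Int_absorb1)
  define F where "F = rep c k d"
  have inv: "chart_inv c (chart_map c q) = q" if "q \<in> O'" for q using chart_inv_map[OF ic] OU that by auto
  have F2: "Ck_on 2 F S"
  proof (rule Ck_on_subset)
    show "Ck_on 2 F (chart_map c ` (chart_dom c \<inter> k -` chart_dom d))"
      using k2 c d by (simp add: Ck_map_def F_def rep_def)
    show "S \<subseteq> chart_map c ` (chart_dom c \<inter> k -` chart_dom d)" using c d by (auto simp: S_def O'_def)
  qed
  define F' where "F' x v = frechet_derivative F (at x) v" for x v
  have F': "(F has_derivative F' x) (at x)" if "x \<in> S" for x
    unfolding F'_def using C1_on_has_derivative[OF Ck_on_le[OF F2, of 1] that] by simp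
  have F'C1: "Ck_on 1 (\<lambda>x. F' x v) S" for v
    using F2 unfolding F'_def numeral_2_eq_2 One_nat_def by (subst (asm) Ck_on.simps(2)) blast
  have F'eq: "F' (chart_map c q) v = coord A d (k q) (tangent_map A k q (coord_inv A c q v))" if q: "q \<in> O'" for q v
  proof -
    have "(F has_derivative (\<lambda>v. coord A d (k q) (tangent_map A k q (coord_inv A c q v)))) (at (chart_map c q))"
      unfolding F_def using q c d
      by (intro rep_has_derivative Ck_map_has_tangent k1 cC dC) (auto simp: O'_def)
    from has_derivative_unique[OF F' this] show ?thesis using q by (auto simp: S_def)
  qed
  have Fq: "F (chart_map c q) = chart_map d (k q)" if "q \<in> O'" for q using inv[OF that] by (simp add: F_def rep_def)
  have pO: "p \<in> O'" using p by (simp add: O'_def)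
  have "\<exists>t. tangent_map A k q (X q) = t *\<^sub>R Y (k q)" if q: "q \<in> O'" for q
  proof -
    have "Y (k q) \<in> E (k q)" "Y (k q) \<noteq> 0" "tangent_map A k q (X q) \<in> E (k q)"
      using X0[of q] Y0[of "k q"] kE q by (auto simp: O'_def)
    from line_multiple[OF E this] show ?thesis by blast
  qed
  then obtain t where t: "\<And>q. q \<in> O' \<Longrightarrow> tangent_map A k q (X q) = t q *\<^sub>R Y (k q)" by metis
  have tp: "t p = s" using t[OF pO] s Y0[OF p(2)] by simp
  have eqw: "t q * w (k q) (Y (k q)) (tangent_map A k q v) = w q (X q) v" if q: "q \<in> O'" for q v
    using kw[of q "X q" v] unfolding t[OF q] bilinear_lmul[OF w_bilinear] by simp
  \<comment> \<open>If the image of \<open>X q\<close> were 0, invariance and nondegeneracy of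
    \<open>w\<close> would force \<open>X q\<close> to be 0.\<close>
  have t0: "t q \<noteq> 0" if q: "q \<in> O'" for q
  proof
    assume "t q = 0"
    then have "X q = 0" using eqw[OF q] by (intro w_nondeg) simp
    then show False using X0 q by (auto simp: O'_def)
  qed
  define \<alpha> where "\<alpha> = form_along w c X"
  define \<beta> where "\<beta> = form_along w d Y"
  have \<alpha>: "\<alpha> (chart_map c q) v = w q (X q) (coord_inv A c q v)" if "q \<in> O'" for q v
    using form_along_coord[OF c(1), of q w X "coord_inv A c q v"] coord_coord_inv(1)[OF cC] OU that by (auto simp: \<alpha>_def)
  let ?x = "chart_map c p"
  define a where "a v = frechet_derivative (\<lambda>x. \<alpha> x v) (at ?x)" for v
  define b where "b v = frechet_derivative (\<lambda>x. \<beta> x v) (at (F ?x))" for v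
  let ?u = "coord A c p y" and ?v = "coord A c p z"
  have xS: "?x \<in> S" using pO by (auto simp: S_def)
  have pc: "p \<in> chart_dom c" using pO OU by auto
  have FS: "F ?x \<in> S'" using p Fq[OF pO] by (auto simp: S'_def)
  \<comment> \<open>A vector off the kernel; through it the factor 1 / t is seen to be
    differentiable.\<close>
  obtain v0 where v0: "w p (X p) v0 \<noteq> 0" using w_nondeg[of p "X p"] X0[OF p(1)] by blast
  have "b (F' ?x ?v) (F' ?x ?u) - b (F' ?x ?u) (F' ?x ?v) = 1 / t (chart_inv c ?x) * (a ?v ?u - a ?u ?v)"
  proof (rule exterior_derivative_scaled_pullback[where F=F and F'=F' and a=a and b=b and \<alpha>=\<alpha> and \<beta>=\<beta>
        and h="\<lambda>x. 1 / t (chart_inv c x)", OF opS xS opS' FS])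
    show "(F has_derivative F' x) (at x)" if "x \<in> S" for x by (rule F'[OF that])
    show "((\<lambda>x. F' x v) has_derivative frechet_derivative (\<lambda>x. F' x v) (at ?x)) (at ?x)" for v
      by (rule C1_on_has_derivative[OF F'C1 xS])
    show "linear (\<alpha> x)" if "x \<in> S" for x unfolding \<alpha>_def
      using that OU by (intro form_along_linear w_bilinear c(1)) (auto simp: S_def)
    show "linear (\<beta> x)" if "x \<in> S'" for x unfolding \<beta>_def
      using that d by (intro form_along_linear w_bilinear d(1)) (auto simp: S'_def)
    show "((\<lambda>x. \<alpha> x v) has_derivative a v) (at ?x)" for v unfolding a_def \<alpha>_def
      using p by (intro C1_on_has_derivative[OF form_along_C1[OF w_smooth X]]) auto
    show "((\<lambda>x. \<beta> x v) has_derivative b v) (at (F ?x))" for v unfolding b_def \<beta>_def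
      using FS by (intro C1_on_has_derivative[OF form_along_C1[OF w_smooth Y]]) (auto simp: S'_def)
    show "\<beta> (F x) (F' x v) = 1 / t (chart_inv c x) * \<alpha> x v" if xS: "x \<in> S" for x v
    proof -
      obtain q where q: "q \<in> O'" "x = chart_map c q" using xS unfolding S_def by blast
      have "\<beta> (F x) (F' x v) = w (k q) (Y (k q)) (tangent_map A k q (coord_inv A c q v))"
        unfolding q(2) F'eq[OF q(1)] Fq[OF q(1)] \<beta>_def using d q(1) by (intro form_along_coord) (auto simp: O'_def)
      then show ?thesis using eqw[OF q(1), of "coord_inv A c q v"] t0[OF q(1)] \<alpha>[OF q(1)] inv[OF q(1)]
        by (simp add: q(2) field_simps)
    qed
    show "\<alpha> ?x (coord A c p v0) \<noteq> 0" using v0 form_along_coord[OF c(1) pc] by (simp add: \<alpha>_def)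
    show "\<alpha> ?x ?u = 0" "\<alpha> ?x ?v = 0" using form_along_coord[OF c(1) pc] y z by (simp_all add: \<alpha>_def)
  qed
  then have *: "s * (b (F' ?x ?v) (F' ?x ?u) - b (F' ?x ?u) (F' ?x ?v)) = a ?v ?u - a ?u ?v"
    using t0[OF pO] tp inv[OF pO] by simp
  have "dform w c X p y z = a ?v ?u - a ?u ?v" by (simp add: dform_def a_def \<alpha>_def)
  moreover have "dform w d Y (k p) (tangent_map A k p y) (tangent_map A k p z) = b (F' ?x ?v) (F' ?x ?u) - b (F' ?x ?u) (F' ?x ?v)"
    unfolding F'eq[OF pO] coord_coord_inv(2)[OF cC pc] by (simp add: dform_def b_def \<beta>_def Fq[OF pO])
  ultimately show ?thesis using * by simp
qed

text \<open>On the center plane every alternating form is a multiple of \<open>w\<close>, which is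
  nonzero there, and the factor is locally bounded by continuity. The norm of \<open>X\<close> is
  inserted to make the bound homogeneous in the section.\<close>

lemma dform_bound:
  assumes X: "line_frame Es (chart_at A p) U X" and p: "p \<in> U"
  shows "\<exists>V K. open V \<and> p \<in> V \<and> V \<subseteq> U \<and> (\<forall>q\<in>V. \<forall>y\<in>Ec q. \<forall>z\<in>Ec q.
    \<bar>dform w (chart_at A p) X q y z\<bar> \<le> K * (nrm q (X q) * \<bar>w q y z\<bar>))"
proof -
  let ?c = "chart_at A p"
  have c: "?c \<in> A" "open U" "U \<subseteq> chart_dom ?c" and X0: "\<And>q. q \<in> U \<Longrightarrow> X q \<in> Es q \<and> X q \<noteq> 0"
    and XC: "Ck_on 1 (\<lambda>x. coord A ?c (chart_inv ?c x) (X (chart_inv ?c x))) (chart_map ?c ` U)"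
    using X by (auto simp: line_frame_def simp del: Ck_on.simps One_nat_def)
  note cC = Ck_chart_atlas[OF c(1), of 1]
  obtain U1 r W where U1: "open U1" "p \<in> U1" "U1 \<subseteq> chart_dom ?c" "r = dim (Ec p)"
    and Wc: "\<And>i. i < r \<Longrightarrow> Ck_on 0 (\<lambda>x. coord A ?c (chart_inv ?c x) (W i (chart_inv ?c x))) (chart_map ?c ` U1)"
    and Ws: "\<And>q. q \<in> U1 \<Longrightarrow> span ((\<lambda>i. W i q) ` {..<r}) = Ec q"
    by (rule subbundle_local_frame[OF metric cont(2), of p]) blast
  have r: "r = 2" using U1 dim_c by simp
  have Ecs: "Ec q = span {W 0 q, W 1 q}" if "q \<in> U1" for q
    using Ws[OF that] by (simp add: r numeral_2_eq_2 lessThan_Suc insert_commute)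
  obtain U2 k where U2: "open U2" "p \<in> U2" "U2 \<subseteq> chart_dom ?c" "k > 0"
    "\<And>q v. q \<in> U2 \<Longrightarrow> norm (coord A ?c q v) \<le> k * nrm q v"
    using metric_coord_bounds[OF metric, of p] by metis
  define V where "V = U \<inter> U1 \<inter> U2"
  have V: "open V" "p \<in> V" "V \<subseteq> chart_dom ?c" using c U1 U2 p by (auto simp: V_def)
  define S where "S = chart_map ?c ` V"
  have opS: "open S" using open_chart_image[OF is_chart_at V(1), of p] V(3) by (simp add: S_def Int_absorb1)
  have inv: "chart_inv ?c (chart_map ?c q) = q" if "q \<in> V" for q using chart_inv_map[OF is_chart_at] V(3) that by auto
  define Z where "Z i x = coord A ?c (chart_inv ?c x) (W i (chart_inv ?c x))" for i x
  have Zc: "continuous_on S (Z i)" if "i < 2" for i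
    using Wc[of i] that r unfolding Z_def[abs_def] by (auto intro: continuous_on_subset simp: S_def V_def)
  define \<nu> where "\<nu> x = norm (coord A ?c (chart_inv ?c x) (X (chart_inv ?c x)))" for x
  define \<mu> where "\<mu> x = \<bar>local_form A w ?c (Z 0 x) (Z 1 x) x\<bar>" for x
  define cf where "cf x i j = frechet_derivative (\<lambda>x. form_along w ?c X x j) (at x) i" for x i j
  define \<delta> where "\<delta> x = \<bar>\<Sum>i\<in>Basis. \<Sum>j\<in>Basis. (Z 0 x \<bullet> i) * (Z 1 x \<bullet> j) * (cf x i j - cf x j i)\<bar>" for x
  have cfc: "continuous_on S (\<lambda>x. cf x i j)" for i j unfolding cf_def
    by (rule continuous_on_subset[OF C1_on_continuous_derivative[OF form_along_C1[OF w_smooth X]]]) (auto simp: S_def V_def)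
  have \<delta>c: "continuous_on S \<delta>" unfolding \<delta>_def by (intro continuous_intros cfc Zc) auto
  have \<nu>c: "continuous_on S \<nu>" unfolding \<nu>_def
    by (intro continuous_intros continuous_on_subset[OF C1_on_continuous[OF XC]]) (auto simp: S_def V_def)
  have \<mu>c: "continuous_on S \<mu>"
  proof -
    have Zc': "continuous_on (S \<times> (UNIV :: 'e set)) (\<lambda>z. Z i (fst z))" if "i < 2" for i
      by (rule continuous_on_compose2[OF Zc[OF that] continuous_on_fst[OF continuous_on_id]]) auto
    have "continuous_on (S \<times> (UNIV :: 'e set)) (\<lambda>z. local_form A w ?c (Z 0 (fst z)) (Z 1 (fst z)) (fst z))"
      by (rule continuous_local_form_along[OF w_smooth c(1), where U="\<lambda>x v. Z 0 x" and V="\<lambda>x v. Z 1 x"])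
        (use V Zc' in \<open>auto simp: S_def\<close>)
    then have "continuous_on S (\<lambda>x. local_form A w ?c (Z 0 (fst (x, 0::'e))) (Z 1 (fst (x, 0::'e))) (fst (x, 0::'e)))"
      by (rule continuous_on_compose2) (auto intro!: continuous_intros)
    then show ?thesis unfolding \<mu>_def by (intro continuous_intros) simp
  qed
  have \<mu>eq: "\<mu> (chart_map ?c q) = \<bar>w q (W 0 q) (W 1 q)\<bar>" if "q \<in> V" for q
    using local_form_coord[OF cC] that V(3) inv[OF that] by (auto simp: \<mu>_def Z_def)
  have deq: "dform w ?c X q y z = (\<Sum>i\<in>Basis. \<Sum>j\<in>Basis. (coord A ?c q y \<bullet> i) * (coord A ?c q z \<bullet> j) *
      (cf (chart_map ?c q) i j - cf (chart_map ?c q) j i))" if "q \<in> V" for q y z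
    unfolding cf_def using that by (intro dform_eq_sum[OF w_smooth X]) (auto simp: V_def)
  have \<delta>eq: "\<delta> (chart_map ?c q) = \<bar>dform w ?c X q (W 0 q) (W 1 q)\<bar>" if "q \<in> V" for q
    unfolding deq[OF that] using inv[OF that] by (simp add: \<delta>_def Z_def)
  let ?x = "chart_map ?c p"
  \<comment> \<open>Otherwise \<open>W 0 p\<close> would be orthogonal to \<open>Ec\<close>, as it
    is to \<open>Es\<close> and \<open>Eu\<close>; nondegeneracy would make it 0 and leave the
    center plane with dimension at most 1.\<close>
  have "w p (W 0 p) (W 1 p) \<noteq> 0"
  proof
    assume 0: "w p (W 0 p) (W 1 p) = 0"
    have "W 0 p = 0"
    proof (rule w_nondeg)
      fix v
      obtain a b e where abe: "a \<in> Es p" "b \<in> Ec p" "e \<in> Eu p" "v = a + b + e" using decomp by blast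
      have W0: "W 0 p \<in> Ec p" unfolding Ecs[OF U1(2)] by (intro span_base) simp
      have "w p (W 0 p) a = 0" "w p (W 0 p) e = 0"
        using stable_center_orthogonal[OF abe(1) W0] unstable_center_orthogonal[OF abe(3) W0]
          w_skew[of p "W 0 p" a] w_skew[of p "W 0 p" e] by simp_all
      moreover have "w p (W 0 p) b = 0"
      proof -
        have "b \<in> span {W 0 p, W 1 p}" using abe Ecs[OF U1(2)] by simp
        then show ?thesis
        proof (rule span_induct)
          show "subspace {b. w p (W 0 p) b = 0}"
            using w_bilinear[of p] by (simp add: subspace_def bilinear_rzero bilinear_radd bilinear_rmul)
        qed (use 0 w_alt in auto)
      qed
      ultimately show "w p (W 0 p) v = 0" using w_bilinear[of p] by (simp add: abe(4) bilinear_radd)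
    qed
    then have "Ec p = span {W 1 p}" using Ecs[OF U1(2)] by (simp add: span_insert_0)
    then have "dim (Ec p) \<le> 1" by (metis card.empty card_insert_disjoint dim_le_card empty_iff finite.emptyI One_nat_def finite.insertI order_refl)
    then show False using dim_c[of p] by simp
  qed
  then have m: "\<mu> ?x > 0" using \<mu>eq[OF V(2)] by simp
  have n: "\<nu> ?x > 0"
  proof -
    have pc: "p \<in> chart_dom ?c" using V by auto
    have "coord A ?c p (X p) \<noteq> 0" using X0[OF p] coord_coord_inv(2)[OF cC pc, of "X p"]
      linear_0[OF linear_coord(2)[OF cC pc]] by metis
    then show ?thesis using inv[OF V(2)] by (simp add: \<nu>_def)
  qed
  \<comment> \<open>On \<open>S1\<close> the quantities \<mu> and \<nu> keep more than half of their
    values at \<open>p\<close>, and \<delta> exceeds its value by less than 1; these three bounds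
    make up the constant \<open>K\<close>.\<close>
  define S1 where "S1 = (S \<inter> \<mu> -` {\<mu> ?x / 2<..}) \<inter> (S \<inter> \<nu> -` {\<nu> ?x / 2<..}) \<inter> (S \<inter> \<delta> -` {..<\<delta> ?x + 1})"
  have opS1: "open S1" unfolding S1_def
    by (intro open_Int continuous_open_preimage \<mu>c \<nu>c \<delta>c opS) auto
  define V1 where "V1 = V \<inter> (chart_dom ?c \<inter> chart_map ?c -` S1)"
  define K where "K = (\<delta> ?x + 1) / (\<mu> ?x / 2) * (k / (\<nu> ?x / 2))"
  have \<delta>0: "\<delta> ?x \<ge> 0" by (simp add: \<delta>_def)
  show ?thesis
  proof (intro exI[of _ V1] exI[of _ K] conjI ballI)
    show "open V1" unfolding V1_def by (intro open_Int V open_chart_preimage is_chart_at opS1)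
    show "p \<in> V1" using V m n by (auto simp: V1_def S1_def S_def)
    show "V1 \<subseteq> U" by (auto simp: V1_def V_def)
    fix q y z assume q: "q \<in> V1" and y: "y \<in> Ec q" and z: "z \<in> Ec q"
    have qV: "q \<in> V" and qS: "chart_map ?c q \<in> S1" and qc: "q \<in> chart_dom ?c" using q by (auto simp: V1_def)
    have qU1: "q \<in> U1" using qV by (simp add: V_def)
    let ?W0 = "W 0 q" and ?W1 = "W 1 q"
    obtain a b where ab: "y = a *\<^sub>R ?W0 + b *\<^sub>R ?W1"
      using y unfolding Ecs[OF qU1] by (rule in_span_2E)
    obtain a' b' where ab': "z = a' *\<^sub>R ?W0 + b' *\<^sub>R ?W1"
      using z unfolding Ecs[OF qU1] by (rule in_span_2E)
    \<comment> \<open>\<open>w\<close> and \<open>dform\<close> take on \<open>y\<close>,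
      \<open>z\<close> their values on the frame times the same determinant, which cancels in the
      comparison.\<close>
    have alt: "B y z = (a * b' - b * a') * B ?W0 ?W1" if B: "bilinear B" "\<And>v. B v v = (0::real)" for B
    proof -
      have "B ?W1 ?W0 = - B ?W0 ?W1"
        using B(2)[of "?W0 + ?W1"] B(2)[of ?W0] B(2)[of ?W1]
          bilinear_ladd[OF B(1), of ?W0 ?W1 "?W0 + ?W1"] bilinear_radd[OF B(1), of ?W0 ?W0 ?W1]
          bilinear_radd[OF B(1), of ?W1 ?W0 ?W1] by simp
      then show ?thesis unfolding ab ab' using B
        by (simp add: bilinear_ladd bilinear_radd bilinear_lmul bilinear_rmul algebra_simps)
    qed
    have lc: "linear (coord A ?c q)" by (rule linear_coord(1)[OF cC qc])
    have dbil: "bilinear (dform w ?c X q)"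
      unfolding bilinear_def
    proof (intro conjI allI linearI)
      fix u v v' and t :: real
      show "dform w ?c X q u (v + v') = dform w ?c X q u v + dform w ?c X q u v'"
        "dform w ?c X q (v + v') u = dform w ?c X q v u + dform w ?c X q v' u"
        unfolding deq[OF qV] linear_add[OF lc] inner_add_left by (simp_all add: sum.distrib[symmetric] algebra_simps)
      show "dform w ?c X q u (t *\<^sub>R v) = t *\<^sub>R dform w ?c X q u v"
        "dform w ?c X q (t *\<^sub>R v) u = t *\<^sub>R dform w ?c X q v u"
        unfolding deq[OF qV] linear_cmul[OF lc] inner_scaleR_left by (simp_all add: sum_distrib_left mult_ac)
    qed
    have dalt: "dform w ?c X q v v = 0" for v by (simp add: dform_def)
    define D where "D = \<bar>a * b' - b * a'\<bar>"
    have 1: "\<bar>dform w ?c X q y z\<bar> = D * \<delta> (chart_map ?c q)"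
      unfolding \<delta>eq[OF qV] D_def abs_mult[symmetric] using alt[OF dbil dalt] by simp
    have 2: "\<bar>w q y z\<bar> = D * \<mu> (chart_map ?c q)"
      unfolding \<mu>eq[OF qV] D_def abs_mult[symmetric] using alt[OF w_bilinear w_alt] by simp
    have 3: "\<mu> ?x / 2 < \<mu> (chart_map ?c q)" "\<nu> ?x / 2 < \<nu> (chart_map ?c q)" "\<delta> (chart_map ?c q) < \<delta> ?x + 1"
      using qS by (auto simp: S1_def)
    have "\<nu> (chart_map ?c q) \<le> k * nrm q (X q)" using U2(5)[of q "X q"] qV inv[OF qV] by (simp add: \<nu>_def V_def)
    \<comment> \<open>The section does not become short, so its norm can be inserted as a factor at
      the cost of a constant.\<close>
    then have 4: "1 \<le> k / (\<nu> ?x / 2) * nrm q (X q)" using 3(2) n U2(4) by (simp add: field_simps)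
    have D0: "0 \<le> D" by (simp add: D_def)
    have "\<bar>dform w ?c X q y z\<bar> \<le> D * (\<delta> ?x + 1)" unfolding 1 using 3(3) D0 by (intro mult_left_mono) auto
    also have "\<dots> = (\<delta> ?x + 1) / (\<mu> ?x / 2) * (D * (\<mu> ?x / 2))" using m by simp
    also have "\<dots> \<le> (\<delta> ?x + 1) / (\<mu> ?x / 2) * \<bar>w q y z\<bar>"
      unfolding 2 using 3(1) D0 \<delta>0 m by (intro mult_left_mono) auto
    also have "\<dots> \<le> ((\<delta> ?x + 1) / (\<mu> ?x / 2) * \<bar>w q y z\<bar>) * (k / (\<nu> ?x / 2) * nrm q (X q))"
    proof -
      have "0 \<le> (\<delta> ?x + 1) / (\<mu> ?x / 2) * \<bar>w q y z\<bar>" using \<delta>0 m by simp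
      from mult_left_mono[OF 4 this] show ?thesis by simp
    qed
    also have "\<dots> = K * (nrm q (X q) * \<bar>w q y z\<bar>)" by (simp add: K_def)
    finally show "\<bar>dform w ?c X q y z\<bar> \<le> K * (nrm q (X q) * \<bar>w q y z\<bar>)" .
  qed
qed

text \<open>The bound on \<open>dform\<close> is linear in the norm of the section and in the value
  of \<open>w\<close> on the two center vectors. Transported along the orbit, that value is constant
  while the section shrinks like lam^n, so a number that is invariant up to this scaling must be
  0.\<close>

lemma dform_stable_zero:
  assumes X: "line_frame Es c U X" and p: "p \<in> U" and y: "y \<in> Ec p" and z: "z \<in> Ec p"
  shows "dform w c X p y z = 0"
proof -
  obtain K where K: "\<And>q. \<exists>d V Y. line_frame Es d V Y \<and> q \<in> V \<and>
    (\<forall>y\<in>Ec q. \<forall>z\<in>Ec q. \<bar>dform w d Y q y z\<bar> \<le> K * (nrm q (Y q) * \<bar>w q y z\<bar>))"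
  proof (rule compact_uniform_bound[OF comp])
    fix p
    obtain U X where X: "line_frame Es (chart_at A p) U X" "p \<in> U"
      by (rule line_frame_exists[OF metric C1_s dim_s])
    show "\<exists>W K. open W \<and> p \<in> W \<and> (\<forall>q\<in>W. \<exists>d V Y. line_frame Es d V Y \<and> q \<in> V \<and>
      (\<forall>y\<in>Ec q. \<forall>z\<in>Ec q. \<bar>dform w d Y q y z\<bar> \<le> K * (nrm q (Y q) * \<bar>w q y z\<bar>)))"
      using dform_bound[OF X] X(1) by (meson subsetD)
  next
    fix q K K' assume "\<exists>d V Y. line_frame Es d V Y \<and> q \<in> V \<and>
      (\<forall>y\<in>Ec q. \<forall>z\<in>Ec q. \<bar>dform w d Y q y z\<bar> \<le> K * (nrm q (Y q) * \<bar>w q y z\<bar>))" "K \<le> (K' :: real)"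
    then show "\<exists>d V Y. line_frame Es d V Y \<and> q \<in> V \<and>
      (\<forall>y\<in>Ec q. \<forall>z\<in>Ec q. \<bar>dform w d Y q y z\<bar> \<le> K' * (nrm q (Y q) * \<bar>w q y z\<bar>))"
      by (meson abs_ge_zero mult_nonneg_nonneg mult_right_mono nrm_nonneg order_trans)
  qed (rule that)
  have sub: "\<And>q. subspace (Es q)" by (rule subspace_subbundle[OF cont(1)])
  have Ty: "T n p v \<in> Ec ((f ^^ n) p)" if "v \<in> Ec p" for n v using T_image[OF inv(2), of n p] that by blast
  have TX: "T n p v \<in> Es ((f ^^ n) p)" if "v \<in> Es p" for n v using T_image[OF inv(1), of n p] that by blast
  have Xp: "X p \<in> Es p" using X p by (simp add: line_frame_def)
  \<comment> \<open>Sections and charts change at every point of the orbit; the scalars that relate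
    the image of \<open>X p\<close> to the local sections multiply up to \<open>t\<close>.\<close>
  have chain: "dform w c X p y z = t * dform w d Y ((f ^^ n) p) (T n p y) (T n p z)"
    if "line_frame Es d V Y" "(f ^^ n) p \<in> V" "T n p (X p) = t *\<^sub>R Y ((f ^^ n) p)" for n d V Y t
    using that
  proof (induction n arbitrary: d V Y t)
    \<comment> \<open>The identity map takes the given section to \<open>Y\<close>, which may live
      in a different chart.\<close>
    case 0
    have T0: "T 0 p = (\<lambda>v. v)" using tangent_map_id by (simp add: id_def)
    have "dform w c X p y z = t * dform w d Y p (tangent_map A (\<lambda>p. p) p y) (tangent_map A (\<lambda>p. p) p z)"
      by (rule dform_invariant[OF dim_s sub Ck_map_id _ _ X 0(1) p])
        (use 0 T0 stable_center_orthogonal[OF Xp] y z in \<open>auto simp: tangent_map_id\<close>)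
    then show ?case using T0 by (simp add: tangent_map_id)
  next
    case (Suc n)
    let ?q = "(f ^^ n) p"
    obtain V' Y' where Y': "line_frame Es (chart_at A ?q) V' Y'" "?q \<in> V'"
      by (rule line_frame_exists[OF metric C1_s dim_s])
    have Y'0: "Y' ?q \<in> Es ?q" "Y' ?q \<noteq> 0" using Y' by (auto simp: line_frame_def)
    obtain t' where t': "T n p (X p) = t' *\<^sub>R Y' ?q"
      by (rule line_multiple[OF dim_s sub Y'0 TX[OF Xp, of n]])
    have Y0: "Y (f ?q) \<in> Es (f ?q)" "Y (f ?q) \<noteq> 0" using Suc.prems by (auto simp: line_frame_def)
    have "tangent_map A f ?q (Y' ?q) \<in> Es (f ?q)" using inv(1)[of ?q] Y'0 by blast
    then obtain s where s: "tangent_map A f ?q (Y' ?q) = s *\<^sub>R Y (f ?q)"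
      using line_multiple[OF dim_s sub Y0] by blast
    have "t *\<^sub>R Y (f ?q) = tangent_map A f ?q (T n p (X p))"
      using Suc.prems(3) unfolding tangent_map_funpow_Suc[OF f1] by simp
    also have "\<dots> = t' *\<^sub>R tangent_map A f ?q (Y' ?q)"
      unfolding t' by (rule linear_cmul[OF linear_tangent_map[OF f1]])
    also have "\<dots> = (t' * s) *\<^sub>R Y (f ?q)" by (simp add: s)
    finally have ts: "t = t' * s" using Y0 by simp
    have "dform w (chart_at A ?q) Y' ?q (T n p y) (T n p z) =
      s * dform w d Y (f ?q) (tangent_map A f ?q (T n p y)) (tangent_map A f ?q (T n p z))"
    proof (rule dform_invariant[OF dim_s sub f2 pull _ Y'(1) Suc.prems(1) Y'(2) _ s])
      show "tangent_map A f q v \<in> Es (f q)" if "v \<in> Es q" for q v using inv(1)[of q] that by blast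
      show "f ?q \<in> V" using Suc.prems(2) by simp
    qed (intro stable_center_orthogonal Y'0 Ty y z)+
    then show ?case using Suc.IH[OF Y' t'] ts unfolding tangent_map_funpow_Suc[OF f1] by simp
  qed
  define B where "B = \<bar>K\<bar> * C * nrm p (X p) * \<bar>w p y z\<bar>"
  have bd: "\<bar>dform w c X p y z\<bar> \<le> B * lam ^ n" if n: "1 \<le> n" for n
  proof -
    let ?q = "(f ^^ n) p"
    obtain d V Y where Y: "line_frame Es d V Y" "?q \<in> V"
      and bd: "\<forall>y\<in>Ec ?q. \<forall>z\<in>Ec ?q. \<bar>dform w d Y ?q y z\<bar> \<le> K * (nrm ?q (Y ?q) * \<bar>w ?q y z\<bar>)" using K by blast
    have Y0: "Y ?q \<in> Es ?q" "Y ?q \<noteq> 0" using Y by (auto simp: line_frame_def)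
    obtain t where t: "T n p (X p) = t *\<^sub>R Y ?q" by (rule line_multiple[OF dim_s sub Y0 TX[OF Xp, of n]])
    have "\<bar>dform w c X p y z\<bar> = \<bar>t\<bar> * \<bar>dform w d Y ?q (T n p y) (T n p z)\<bar>"
      unfolding chain[OF Y t] by (rule abs_mult)
    also have "\<dots> \<le> \<bar>t\<bar> * (K * (nrm ?q (Y ?q) * \<bar>w ?q (T n p y) (T n p z)\<bar>))"
      using bd Ty[OF y, of n] Ty[OF z, of n] by (intro mult_left_mono) auto
    \<comment> \<open>The scalar \<open>t\<close> and the local section recombine to the image of
      \<open>X p\<close>, so the choice of the section disappears from the bound.\<close>
    also have "\<dots> = K * (nrm ?q (T n p (X p)) * \<bar>w p y z\<bar>)" unfolding t nrm_scaleR w_T by simp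
    also have "\<dots> \<le> \<bar>K\<bar> * ((C * lam ^ n * nrm p (X p)) * \<bar>w p y z\<bar>)"
      using contr[OF n Xp] nrm_nonneg by (intro mult_mono mult_right_mono) auto
    finally show ?thesis by (simp add: B_def mult_ac)
  qed
  have "(\<lambda>n. B * lam ^ n) \<longlonglongrightarrow> B * 0" using lam by (intro tendsto_mult LIMSEQ_power_zero) auto
  then have "\<bar>dform w c X p y z\<bar> \<le> B * 0" by (rule LIMSEQ_le_const) (use bd in blast)
  then show ?thesis by simp
qed

lemma dform_unstable_zero:
  "line_frame Eu c U X \<Longrightarrow> p \<in> U \<Longrightarrow> y \<in> Ec p \<Longrightarrow> z \<in> Ec p \<Longrightarrow> dform w c X p y z = 0"
  by (rule symplectic_splitting.dform_stable_zero[OF inverse_splitting])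

end

section \<open>Charts adapted to the center bundle\<close>

context atlas
begin

text \<open>A chart of the atlas, restricted to the part over \<open>V\<close> and followed by a C^1
  change of coordinates, still belongs to the C^1 structure, and \<Theta> acts on coordinates of
  tangent vectors through its derivative.\<close>

lemma reparametrized_chart:
  assumes c: "c \<in> A" and V: "open V" "V \<subseteq> chart_map c ` chart_dom c" and B: "open B"
    and hom: "homeomorphism B V \<Phi> \<Theta>" and \<Phi>: "Ck_on 1 \<Phi> B" and \<Theta>: "Ck_on 1 \<Theta> V"
  defines "c' \<equiv> (chart_dom c \<inter> chart_map c -` V, \<Theta> \<circ> chart_map c)"
  shows "Ck_chart A 1 c'" and "chart_map c' ` chart_dom c' = B"
    and "\<And>q v. q \<in> chart_dom c' \<Longrightarrow> coord A c' q v = frechet_derivative \<Theta> (at (chart_map c q)) (coord A c q v)"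
proof -
  note cC = Ck_chart_atlas[OF c, of 1] note ic = is_chart[OF cC]
  have dom: "chart_dom c' = chart_dom c \<inter> chart_map c -` V" and map: "chart_map c' = \<Theta> \<circ> chart_map c"
    by (simp_all add: c'_def)
  have imV: "chart_map c ` chart_dom c' = V" using V(2) by (auto simp: dom)
  show imB: "chart_map c' ` chart_dom c' = B"
    unfolding map image_comp[symmetric] imV using hom by (simp add: homeomorphism_def)
  have \<Phi>V: "\<Phi> x \<in> V" "\<Theta> (\<Phi> x) = x" if "x \<in> B" for x using hom that by (auto simp: homeomorphism_def)
  have \<Theta>B: "\<Theta> z \<in> B" "\<Phi> (\<Theta> z) = z" if "z \<in> V" for z using hom that by (auto simp: homeomorphism_def)
  have inj: "inj_on (chart_map c') (chart_dom c')"
  proof (rule inj_onI)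
    fix q r assume *: "q \<in> chart_dom c'" "r \<in> chart_dom c'" "chart_map c' q = chart_map c' r"
    then have "\<Theta> (chart_map c q) = \<Theta> (chart_map c r)" "chart_map c q \<in> V" "chart_map c r \<in> V"
      by (simp_all add: dom map)
    then have "chart_map c q = chart_map c r" using \<Theta>B(2) by metis
    moreover have "q \<in> chart_dom c" "r \<in> chart_dom c" using *(1,2) by (simp_all add: dom)
    ultimately show "q = r" using chart_inv_map[OF ic] by metis
  qed
  have inv_dom: "chart_inv c (\<Phi> x) \<in> chart_dom c'" if "x \<in> B" for x
    using \<Phi>V[OF that] V(2) chart_inv_in_dom[OF ic] chart_map_inv[OF ic] by (auto simp: dom)
  have inv: "chart_inv c' x = chart_inv c (\<Phi> x)" if x: "x \<in> B" for x
    unfolding chart_inv_def[of c']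
  proof (rule inv_into_f_eq[OF inj inv_dom[OF x]])
    have "chart_map c (chart_inv c (\<Phi> x)) = \<Phi> x" using \<Phi>V[OF x] V(2) by (intro chart_map_inv[OF ic]) auto
    then show "chart_map c' (chart_inv c (\<Phi> x)) = x" using \<Phi>V[OF x] by (simp add: map)
  qed
  have chart': "is_chart c'"
    unfolding is_chart_def imB
  proof (intro conjI B homeomorphismI)
    show "open (chart_dom c')" unfolding dom by (rule open_chart_preimage[OF ic V(1)])
    show "continuous_on (chart_dom c') (chart_map c')" unfolding map
      by (rule continuous_on_compose[OF continuous_on_subset[OF chart_map_continuous[OF ic]]])
        (use imV homeomorphism_cont2[OF hom] in \<open>auto simp: dom\<close>)
    have "continuous_on B (\<lambda>x. chart_inv c (\<Phi> x))"
      by (rule continuous_on_compose2[OF chart_inv_continuous[OF ic] homeomorphism_cont1[OF hom]])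
        (use \<Phi>V V(2) in auto)
    then show "continuous_on B (chart_inv c')" using inv by (simp cong: continuous_on_cong)
    show "chart_map c' ` chart_dom c' \<subseteq> B" using imB by simp
    show "chart_inv c' ` B \<subseteq> chart_dom c'" using inv inv_dom by auto
    show "chart_inv c' (chart_map c' q) = q" if "q \<in> chart_dom c'" for q
      using inj that by (simp add: chart_inv_def)
    show "chart_map c' (chart_inv c' x) = x" if "x \<in> B" for x
      using that imB unfolding chart_inv_def by (metis f_inv_into_f)
  qed
  have tr2: "transition d c' = (\<lambda>x. \<Theta> (transition d c x))" for d
    by (auto simp: transition_def map)
  show C1': "Ck_chart A 1 c'"
    unfolding Ck_chart_def
  proof (intro conjI ballI chart')
    fix d assume d: "d \<in> A"
    have dC: "Ck_chart A 1 d" by (rule Ck_chart_atlas[OF d])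
    have id: "is_chart d" by (rule is_chart[OF dC])
    have T: "Ck_on 1 (transition c d) (chart_map c ` (chart_dom c \<inter> chart_dom d))"
      "Ck_on 1 (transition d c) (chart_map d ` (chart_dom c \<inter> chart_dom d))"
      using cC d by (auto simp: Ck_chart_def simp del: Ck_on.simps One_nat_def)
    let ?D = "chart_map c' ` (chart_dom c' \<inter> chart_dom d)"
    have opD: "open ?D" using id by (intro open_chart_image chart') (simp add: is_chart_def)
    have DB: "?D \<subseteq> B" using imB by auto
    have "\<Phi> ` ?D \<subseteq> chart_map c ` (chart_dom c \<inter> chart_dom d)"
      using \<Theta>B(2) by (auto simp: map dom)
    then have C1: "Ck_on 1 (\<lambda>x. transition c d (\<Phi> x)) ?D"
      by (rule C1_on_compose[OF Ck_on_subset[OF \<Phi> DB] T(1)])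
    have "transition c d (\<Phi> x) = transition c' d x" if "x \<in> ?D" for x
      using inv[of x] that DB by (auto simp: transition_def)
    from Ck_on_cong[OF opD this, THEN iffD1, OF _ C1] show "Ck_on 1 (transition c' d) ?D" by simp
    show "Ck_on 1 (transition d c') (chart_map d ` (chart_dom c' \<inter> chart_dom d))"
      unfolding tr2
    proof (rule C1_on_compose[OF Ck_on_subset[OF T(2)] \<Theta>])
      show "transition d c ` chart_map d ` (chart_dom c' \<inter> chart_dom d) \<subseteq> V"
        using chart_inv_map[OF id] by (auto simp: transition_def dom)
    qed (auto simp: dom)
  qed
  fix q v assume q: "q \<in> chart_dom c'"
  then have qc: "q \<in> chart_dom c" "chart_map c q \<in> V" by (auto simp: dom)
  have "transition (chart_at A q) c (chart_map (chart_at A q) q) = chart_map c q"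
    using chart_inv_map[OF is_chart_at chart_at(2)] by (simp add: transition_def)
  then have D: "(\<Theta> has_derivative frechet_derivative \<Theta> (at (chart_map c q)))
      (at (transition (chart_at A q) c (chart_map (chart_at A q) q)))"
    using C1_on_has_derivative[OF \<Theta> qc(2)] by simp
  have "(transition (chart_at A q) c' has_derivative
    (\<lambda>v. frechet_derivative \<Theta> (at (chart_map c q)) (coord A c q v))) (at (chart_map (chart_at A q) q))"
    unfolding tr2 by (rule has_derivative_compose[OF coord_has_derivative(1)[OF cC qc(1)] D])
  from has_derivative_unique[OF coord_has_derivative(1)[OF C1' q] this]
  show "coord A c' q v = frechet_derivative \<Theta> (at (chart_map c q)) (coord A c q v)" by simp
qed

end

lemma inverse_derivatives:
  assumes hom: "homeomorphism B V \<Phi> \<Theta>" and B: "open B" and V: "open V"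
    and \<Phi>: "Ck_on 1 \<Phi> B" and \<Theta>: "Ck_on 1 \<Theta> V" and x: "x \<in> B"
  shows "frechet_derivative \<Theta> (at (\<Phi> x)) (frechet_derivative \<Phi> (at x) v) = v"
    and "frechet_derivative \<Phi> (at x) (frechet_derivative \<Theta> (at (\<Phi> x)) v) = v"
proof -
  have zV: "\<Phi> x \<in> V" "\<Theta> (\<Phi> x) = x" using hom x by (auto simp: homeomorphism_def)
  have D: "(\<Phi> has_derivative frechet_derivative \<Phi> (at x)) (at x)"
    "(\<Theta> has_derivative frechet_derivative \<Theta> (at (\<Phi> x))) (at (\<Phi> x))"
    using C1_on_has_derivative[OF \<Phi> x] C1_on_has_derivative[OF \<Theta> zV(1)] by blast+
  have "((\<lambda>x. \<Theta> (\<Phi> x)) has_derivative (\<lambda>v. frechet_derivative \<Theta> (at (\<Phi> x)) (frechet_derivative \<Phi> (at x) v))) (at x)"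
    by (rule has_derivative_compose[OF D])
  then have "((\<lambda>x. x) has_derivative (\<lambda>v. frechet_derivative \<Theta> (at (\<Phi> x)) (frechet_derivative \<Phi> (at x) v))) (at x)"
    by (rule has_derivative_transform_within_open[OF _ B x]) (use hom in \<open>auto simp: homeomorphism_def\<close>)
  from has_derivative_unique[OF this has_derivative_ident]
  show "frechet_derivative \<Theta> (at (\<Phi> x)) (frechet_derivative \<Phi> (at x) v) = v" by meson
  have "((\<lambda>z. \<Phi> (\<Theta> z)) has_derivative (\<lambda>v. frechet_derivative \<Phi> (at x) (frechet_derivative \<Theta> (at (\<Phi> x)) v))) (at (\<Phi> x))"
    by (rule has_derivative_compose[OF D(2)]) (simp add: zV D(1))
  then have "((\<lambda>z. z) has_derivative (\<lambda>v. frechet_derivative \<Phi> (at x) (frechet_derivative \<Theta> (at (\<Phi> x)) v))) (at (\<Phi> x))"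
    by (rule has_derivative_transform_within_open[OF _ V zV(1)]) (use hom in \<open>auto simp: homeomorphism_def\<close>)
  from has_derivative_unique[OF this has_derivative_ident]
  show "frechet_derivative \<Phi> (at x) (frechet_derivative \<Theta> (at (\<Phi> x)) v) = v" by meson
qed

text \<open>One direction is the orthogonality already shown. For the other, w(X, Y) is nonzero, so
  pairing with \<open>X\<close> reads off the unstable component of a vector and pairing with
  \<open>Y\<close> its stable component.\<close>

lemma (in symplectic_splitting) center_iff_orthogonal:
  assumes X: "X \<in> Es q" "X \<noteq> 0" and Y: "Y \<in> Eu q" "Y \<noteq> 0"
  shows "v \<in> Ec q \<longleftrightarrow> w q X v = 0 \<and> w q Y v = 0"
proof
  assume "v \<in> Ec q"
  then show "w q X v = 0 \<and> w q Y v = 0"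
    using stable_center_orthogonal[OF X(1)] unstable_center_orthogonal[OF Y(1)] by blast
next
  assume v: "w q X v = 0 \<and> w q Y v = 0"
  obtain a b e where abe: "a \<in> Es q" "b \<in> Ec q" "e \<in> Eu q" "v = a + b + e" using decomp by blast
  obtain s where s: "a = s *\<^sub>R X" by (rule line_multiple[OF dim_s subspace_subbundle[OF cont(1)] X abe(1)])
  obtain t where t: "e = t *\<^sub>R Y" by (rule line_multiple[OF dim_u subspace_subbundle[OF cont(3)] Y abe(3)])
  have b: "w q X b = 0" "w q Y b = 0"
    using stable_center_orthogonal[OF X(1) abe(2)] unstable_center_orthogonal[OF Y(1) abe(2)] by auto
  \<comment> \<open>If this number were 0, \<open>X\<close> would be orthogonal to all three
    bundles.\<close>
  have XY: "w q X Y \<noteq> 0"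
  proof
    assume 0: "w q X Y = 0"
    have "X = 0"
    proof (rule w_nondeg)
      fix u
      obtain a b e where u: "a \<in> Es q" "b \<in> Ec q" "e \<in> Eu q" "u = a + b + e" using decomp by blast
      obtain s where s: "a = s *\<^sub>R X" by (rule line_multiple[OF dim_s subspace_subbundle[OF cont(1)] X u(1)])
      obtain t where t: "e = t *\<^sub>R Y" by (rule line_multiple[OF dim_u subspace_subbundle[OF cont(3)] Y u(3)])
      show "w q X u = 0" using stable_center_orthogonal[OF X(1) u(2)] 0 w_alt
        by (simp add: u(4) s t bilinear_radd[OF w_bilinear] bilinear_rmul[OF w_bilinear])
    qed
    then show False using X by simp
  qed
  have "w q X v = t * w q X Y" "w q Y v = s * w q Y X"
    using b w_alt by (simp_all add: abe(4) s t bilinear_radd[OF w_bilinear] bilinear_rmul[OF w_bilinear])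
  then have "s = 0" "t = 0" using v XY w_skew[of q Y X] by auto
  then show "v \<in> Ec q" using abe s t by simp
qed

section \<open>Frobenius charts for the center bundle\<close>

locale symplectic_splitting_4 = symplectic_splitting A g w f h Es Ec Eu lam C
  for A :: "('m::t2_space, real ^ 4) chart set" and g w f h Es Ec Eu lam C
begin

abbreviation e3 :: "real ^ 4" where "e3 \<equiv> axis 3 1"
abbreviation e4 :: "real ^ 4" where "e4 \<equiv> axis 4 1"

lemma e34 [simp]: "e3 \<in> Basis" "e4 \<in> Basis" "e3 \<bullet> e4 = 0" "e4 \<bullet> e3 = 0" "e3 \<bullet> e3 = 1" "e4 \<bullet> e4 = 1" "e3 \<noteq> e4"
  by (auto simp: Basis_vec_def inner_axis_axis axis_eq_axis)

lemma card_center_coordinates: "card (Basis - {e3, e4}) = 2"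
  by (subst card_Diff_subset) auto

sublocale plane_field A Ec "Basis - {e3, e4}"
  by unfold_locales (use dim_c card_center_coordinates in auto)

text \<open>The forms w(X3, .) and w(X4, .) cut out the center planes. Two constant forms complete
  them to a coframe for Frobenius' theorem: constant forms are closed, and the exterior derivatives
  of the other two vanish on the center planes.\<close>

lemma center_chart_exists: "\<exists>c. center_chart c \<and> p \<in> chart_dom c"
proof -
  define c where "c = chart_at A p"
  have c: "c \<in> A" "p \<in> chart_dom c" by (simp_all add: c_def chart_at)
  note cC = Ck_chart_atlas[OF c(1), of 1] note ic = is_chart[OF cC]
  obtain U3 X3 where F3: "line_frame Es c U3 X3" "p \<in> U3"
    unfolding c_def by (rule line_frame_exists[OF metric C1_s dim_s])
  obtain U4 X4 where F4: "line_frame Eu c U4 X4" "p \<in> U4"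
    unfolding c_def by (rule line_frame_exists[OF metric C1_u dim_u])
  define U where "U = U3 \<inter> U4"
  have U: "open U" "p \<in> U" "U \<subseteq> chart_dom c" using F3 F4 by (auto simp: U_def line_frame_def)
  define S where "S = chart_map c ` U"
  have opS: "open S" using open_chart_image[OF ic U(1)] U(3) by (simp add: S_def Int_absorb1)
  let ?x = "chart_map c p"
  have xS: "?x \<in> S" using U by (auto simp: S_def)
  define \<alpha> where "\<alpha> = form_along w c X3"
  define \<beta> where "\<beta> = form_along w c X4"
  have \<alpha>C: "Ck_on 1 (\<lambda>x. \<alpha> x v) S" for v unfolding \<alpha>_def
    by (rule Ck_on_subset[OF form_along_C1[OF w_smooth F3(1)]]) (auto simp: S_def U_def)
  have \<beta>C: "Ck_on 1 (\<lambda>x. \<beta> x v) S" for v unfolding \<beta>_def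
    by (rule Ck_on_subset[OF form_along_C1[OF w_smooth F4(1)]]) (auto simp: S_def U_def)
  have lin: "linear (\<alpha> x)" "linear (\<beta> x)" if "x \<in> S" for x
  proof -
    have "x \<in> chart_map c ` chart_dom c" using that U(3) unfolding S_def by blast
    then show "linear (\<alpha> x)" "linear (\<beta> x)"
      unfolding \<alpha>_def \<beta>_def by (rule form_along_linear[OF w_bilinear c(1)])+
  qed
  have Ec_iff: "v \<in> Ec q \<longleftrightarrow> \<alpha> (chart_map c q) (coord A c q v) = 0 \<and> \<beta> (chart_map c q) (coord A c q v) = 0"
    if q: "q \<in> U" for q v
  proof -
    have qc: "q \<in> chart_dom c" using q U(3) by auto
    have "X3 q \<in> Es q" "X3 q \<noteq> 0" "X4 q \<in> Eu q" "X4 q \<noteq> 0"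
      using F3 F4 q by (auto simp: U_def line_frame_def)
    then show ?thesis unfolding \<alpha>_def \<beta>_def form_along_coord[OF c(1) qc] by (rule center_iff_orthogonal)
  qed
  define Ex where "Ex = coord A c p ` Ec p"
  have subE: "subspace (Ec p)" by (rule subspace_subbundle[OF cont(2)])
  have linc: "linear (coord A c p)" by (rule linear_coord(1)[OF cC c(2)])
  have injc: "inj (coord A c p)" by (rule injI) (metis coord_coord_inv(2)[OF cC c(2)])
  have "dim Ex = 2" unfolding Ex_def using dim_image_eq[OF linc] injc dim_c by (metis inj_on_subset subset_UNIV)
  moreover have "dim (span (Basis - {e3, e4})) = 2"
    using dim_coord_plane[of "Basis - {e3, e4}"] coord_plane_span[of "Basis - {e3, e4}"] card_center_coordinates by simp
  ultimately have "dim Ex = dim (span (Basis - {e3, e4}))" by simp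
  \<comment> \<open>A linear map that takes the center plane at \<open>p\<close>, in coordinates,
    one-to-one onto the plane orthogonal to \<open>e3\<close> and \<open>e4\<close>; it supplies the
    two constant forms.\<close>
  then obtain m m' where m: "linear m" "m ` Ex = span (Basis - {e3, e4})" "\<And>x. x \<in> Ex \<Longrightarrow> m' (m x) = x"
    using isometries_subspaces[of Ex "span (Basis - {e3, e4})"] linear_subspace_image[OF linc subE] subspace_span
    unfolding Ex_def by metis
  define \<pi> where "\<pi> v = v - (v \<bullet> e3) *\<^sub>R e3 - (v \<bullet> e4) *\<^sub>R e4" for v
  have \<pi>lin: "linear \<pi>" unfolding \<pi>_def
    by (intro linearI) (simp_all add: inner_add_left algebra_simps)
  have \<pi>inner: "\<pi> v \<bullet> e3 = 0" "\<pi> v \<bullet> e4 = 0" for v by (simp_all add: \<pi>_def inner_diff_left)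
  have \<pi>iff: "\<pi> v = v \<longleftrightarrow> v \<bullet> e3 = 0 \<and> v \<bullet> e4 = 0" for v
  proof
    show "v \<bullet> e3 = 0 \<and> v \<bullet> e4 = 0" if "\<pi> v = v" using \<pi>inner[of v] that by simp
  qed (simp add: \<pi>_def)
  have \<pi>\<pi>: "\<pi> (\<pi> v) = \<pi> v" for v using \<pi>iff \<pi>inner by blast
  \<comment> \<open>The projection \<pi> removes what \<open>m\<close> may contribute along
    \<open>e3\<close> and \<open>e4\<close>. The components in these directions are then exactly
    \<alpha> and \<beta>, and a vector is central if and only if \<pi> fixes its image under the
    coframe.\<close>
  define M where "M x v = \<pi> (m v) + \<alpha> x v *\<^sub>R e3 + \<beta> x v *\<^sub>R e4" for x v
  have M3: "M x v \<bullet> e3 = \<alpha> x v" and M4: "M x v \<bullet> e4 = \<beta> x v" for x v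
    by (simp_all add: M_def inner_add_left \<pi>inner)
  have \<pi>Miff: "\<pi> (M x v) = M x v \<longleftrightarrow> \<alpha> x v = 0 \<and> \<beta> x v = 0" for x v unfolding \<pi>iff M3 M4 ..
  have Mlin: "linear (M x)" if "x \<in> S" for x
    unfolding M_def[abs_def] using lin[OF that] m(1) \<pi>lin
    by (intro linearI) (simp_all add: linear_add linear_cmul algebra_simps)
  have MC: "Ck_on 1 (\<lambda>x. M x v) S" for v
    unfolding M_def by (intro C1_on_add C1_on_scaleR C1_on_const \<alpha>C \<beta>C)
  have Minj: "inj (M ?x)"
    unfolding linear_injective_0[OF Mlin[OF xS]]
  proof (intro allI impI)
    fix v assume 0: "M ?x v = 0"
    then have ab: "\<alpha> ?x v = 0" "\<beta> ?x v = 0" using M3[of ?x v] M4[of ?x v] by simp_all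
    have "coord_inv A c p v \<in> Ec p" using Ec_iff[OF U(2)] ab coord_coord_inv(1)[OF cC c(2)] by simp
    then have vE: "v \<in> Ex" unfolding Ex_def using coord_coord_inv(1)[OF cC c(2), of v] by (metis image_eqI)
    then have "m v \<in> coord_plane (Basis - {e3, e4}) 0" using m(2) coord_plane_span[of "Basis - {e3, e4}"] by auto
    then have "\<pi> (m v) = m v" unfolding \<pi>iff by (auto simp: coord_plane_def)
    moreover have "\<pi> (m v) = 0" using 0 ab by (simp add: M_def)
    ultimately have "m v = m 0" using linear_0[OF m(1)] by simp
    moreover have "0 \<in> Ex" unfolding Ex_def using subspace_0[OF subE] linear_0[OF linc] by (metis image_eqI)
    ultimately show "v = 0" using m(3) vE by metis
  qed
  \<comment> \<open>The part \<pi> (m v) does not depend on the point, so only \<alpha> and \<beta>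
    are differentiated; on the center plane their derivatives are symmetric because
    \<open>dform\<close> vanishes there.\<close>
  have integ: "frechet_derivative (\<lambda>z. M z u) (at z) v = frechet_derivative (\<lambda>z. M z v) (at z) u"
    if z: "z \<in> S" and u: "\<pi> (M z u) = M z u" and v: "\<pi> (M z v) = M z v" for z u v
  proof -
    obtain q where q: "q \<in> U" "z = chart_map c q" using z by (auto simp: S_def)
    have qc: "q \<in> chart_dom c" using q U(3) by auto
    define y y' where "y = coord_inv A c q u" and "y' = coord_inv A c q v"
    have cy: "coord A c q y = u" "coord A c q y' = v" using coord_coord_inv(1)[OF cC qc] by (simp_all add: y_def y'_def)
    have "y \<in> Ec q" "y' \<in> Ec q" using u v unfolding \<pi>Miff Ec_iff[OF q(1)] cy by (simp_all add: q(2))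
    then have "dform w c X3 q y' y = 0" "dform w c X4 q y' y = 0"
      using dform_stable_zero[OF F3(1)] dform_unstable_zero[OF F4(1)] q(1) by (auto simp: U_def)
    then have sym: "frechet_derivative (\<lambda>x. \<alpha> x u) (at z) v = frechet_derivative (\<lambda>x. \<alpha> x v) (at z) u"
      "frechet_derivative (\<lambda>x. \<beta> x u) (at z) v = frechet_derivative (\<lambda>x. \<beta> x v) (at z) u"
      unfolding dform_def cy \<alpha>_def \<beta>_def q(2) by simp_all
    have D: "frechet_derivative (\<lambda>x. M x u) (at z) = (\<lambda>v. frechet_derivative (\<lambda>x. \<alpha> x u) (at z) v *\<^sub>R e3
      + frechet_derivative (\<lambda>x. \<beta> x u) (at z) v *\<^sub>R e4)" for u
    proof -
      have "((\<lambda>x. M x u) has_derivative (\<lambda>v. 0 + frechet_derivative (\<lambda>x. \<alpha> x u) (at z) v *\<^sub>R e3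
        + frechet_derivative (\<lambda>x. \<beta> x u) (at z) v *\<^sub>R e4)) (at z)" unfolding M_def
        by (intro has_derivative_add has_derivative_const has_derivative_scaleR_left
            C1_on_has_derivative[OF \<alpha>C z] C1_on_has_derivative[OF \<beta>C z])
      from frechet_derivative_at[OF this] show ?thesis by simp
    qed
    show ?thesis unfolding D sym ..
  qed
  obtain W V \<Phi> \<Theta> where W: "open W" "0 \<in> W" and V: "open V" "V \<subseteq> S" and \<Phi>0: "\<Phi> 0 = ?x"
    and hom: "homeomorphism W V \<Phi> \<Theta>" and \<Phi>C: "Ck_on 1 \<Phi> W" and \<Theta>C: "Ck_on 1 \<Theta> V"
    and M\<Phi>: "\<And>\<xi> k. \<xi> \<in> W \<Longrightarrow> M (\<Phi> \<xi>) (frechet_derivative \<Phi> (at \<xi>) (\<pi> k)) = \<pi> k"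
    and Minj': "\<And>z. z \<in> V \<Longrightarrow> inj (M z)"
  proof (rule frobenius[where M=M and p=\<pi>, OF opS xS Mlin MC Minj \<pi>lin \<pi>\<pi>])
    show "frechet_derivative (\<lambda>z. M z u) (at z) v = frechet_derivative (\<lambda>z. M z v) (at z) u"
      if "z \<in> S" "\<pi> (M z u) = M z u" "\<pi> (M z v) = M z v" for z u v by (rule integ[OF that])
  qed (assumption | rule that)+
  obtain e where "e > 0" "ball 0 e \<subseteq> W" using W open_contains_ball by blast
  \<comment> \<open>The domain is cut down to a box around 0, the shape that
    \<open>center_chart\<close> prescribes.\<close>
  then obtain a b where ab: "0 \<in> box a b" "box a b \<subseteq> W" using rational_boxes[of e "0 :: real ^ 4"] by blast
  define V' where "V' = \<Phi> ` box a b"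
  have hom': "homeomorphism (box a b) V' \<Phi> \<Theta>"
    unfolding V'_def by (rule homeomorphism_of_subsets[OF hom ab(2)]) (use hom ab(2) in \<open>auto simp: homeomorphism_def\<close>)
  have V'V: "V' \<subseteq> V" using hom ab(2) by (auto simp: V'_def homeomorphism_def)
  have opV': "open V'"
  proof -
    have "openin (top_of_set V) V'" unfolding V'_def
      by (rule homeomorphism_imp_open_map[OF hom]) (use ab(2) in \<open>auto simp: openin_open\<close>)
    then show ?thesis using V(1) openin_open_eq by blast
  qed
  have V'S: "V' \<subseteq> chart_map c ` chart_dom c" "V' \<subseteq> S" using V'V V(2) U(3) unfolding S_def by blast+
  define c' where "c' = (chart_dom c \<inter> chart_map c -` V', \<Theta> \<circ> chart_map c)"
  note re = reparametrized_chart[OF c(1) opV' V'S(1) open_box hom' Ck_on_subset[OF \<Phi>C ab(2)] Ck_on_subset[OF \<Theta>C V'V], folded c'_def]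
  have "center_chart c'"
    unfolding center_chart_def
  proof (intro conjI ballI re(1))
    show "\<exists>a b. chart_map c' ` chart_dom c' = box a b" using re(2) by blast
    fix q assume q: "q \<in> chart_dom c'"
    then have qc: "q \<in> chart_dom c" "chart_map c q \<in> V'" by (auto simp: c'_def)
    define \<xi> where "\<xi> = \<Theta> (chart_map c q)"
    have \<xi>: "\<xi> \<in> box a b" "\<Phi> \<xi> = chart_map c q" using hom' qc(2) by (auto simp: homeomorphism_def \<xi>_def)
    have \<xi>W: "\<xi> \<in> W" using \<xi> ab by auto
    have qU: "q \<in> U"
    proof -
      obtain r where "r \<in> U" "chart_map c q = chart_map c r" using qc(2) V'S(2) by (auto simp: S_def)
      then show ?thesis using chart_inv_map[OF ic] U(3) qc(1) by (metis subsetD)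
    qed
    let ?D\<Phi> = "frechet_derivative \<Phi> (at \<xi>)" and ?D\<Theta> = "frechet_derivative \<Theta> (at (\<Phi> \<xi>))"
    note inv = inverse_derivatives[OF hom W(1) V(1) \<Phi>C \<Theta>C \<xi>W]
    have co: "coord A c' q v = ?D\<Theta> (coord A c q v)" for v using re(3)[OF q] \<xi>(2) by simp
    have Ec_M: "v \<in> Ec q \<longleftrightarrow> \<pi> (M (\<Phi> \<xi>) (coord A c q v)) = M (\<Phi> \<xi>) (coord A c q v)" for v
      unfolding \<pi>Miff \<xi>(2) by (rule Ec_iff[OF qU])
    \<comment> \<open>The conclusion of Frobenius' theorem shows at once that a vector whose new
      coordinates are fixed by \<pi> is central; the converse also uses that the coframe is
      injective.\<close>
    have "(\<forall>b\<in>Basis - (Basis - {e3, e4}). coord A c' q v \<bullet> b = 0) \<longleftrightarrow> v \<in> Ec q" for v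
    proof -
      have "Basis - (Basis - {e3, e4}) = {e3, e4}" by auto
      then have "(\<forall>b\<in>Basis - (Basis - {e3, e4}). coord A c' q v \<bullet> b = 0) \<longleftrightarrow> \<pi> (?D\<Theta> (coord A c q v)) = ?D\<Theta> (coord A c q v)"
        unfolding \<pi>iff co by simp
      also have "\<dots> \<longleftrightarrow> v \<in> Ec q"
        unfolding Ec_M
      proof
        assume *: "\<pi> (?D\<Theta> (coord A c q v)) = ?D\<Theta> (coord A c q v)"
        then have "M (\<Phi> \<xi>) (coord A c q v) = ?D\<Theta> (coord A c q v)"
          using M\<Phi>[OF \<xi>W, of "?D\<Theta> (coord A c q v)"] inv(2) by simp
        then show "\<pi> (M (\<Phi> \<xi>) (coord A c q v)) = M (\<Phi> \<xi>) (coord A c q v)" using * by simp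
      next
        assume *: "\<pi> (M (\<Phi> \<xi>) (coord A c q v)) = M (\<Phi> \<xi>) (coord A c q v)"
        then have "M (\<Phi> \<xi>) (?D\<Phi> (M (\<Phi> \<xi>) (coord A c q v))) = M (\<Phi> \<xi>) (coord A c q v)"
          using M\<Phi>[OF \<xi>W, of "M (\<Phi> \<xi>) (coord A c q v)"] by simp
        moreover have "\<Phi> \<xi> \<in> V" using \<xi>(2) qc(2) V'V by auto
        ultimately have "?D\<Phi> (M (\<Phi> \<xi>) (coord A c q v)) = coord A c q v" using Minj' by (meson injD)
        then have "?D\<Theta> (coord A c q v) = M (\<Phi> \<xi>) (coord A c q v)" using inv(1) by metis
        then show "\<pi> (?D\<Theta> (coord A c q v)) = ?D\<Theta> (coord A c q v)" using * by simp
      qed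
      finally show ?thesis .
    qed
    then show "{v. \<forall>b\<in>Basis - (Basis - {e3, e4}). coord A c' q v \<bullet> b = 0} = Ec q" by blast
  qed
  moreover have "?x \<in> V'" unfolding V'_def using ab(1) \<Phi>0 by (metis image_eqI)
  then have "p \<in> chart_dom c'" using c(2) by (simp add: c'_def)
  ultimately show ?thesis by blast
qed

lemma preserving_center: "preserving f" "preserving h"
proof -
  show "preserving f" using f1 inv(2) by (auto simp: preserving_def)
  have "tangent_map A h p ` Ec p = Ec (h p)" for p
    by (rule symplectic_splitting.inv(2)[OF inverse_splitting])
  then show "preserving h" using h1 by (auto simp: preserving_def)
qed

end

section \<open>The center foliation\<close>

text \<open>Two applications of the dimension formula for sums of subspaces; it yields the dimension
  of the center bundle from those of the line bundles.\<close>

lemma dim_middle_summand: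
  fixes S T U :: "'e::euclidean_space set"
  assumes sub: "subspace S" "subspace T" "subspace U"
    and ex: "\<And>v. \<exists>a\<in>S. \<exists>b\<in>T. \<exists>c\<in>U. v = a + b + c"
    and uniq: "\<And>a b c. a \<in> S \<Longrightarrow> b \<in> T \<Longrightarrow> c \<in> U \<Longrightarrow> a + b + c = 0 \<Longrightarrow> a = 0 \<and> b = 0 \<and> c = 0"
  shows "dim S + dim T + dim U = DIM('e)"
proof -
  let ?ST = "{x + y |x y. x \<in> S \<and> y \<in> T}"
  have "S \<inter> T \<subseteq> {0}"
  proof
    fix v assume "v \<in> S \<inter> T"
    then show "v \<in> {0}" using uniq[of v "- v" 0] sub by (auto simp: subspace_neg subspace_0)
  qed
  then have 1: "dim (S \<inter> T) = 0" by (simp only: dim_eq_0)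
  have "?ST \<inter> U \<subseteq> {0}"
  proof
    fix v assume "v \<in> ?ST \<inter> U"
    then obtain x y where xy: "x \<in> S" "y \<in> T" "v = x + y" "v \<in> U" by blast
    have "x = 0 \<and> y = 0 \<and> - v = 0"
      by (rule uniq[OF xy(1,2) subspace_neg[OF sub(3) xy(4)]]) (simp add: xy(3))
    then show "v \<in> {0}" by simp
  qed
  then have 2: "dim (?ST \<inter> U) = 0" by (simp only: dim_eq_0)
  have "v \<in> {x + y |x y. x \<in> ?ST \<and> y \<in> U}" for v using ex[of v] by blast
  then have "{x + y |x y. x \<in> ?ST \<and> y \<in> U} = UNIV" by blast
  then show ?thesis
    using dim_sums_Int[OF sub(1,2)] dim_sums_Int[OF subspace_sums[OF sub(1,2)] sub(3)] 1 2 by simp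
qed

text \<open>The rates are brought into homogeneous form: quotients for unit vectors become products
  for all vectors, 0 included, and the contraction of \<open>Eu\<close> under the inverse becomes an
  expansion under \<open>f\<close>.\<close>

lemma (in atlas) partially_hyperbolic_splitting:
  assumes comp: "compact (UNIV :: 'm set)" and metric: "riemannian_metric A g" and symplectic: "symplectic_form A w"
    and f2: "Ck_diffeo A 2 f"
    and ph: "partially_hyperbolic_symplectomorphism A g w f Es Ec Eu"
    and dims: "\<And>p. dim (Es p) = 1" "\<And>p. dim (Eu p) = 1" and C1: "Ck_subbundle A 1 Es" "Ck_subbundle A 1 Eu"
    and dim4: "DIM('e) = 4"
  obtains lam C where "symplectic_splitting A g w f (inv f) Es Ec Eu lam C"
proof -
  have bij: "bij f" and fC: "Ck_map A 2 f" and hC: "Ck_map A 2 (inv f)" using f2 by (auto simp: Ck_diffeo_def)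
  have hf: "inv f (f x) = x" and fh: "f (inv f x) = x" for x using bij by (simp_all add: bij_is_inj bij_is_surj surj_f_inv_f)
  have f1: "Ck_map A 1 f" and h1: "Ck_map A 1 (inv f)" using Ck_map_le[OF fC] Ck_map_le[OF hC] by simp_all
  have ph': "partially_hyperbolic A g f Es Ec Eu" and pb: "pullback_form A f w = w"
    using ph by (simp_all add: partially_hyperbolic_symplectomorphism_def)
  have spl: "continuous_splitting A Es Ec Eu" and inv: "invariant_subbundle A f Es" "invariant_subbundle A f Ec" "invariant_subbundle A f Eu"
    using ph' by (simp_all add: partially_hyperbolic_def)
  have cont: "Ck_subbundle A 0 Es" "Ck_subbundle A 0 Ec" "Ck_subbundle A 0 Eu"
    and ex1: "\<And>p v. \<exists>!x. case x of (a, b, c) \<Rightarrow> a \<in> Es p \<and> b \<in> Ec p \<and> c \<in> Eu p \<and> v = a + b + c"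
    using spl unfolding continuous_splitting_def by blast+
  have sub: "subspace (Es p)" "subspace (Ec p)" "subspace (Eu p)" for p
    using cont unfolding Ck_subbundle_def by (metis subspace_span)+
  have decomp: "\<exists>a\<in>Es p. \<exists>b\<in>Ec p. \<exists>c\<in>Eu p. v = a + b + c" for p v
    using ex1_implies_ex[OF ex1[of p v]] by auto
  have uniq: "a = 0 \<and> b = 0 \<and> c = 0" if "a \<in> Es p" "b \<in> Ec p" "c \<in> Eu p" "a + b + c = 0" for a b c p
  proof -
    have "(a, b, c) = (0, 0, 0)"
      by (rule ex1E[OF ex1[of p 0]]) (use that sub[of p] in \<open>auto simp: subspace_0\<close>)
    then show ?thesis by simp
  qed
  have dimc: "dim (Ec p) = 2" for p
    using dim_middle_summand[OF sub[of p] decomp uniq] dims[of p] dim4 by simp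
  obtain lam C0 where lam: "0 < lam" "lam < 1" and C0: "0 < C0" and rates:
    "\<forall>n\<ge>1. \<forall>p.
         let nrm = riem_norm g;
             S = (\<lambda>E. {X \<in> E p. nrm p X = 1});
             Dn = (\<lambda>X. nrm ((f ^^ n) p) (tangent_map A (f ^^ n) p X));
             Dm = (\<lambda>X. nrm ((inv f ^^ n) p) (tangent_map A (inv f ^^ n) p X))
         in (\<forall>X \<in> S Es. Dn X \<le> C0 * lam ^ n) \<and>
            (\<forall>X \<in> S Eu. Dm X \<le> C0 * lam ^ n) \<and>
            (\<forall>X \<in> S Es. \<forall>Y \<in> S Ec. Dn X / Dn Y \<le> C0 * lam ^ n) \<and>
            (\<forall>X \<in> S Ec. \<forall>Y \<in> S Eu. Dn X / Dn Y \<le> C0 * lam ^ n)"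
    using ph' unfolding partially_hyperbolic_def by blast
  note pos = riem_norm_pos[OF metric] and scale = riem_norm_scaleR[OF metric]
  have n0: "riem_norm g p 0 = 0" for p using scale[of p 0 0] by simp
  have nn: "riem_norm g p v \<ge> 0" for p v using pos[of v p] n0[of p] by (cases "v = 0") auto
  define D where "D n p v = riem_norm g ((f ^^ n) p) (tangent_map A (f ^^ n) p v)" for n p v
  define D' where "D' n p v = riem_norm g ((inv f ^^ n) p) (tangent_map A (inv f ^^ n) p v)" for n p v
  \<comment> \<open>Later estimates compare \<open>C\<close> with its square, hence the bound from
    below by 1.\<close>
  define C where "C = max 1 C0"
  have Cl: "C0 * lam ^ n \<le> C * lam ^ n" for n using lam by (intro mult_right_mono) (auto simp: C_def)
  have lT: "linear (tangent_map A (f ^^ n) p)" "linear (tangent_map A (inv f ^^ n) p)" for n p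
    by (intro linear_tangent_map_funpow f1 h1)+
  have Dsc: "D n p (t *\<^sub>R v) = \<bar>t\<bar> * D n p v" "D' n p (t *\<^sub>R v) = \<bar>t\<bar> * D' n p v" for n p t v
    unfolding D_def D'_def linear_cmul[OF lT(1)] linear_cmul[OF lT(2)] by (rule scale)+
  have return: "tangent_map A (inv f ^^ n) ((f ^^ n) p) (tangent_map A (f ^^ n) p v) = v" for n p v
    by (rule tangent_map_funpow_inverse[OF f1 h1 hf])
  \<comment> \<open>Invertibility of the tangent maps keeps the denominators of the domination
    quotients positive.\<close>
  have Dpos: "D n p v > 0" if "v \<noteq> 0" for n p v
  proof -
    have "tangent_map A (f ^^ n) p v \<noteq> 0" using return[of n p v] linear_0[OF lT(2)] that by metis
    then show ?thesis unfolding D_def by (rule pos)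
  qed
  define u where "u p v = (1 / riem_norm g p v) *\<^sub>R v" for p v
  have u: "riem_norm g p (u p v) = 1" "v = riem_norm g p v *\<^sub>R u p v" if "v \<noteq> 0" for p v
    using pos[OF that, of p] by (simp_all add: u_def scale)
  have uE: "u p v \<in> E" if "subspace E" "v \<in> E" for p v E unfolding u_def using that by (rule subspace_scale)
  have r: "\<And>n p X. 1 \<le> n \<Longrightarrow> X \<in> Es p \<Longrightarrow> riem_norm g p X = 1 \<Longrightarrow> D n p X \<le> C * lam ^ n"
    "\<And>n p X. 1 \<le> n \<Longrightarrow> X \<in> Eu p \<Longrightarrow> riem_norm g p X = 1 \<Longrightarrow> D' n p X \<le> C * lam ^ n"
    "\<And>n p X Y. 1 \<le> n \<Longrightarrow> X \<in> Es p \<Longrightarrow> riem_norm g p X = 1 \<Longrightarrow> Y \<in> Ec p \<Longrightarrow> riem_norm g p Y = 1 \<Longrightarrow>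
       D n p X / D n p Y \<le> C * lam ^ n"
    "\<And>n p X Y. 1 \<le> n \<Longrightarrow> X \<in> Ec p \<Longrightarrow> riem_norm g p X = 1 \<Longrightarrow> Y \<in> Eu p \<Longrightarrow> riem_norm g p Y = 1 \<Longrightarrow>
       D n p X / D n p Y \<le> C * lam ^ n"
    using rates order_trans[OF _ Cl] by (simp_all add: Let_def D_def D'_def)
  have contr: "D n p X \<le> C * lam ^ n * riem_norm g p X" if "1 \<le> n" "X \<in> Es p" for n p X
  proof (cases "X = 0")
    case False
    have "D n p X = riem_norm g p X * D n p (u p X)" by (subst u(2)[OF False, of p]) (simp add: Dsc nn)
    also have "\<dots> \<le> riem_norm g p X * (C * lam ^ n)"
      using r(1)[OF that(1) uE[OF sub(1) that(2)] u(1)[OF False]] by (intro mult_left_mono nn)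
    finally show ?thesis by (simp add: mult_ac)
  qed (use Dsc(1)[of n p 0 0] n0 in simp)
  have contr': "D' n p X \<le> C * lam ^ n * riem_norm g p X" if "1 \<le> n" "X \<in> Eu p" for n p X
  proof (cases "X = 0")
    case False
    have "D' n p X = riem_norm g p X * D' n p (u p X)" by (subst u(2)[OF False, of p]) (simp add: Dsc nn)
    also have "\<dots> \<le> riem_norm g p X * (C * lam ^ n)"
      using r(2)[OF that(1) uE[OF sub(3) that(2)] u(1)[OF False]] by (intro mult_left_mono nn)
    finally show ?thesis by (simp add: mult_ac)
  qed (use Dsc(2)[of n p 0 0] n0 in simp)
  have dom: "D n p X * riem_norm g p Y \<le> C * lam ^ n * (riem_norm g p X * D n p Y)"
    if unit: "D n p (u p X) / D n p (u p Y) \<le> C * lam ^ n" and "X \<noteq> 0" "Y \<noteq> 0" for n p X Y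
  proof -
    have "u p Y \<noteq> 0" using u(1)[OF \<open>Y \<noteq> 0\<close>, of p] n0 by auto
    then have le: "D n p (u p X) \<le> C * lam ^ n * D n p (u p Y)" using unit Dpos by (simp add: divide_le_eq)
    have "D n p X = riem_norm g p X * D n p (u p X)" "D n p Y = riem_norm g p Y * D n p (u p Y)"
      by (subst u(2)[OF \<open>X \<noteq> 0\<close>, of p], simp add: Dsc nn, subst u(2)[OF \<open>Y \<noteq> 0\<close>, of p], simp add: Dsc nn)
    then have eq: "D n p X * riem_norm g p Y = (riem_norm g p X * riem_norm g p Y) * D n p (u p X)"
      "C * lam ^ n * (riem_norm g p X * D n p Y) = (riem_norm g p X * riem_norm g p Y) * (C * lam ^ n * D n p (u p Y))"
      by simp_all
    show ?thesis unfolding eq by (intro mult_left_mono[OF le] mult_nonneg_nonneg nn)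
  qed
  have dom0: "D n p X * riem_norm g p Y \<le> C * lam ^ n * (riem_norm g p X * D n p Y)" if "X = 0 \<or> Y = 0" for n p X Y
    using that Dsc(1)[of n p 0 0] n0[of p] by auto
  have Tinv: "tangent_map A f p ` E p = E (f p)" if "invariant_subbundle A f E" for p E
    using that by (simp add: invariant_subbundle_def)
  have Tn: "tangent_map A (f ^^ n) p v \<in> Eu ((f ^^ n) p)" if "v \<in> Eu p" for n p v
  proof (induction n)
    case 0
    then show ?case using that tangent_map_id by (simp add: id_def)
  next
    case (Suc n)
    then show ?case unfolding tangent_map_funpow_Suc[OF f1] using Tinv[OF inv(3)] by auto
  qed
  have fn: "(inv f ^^ n) ((f ^^ n) p) = p" for n p by (rule funpow_left_inverse[of "inv f" f, OF hf])
  have "symplectic_splitting A g w f (inv f) Es Ec Eu lam C"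
  proof (unfold_locales)
    show "w (f p) (tangent_map A f p y) (tangent_map A f p z) = w p y z" for p y z
      using fun_cong[OF fun_cong[OF fun_cong[OF pb, of p], of y], of z] by (simp add: pullback_form_def)
    fix n :: nat and p X Y assume n: "1 \<le> n"
    show "riem_norm g ((f ^^ n) p) (tangent_map A (f ^^ n) p X) \<le> C * lam ^ n * riem_norm g p X" if "X \<in> Es p"
      using contr[OF n that] by (simp add: D_def)
    \<comment> \<open>The contraction under the inverse, applied at the n-th image of
      \<open>p\<close> to the image of \<open>X\<close>.\<close>
    show "riem_norm g p X \<le> C * lam ^ n * riem_norm g ((f ^^ n) p) (tangent_map A (f ^^ n) p X)" if "X \<in> Eu p"
      using contr'[OF n Tn[OF that, of n]] by (simp add: D'_def return fn)
    show "riem_norm g ((f ^^ n) p) (tangent_map A (f ^^ n) p X) * riem_norm g p Y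
         \<le> C * lam ^ n * (riem_norm g p X * riem_norm g ((f ^^ n) p) (tangent_map A (f ^^ n) p Y))"
      if "X \<in> Es p" "Y \<in> Ec p"
      using dom[OF r(3)[OF n uE[OF sub(1) that(1)] u(1) uE[OF sub(2) that(2)] u(1)]] dom0[of X Y n p]
      unfolding D_def by blast
    show "riem_norm g ((f ^^ n) p) (tangent_map A (f ^^ n) p X) * riem_norm g p Y
         \<le> C * lam ^ n * (riem_norm g p X * riem_norm g ((f ^^ n) p) (tangent_map A (f ^^ n) p Y))"
      if "X \<in> Ec p" "Y \<in> Eu p"
      using dom[OF r(4)[OF n uE[OF sub(2) that(1)] u(1) uE[OF sub(3) that(2)] u(1)]] dom0[of X Y n p]
      unfolding D_def by blast
  qed (use comp metric symplectic fC hC hf fh cont decomp inv Tinv lam C1 dims dimc in \<open>auto simp: C_def\<close>)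
  then show ?thesis using that by blast
qed

text \<open>\<open>dynamically_coherent\<close> hides its foliation behind an existential
  quantifier. The regularity claim therefore speaks of every center foliation, and in particular of
  the one constructed from chains of plaques; the 2 is the dimension of the center planes.\<close>

theorem theorem1:
  fixes A :: "('m::t2_space, real ^ 4) chart set"
    and g w :: "'m \<Rightarrow> real ^ 4 \<Rightarrow> real ^ 4 \<Rightarrow> real"
    and f :: "'m \<Rightarrow> 'm"
    and Es Ec Eu :: "'m \<Rightarrow> (real ^ 4) set"
  assumes "closed_manifold A" and "riemannian_metric A g" and "symplectic_form A w"
    and "Ck_diffeo A 2 f"
    and "partially_hyperbolic_symplectomorphism A g w f Es Ec Eu"
    and "\<And>p. dim (Es p) = 1" and "\<And>p. dim (Eu p) = 1"
    and "Ck_subbundle A 1 Es" and "Ck_subbundle A 1 Eu"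
  shows "dynamically_coherent A f Ec \<and>
    (\<forall>F. center_foliation A f Ec F \<longrightarrow> foliation A 1 2 F)"
proof -
  have comp: "compact (UNIV :: 'm set)" and smooth: "smooth_atlas A"
    using assms(1) by (simp_all add: closed_manifold_def)
  interpret atlas A by unfold_locales (rule smooth)
  obtain lam C where "symplectic_splitting A g w f (inv f) Es Ec Eu lam C"
    by (rule partially_hyperbolic_splitting[OF comp assms(2-9)]) auto
  then interpret symplectic_splitting_4 A g w f "inv f" Es Ec Eu lam C
    by (simp add: symplectic_splitting_4_def)
  have "bij f" using assms(4) by (simp add: Ck_diffeo_def)
  from center_foliation_exists[OF center_chart_exists comp preserving_center this]
  have "dynamically_coherent A f Ec" by (simp add: dynamically_coherent_def)
  moreover have "foliation A 1 2 F" if "center_foliation A f Ec F" for F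
    using center_foliation_C1[OF center_chart_exists that] unfolding card_center_coordinates .
  ultimately show ?thesis by blast
qed

end
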